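(* Let $X$ be a CHLOTS. The order tree $T(X)$ is an $\Omega$-bounded reproductive tree of height $\Omega$ with $S_0\cong X$ (order isomorphic). The branch space of $T(X)$, with the induced order, is an IHLOTS whose completion is a CHLOTS.
   Context: A LOTS is a totally ordered set with the order topology; it is complete if every nonempty bounded subset has a supremum and infimum. A HLOTS is a LOTS with at least three points which is order isomorphic to every nonempty open convex subset of itself; a CHLOTS is a complete HLOTS, an IHLOTS is a non-complete HLOTS. Every HLOTS is order dense without max or min. The completion of an order dense LOTS $Y$ is the (essentially unique) complete order dense LOTS containing $Y$ as a dense subset and having a max (resp. min) iff $Y$ does. $\Omega$ is the first uncountable ordinal. Order tree. Let $\bullet X\bullet=\{m\}+X+\{M\}$ be $X$ with a minimum $m$ and a maximum $M$ adjoined. For an ordinal $\alpha$ and a function $p:\alpha\to X$ define $\hat p:\alpha+1\to\bullet X\bullet$ by $\hat p(0)=m$ and $\hat p(i)=\sup\{p(j):j<i\}$ for $0<i\le\alpha$. The vertices of $T(X)$ of order $\alpha$ are the functions $p:\alpha\to X$ with $\hat p(i)<p(i)$ for all $i<\alpha$ (sharply increasing) and $\hat p(\alpha)<M$ (bounded). The tree order is $q\prec p$ iff $p$ is a proper extension of $q$ (i.e. $q=p|\beta$ with $\beta$ the domain of $q$ strictly smaller than the domain of $p$). The immediate successors of $p:\alpha\to X$ (functions on $\alpha+1$ extending $p$) are linearly ordered by their value at $\alpha$. General tree notions. For $p$ in a tree $T$ (partially ordered set with well-ordered predecessor sets), $o(p)$ is the order type of its predecessor set, $T_p$ consists of $p$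 and all elements above it, $S_p=\{q\in T_p:o(q)=o(p)+1\}$, and $0$ is the root. The height $h(A)$ of $A\subset T$ is the least ordinal greater than all $o(p)$, $p\in A$. A branch is a maximal linearly ordered subset; $x_i$ denotes the element of order $i$ of a branch $x$. $T$ is bi-ordered if each nonempty $S_p$ carries a linear order; then the branch space $X(T)$ (the set of branches) is ordered by: $x<y$ iff for some $\epsilon$, $x_\epsilon=y_\epsilon$ and $x_{\epsilon+1}<y_{\epsilon+1}$ in $S_{x_\epsilon}$. $T$ is $\Omega$-bounded if $h(x)<\Omega$ for every branch $x$. $T$ is reproductive if for every $p\in T$ there is a bijection $T\to T_p$ preserving in both directions $\prec$ and the linear orders on successor sets. *)

theory Defs
  imports "HOL-Analysis.Analysis"
begin

section \<open>Linearly ordered spaces\<close>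

text \<open>
  A LOTS is given by a reflexive linear order \<open>r\<close> (so \<open>Linear_order r\<close>) on the point set \<open>Field r\<close>,
  equipped with the topology \<open>lots_topology r\<close>. Order isomorphism is \<open>iso\<close> from the
  well-order library, which for arbitrary relations means a bijection between the fields that
  preserves and reflects the relations (lemma \<open>iso_iff2\<close>). The generators of the topology include
  \<open>Field r\<close> so that it is the underlying space even for a single point.
\<close>

definition lots_topology :: "'a rel \<Rightarrow> 'a topology" where
  "lots_topology r = topology_generated_by
     (insert (Field r) (underS r ` Field r \<union> aboveS r ` Field r))"

definition order_convex :: "'a rel \<Rightarrow> 'a set \<Rightarrow> bool" where
  "order_convex r J \<longleftrightarrow>
     J \<subseteq> Field r \<and> (\<forall>x\<in>J. \<forall>y\<in>J. \<forall>z. (x, z) \<in> r \<and> (z, y) \<in> r \<longrightarrow> z \<in> J)"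

definition is_supremum :: "'a rel \<Rightarrow> 'a set \<Rightarrow> 'a \<Rightarrow> bool" where
  "is_supremum r S s \<longleftrightarrow> s \<in> Above r S \<and> (\<forall>u\<in>Above r S. (s, u) \<in> r)"

definition is_infimum :: "'a rel \<Rightarrow> 'a set \<Rightarrow> 'a \<Rightarrow> bool" where
  "is_infimum r S s \<longleftrightarrow> s \<in> Under r S \<and> (\<forall>u\<in>Under r S. (u, s) \<in> r)"

definition complete_order :: "'a rel \<Rightarrow> bool" where
  "complete_order r \<longleftrightarrow>
     (\<forall>S\<subseteq>Field r. S \<noteq> {} \<and> Above r S \<noteq> {} \<and> Under r S \<noteq> {} \<longrightarrow>
        (\<exists>s. is_supremum r S s) \<and> (\<exists>s. is_infimum r S s))"

definition order_dense :: "'a rel \<Rightarrow> bool" where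
  "order_dense r \<longleftrightarrow>
     (\<forall>x y. (x, y) \<in> r \<and> x \<noteq> y \<longrightarrow> (\<exists>z. (x, z) \<in> r \<and> x \<noteq> z \<and> (z, y) \<in> r \<and> z \<noteq> y))"

definition has_max :: "'a rel \<Rightarrow> bool" where
  "has_max r \<longleftrightarrow> (\<exists>M\<in>Field r. \<forall>x\<in>Field r. (x, M) \<in> r)"

definition has_min :: "'a rel \<Rightarrow> bool" where
  "has_min r \<longleftrightarrow> (\<exists>m\<in>Field r. \<forall>x\<in>Field r. (m, x) \<in> r)"

definition hlots :: "'a rel \<Rightarrow> bool" where
  "hlots r \<longleftrightarrow> Linear_order r \<and>
     (\<exists>a\<in>Field r. \<exists>b\<in>Field r. \<exists>c\<in>Field r. a \<noteq> b \<and> a \<noteq> c \<and> b \<noteq> c) \<and>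
     (\<forall>J. J \<noteq> {} \<and> openin (lots_topology r) J \<and> order_convex r J \<longrightarrow> (\<exists>f. iso r (Restr r J) f))"

definition chlots :: "'a rel \<Rightarrow> bool" where
  "chlots r \<longleftrightarrow> hlots r \<and> complete_order r"

definition ihlots :: "'a rel \<Rightarrow> bool" where
  "ihlots r \<longleftrightarrow> hlots r \<and> \<not> complete_order r"

text \<open>
  \<open>is_completion r s\<close>: the linear order \<open>s\<close> is a completion of the order dense linear order \<open>r\<close>,
  the inclusion being given by an order embedding \<open>e\<close> with topologically dense image.
\<close>

definition is_completion :: "'a rel \<Rightarrow> 'b rel \<Rightarrow> bool" where
  "is_completion r s \<longleftrightarrow>
     Linear_order s \<and> order_dense s \<and> complete_order s \<and>
     (\<exists>e. e ` Field r \<subseteq> Field s \<and>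
          (\<forall>x\<in>Field r. \<forall>y\<in>Field r. (x, y) \<in> r \<longleftrightarrow> (e x, e y) \<in> s) \<and>
          lots_topology s closure_of (e ` Field r) = Field s) \<and>
     (has_max s \<longleftrightarrow> has_max r) \<and> (has_min s \<longleftrightarrow> has_min r)"


section \<open>Ordinals\<close>

text \<open>
  The elements of \<open>'a ordinal\<close> are the order types of well-orders on subsets of \<open>'a\<close>, that is, the
  ordinals of cardinality at most that of \<open>'a\<close>. The type is well-ordered, and an ordinal \<open>\<alpha>\<close> is
  identified with the initial segment \<open>{..<\<alpha>}\<close>.
\<close>

quotient_type 'a ordinal = "'a rel" / partial: "\<lambda>r s. (r, s) \<in> ordIso"
  morphisms rep_ordinal order_type
proof (rule part_equivpI)
  show "\<exists>r::'a rel. (r, r) \<in> ordIso"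
    by (rule exI[of _ "{}"]) (simp add: ordIso_reflexive)
  show "symp (\<lambda>r s::'a rel. (r, s) \<in> ordIso)"
    by (rule sympI) (rule ordIso_symmetric)
  show "transp (\<lambda>r s::'a rel. (r, s) \<in> ordIso)"
    by (rule transpI) (rule ordIso_transitive)
qed

instantiation ordinal :: (type) wellorder
begin

lift_definition less_eq_ordinal :: "'a ordinal \<Rightarrow> 'a ordinal \<Rightarrow> bool" is "\<lambda>r s. (r, s) \<in> ordLeq"
  by (meson ordIso_ordLeq_trans ordIso_symmetric ordLeq_ordIso_trans)

lift_definition less_ordinal :: "'a ordinal \<Rightarrow> 'a ordinal \<Rightarrow> bool" is "\<lambda>r s. (r, s) \<in> ordLess"
  by (meson ordIso_ordLess_trans ordIso_symmetric ordLess_ordIso_trans)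

instance
proof
  have wo: "Well_order r" if "(r, s) \<in> ordIso" for r s :: "'a rel"
    using that by (simp add: ordIso_def)
  fix x y z :: "'a ordinal"
  show "x < y \<longleftrightarrow> x \<le> y \<and> \<not> y \<le> x"
    by transfer (metis wo not_ordLess_iff_ordLeq ordLess_imp_ordLeq)
  show "x \<le> x"
    by transfer (rule ordIso_imp_ordLeq)
  show "x \<le> y \<Longrightarrow> y \<le> z \<Longrightarrow> x \<le> z"
    by transfer (rule ordLeq_transitive)
  show "x \<le> y \<Longrightarrow> y \<le> x \<Longrightarrow> x = y"
    by transfer (simp add: ordIso_iff_ordLeq)
  show "x \<le> y \<or> y \<le> x"
    by transfer (metis wo ordLeq_total)
next
  fix P :: "'a ordinal \<Rightarrow> bool" and a :: "'a ordinal"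
  assume step: "\<And>x. (\<And>y. y < x \<Longrightarrow> P y) \<Longrightarrow> P x"
  have 1: "(y, x) \<in> inv_image ordLess rep_ordinal" if "y < x" for x y :: "'a ordinal"
    using that by (simp add: less_ordinal_def)
  have "wf (inv_image ordLess (rep_ordinal :: 'a ordinal \<Rightarrow> 'a rel))"
    by (rule wf_inv_image) (rule wf_ordLess)
  then show "P a"
    by (induction a rule: wf_induct_rule) (blast intro: step 1)
qed

end

definition ord_succ :: "'a ordinal \<Rightarrow> 'a ordinal" where
  "ord_succ \<alpha> = (LEAST \<beta>. \<alpha> < \<beta>)"

text \<open>
  The first uncountable ordinal. It exists in \<open>'a ordinal\<close> as soon as the type \<open>'a\<close> is uncountable,
  and is used only in that case.
\<close>

definition Omega :: "'a ordinal" where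
  "Omega = (LEAST \<alpha>. uncountable {..<\<alpha>})"


section \<open>Bi-ordered trees\<close>

text \<open>
  \<open>prec\<close> is the strict tree order; \<open>sord T p\<close> is the reflexive order on the
  successor set of \<open>p\<close>.
\<close>

record 't bitree =
  nodes :: "'t set"
  prec :: "'t rel"
  sord :: "'t \<Rightarrow> 't rel"

definition preds :: "'t bitree \<Rightarrow> 't \<Rightarrow> 't set" where
  "preds T p = {q \<in> nodes T. (q, p) \<in> prec T}"

definition pred_order :: "'t bitree \<Rightarrow> 't \<Rightarrow> 't rel" where
  "pred_order T p = {(a, b). a \<in> preds T p \<and> b \<in> preds T p \<and> (a = b \<or> (a, b) \<in> prec T)}"

definition is_root :: "'t bitree \<Rightarrow> 't \<Rightarrow> bool" where
  "is_root T z \<longleftrightarrow> z \<in> nodes T \<and> (\<forall>p\<in>nodes T. p \<noteq> z \<longrightarrow> (z, p) \<in> prec T)"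

definition root_of :: "'t bitree \<Rightarrow> 't" where
  "root_of T = (THE z. is_root T z)"

definition is_tree :: "'t bitree \<Rightarrow> bool" where
  "is_tree T \<longleftrightarrow>
     prec T \<subseteq> nodes T \<times> nodes T \<and> irrefl (prec T) \<and> trans (prec T) \<and>
     (\<forall>p\<in>nodes T. well_order_on (preds T p) (pred_order T p)) \<and>
     (\<exists>z. is_root T z)"

definition node_ord :: "'t bitree \<Rightarrow> 't \<Rightarrow> 't ordinal" where
  "node_ord T p = order_type (pred_order T p)"

definition cone :: "'t bitree \<Rightarrow> 't \<Rightarrow> 't set" where
  "cone T p = {q \<in> nodes T. q = p \<or> (p, q) \<in> prec T}"

definition succs :: "'t bitree \<Rightarrow> 't \<Rightarrow> 't set" where
  "succs T p = {q \<in> cone T p. node_ord T q = ord_succ (node_ord T p)}"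

definition bi_ordered :: "'t bitree \<Rightarrow> bool" where
  "bi_ordered T \<longleftrightarrow> (\<forall>p\<in>nodes T. linear_order_on (succs T p) (sord T p))"

text \<open>
  The height of any set of nodes of a tree exists in \<open>'t ordinal\<close>, since the orders of the nodes form an
  initial segment of size at most that of \<open>'t\<close>.
\<close>

definition height :: "'t bitree \<Rightarrow> 't set \<Rightarrow> 't ordinal" where
  "height T A = (LEAST \<alpha>. \<forall>p\<in>A. node_ord T p < \<alpha>)"

definition branches :: "'t bitree \<Rightarrow> 't set set" where
  "branches T = {x. pred_on.maxchain (nodes T) (\<lambda>p q. (p, q) \<in> prec T) x}"

definition Omega_bounded :: "'t bitree \<Rightarrow> bool" where
  "Omega_bounded T \<longleftrightarrow> (\<forall>x\<in>branches T. height T x < Omega)"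

text \<open>\<open>branch_at T x i p\<close> says that \<open>p\<close> is the element \<open>x\<^sub>i\<close> of order \<open>i\<close> of the branch \<open>x\<close>.\<close>

definition branch_at :: "'t bitree \<Rightarrow> 't set \<Rightarrow> 't ordinal \<Rightarrow> 't \<Rightarrow> bool" where
  "branch_at T x i p \<longleftrightarrow> p \<in> x \<and> node_ord T p = i"

definition branch_less :: "'t bitree \<Rightarrow> 't set \<Rightarrow> 't set \<Rightarrow> bool" where
  "branch_less T x y \<longleftrightarrow>
     (\<exists>\<epsilon> p a b. branch_at T x \<epsilon> p \<and> branch_at T y \<epsilon> p \<and>
        branch_at T x (ord_succ \<epsilon>) a \<and> branch_at T y (ord_succ \<epsilon>) b \<and>
        a \<noteq> b \<and> (a, b) \<in> sord T p)"

definition branch_space :: "'t bitree \<Rightarrow> 't set rel" where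
  "branch_space T = {(x, y). x \<in> branches T \<and> y \<in> branches T \<and> (x = y \<or> branch_less T x y)}"

definition reproductive :: "'t bitree \<Rightarrow> bool" where
  "reproductive T \<longleftrightarrow>
     (\<forall>p\<in>nodes T. \<exists>f. bij_betw f (nodes T) (cone T p) \<and>
        (\<forall>q\<in>nodes T. \<forall>q'\<in>nodes T. (q, q') \<in> prec T \<longleftrightarrow> (f q, f q') \<in> prec T) \<and>
        (\<forall>q\<in>nodes T. \<forall>a\<in>succs T q. \<forall>b\<in>succs T q.
           (a, b) \<in> sord T q \<longleftrightarrow> (f a, f b) \<in> sord T (f q)))"


section \<open>The order tree\<close>

datatype 'a bulleted = Min_pt | Pt 'a | Max_pt

definition bullet :: "'a rel \<Rightarrow> 'a bulleted rel" where
  "bullet r = (let B = {Min_pt, Max_pt} \<union> Pt ` Field r in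
     {(x, y). x \<in> B \<and> y \<in> B \<and>
        (x = Min_pt \<or> y = Max_pt \<or> (\<exists>a b. x = Pt a \<and> y = Pt b \<and> (a, b) \<in> r))})"

text \<open>
  A function \<open>p : \<alpha> \<rightarrow> X\<close> is a partial map with domain \<open>{..<\<alpha>}\<close>. Taking \<open>\<alpha>\<close> from
  \<open>'a ordinal\<close> is no restriction: a sharply increasing function is injective, so that its domain has at
  most the cardinality of \<open>'a\<close>. Extension of functions is \<open>map_le\<close>.
\<close>

type_synonym 'a vertex = "'a ordinal \<rightharpoonup> 'a"

definition hat :: "'a rel \<Rightarrow> 'a vertex \<Rightarrow> 'a ordinal \<Rightarrow> 'a bulleted" where
  "hat r p i =
     (if {..<i} = {} then Min_pt
      else THE s. is_supremum (bullet r) ((\<lambda>j. Pt (the (p j))) ` {..<i}) s)"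

definition vertex_of_order :: "'a rel \<Rightarrow> 'a ordinal \<Rightarrow> 'a vertex \<Rightarrow> bool" where
  "vertex_of_order r \<alpha> p \<longleftrightarrow>
     dom p = {..<\<alpha>} \<and> ran p \<subseteq> Field r \<and>
     (\<forall>i<\<alpha>. hat r p i \<in> underS (bullet r) (Pt (the (p i)))) \<and>
     hat r p \<alpha> \<in> underS (bullet r) Max_pt"

definition vertices :: "'a rel \<Rightarrow> 'a vertex set" where
  "vertices r = {p. \<exists>\<alpha>. vertex_of_order r \<alpha> p}"

definition order_tree :: "'a rel \<Rightarrow> 'a vertex bitree" where
  "order_tree r = \<lparr>
     nodes = vertices r,
     prec = {(q, p). q \<in> vertices r \<and> p \<in> vertices r \<and> q \<subseteq>\<^sub>m p \<and> q \<noteq> p},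
     sord = (\<lambda>p. {(q, q'). q \<in> vertices r \<and> q' \<in> vertices r \<and>
       (\<exists>\<alpha>. dom p = {..<\<alpha>} \<and> dom q = {..\<alpha>} \<and> dom q' = {..\<alpha>} \<and> p \<subseteq>\<^sub>m q \<and> p \<subseteq>\<^sub>m q' \<and>
            (the (q \<alpha>), the (q' \<alpha>)) \<in> r)})\<rparr>"

end

theory Submission
  imports Defs
begin

text \<open>
  A vertex is determined by its range, a bounded well-ordered subset of \<open>X\<close> each of whose points is
  isolated from the left, and a branch by the union of the ranges along it, a cofinal set of the same
  kind; the order of branches becomes the lexicographic order of the space \<open>L\<close> of these cofinal sets.
  Open rays of \<open>X\<close> are copies of \<open>X\<close>. Hence all cofinalities in \<open>X\<close> are countable, so that these
  sets are countable, and the tree above a vertex is a copy of the whole tree.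

  Now \<open>L\<close> is an \<open>X\<close>-indexed sum of copies of itself. Cutting \<open>X\<close> along a cofinal (or coinitial) sequence
  gives \<open>L = L \<cdot> \<omega> = L \<cdot> \<omega>\<^sup>*\<close> and so \<open>L + L = L\<close>, and by induction well-ordered and reversely well-ordered
  sums of copies of \<open>L\<close> along countable ordinals are copies of \<open>L\<close>. An open lower or upper set in \<open>L\<close>
  decomposes as such a sum along the path followed by the cut, and an arbitrary open convex set is
  the sum of an upper set of a lower set and a lower set of an upper set. The
  branches through a given vertex have no supremum, so \<open>L\<close> is not complete.

  A completion of an HLOTS is isomorphic to its order of Dedekind cuts, and a nonempty open convex
  subset of the completion is a completion of its trace on the HLOTS, hence isomorphic to the whole.
\<close>

section \<open>Order isomorphisms\<close>

text \<open>Every isomorphism is glued from pieces instead: the pieces are copies of one space, so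
  two sums agree as soon as their index orders do. The sharp inequality in the definition of a
  vertex is what makes the tree self-similar. It excludes the supremum of a vertex as the next
  value, so the possible next values form an open final segment of \<open>X\<close> without minimum,
  also at limits. Completeness of \<open>X\<close> enters in reading this inequality: the supremum
  of the earlier values is less than \<open>p i\<close> iff some point less than \<open>p i\<close>
  bounds them, and in this form suprema disappear. A cone has no supremum for the following reason:
  a path above it can be followed past a bound of the cone's vertex, and the cone at the vertex
  reached there is still wholly above and has no minimum. Ordinals are order types over a fixed
  type, so \<open>Omega\<close> makes sense for the nodes only once the vertex type is known to be
  uncountable.\<close>

definition ord_iso :: "('a \<Rightarrow> 'a \<Rightarrow> bool) \<Rightarrow> 'a set \<Rightarrow> ('b \<Rightarrow> 'b \<Rightarrow> bool) \<Rightarrow> 'b set \<Rightarrow> bool" where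
  "ord_iso lt A lt' B \<longleftrightarrow>
     (\<exists>f. bij_betw f A B \<and> (\<forall>x\<in>A. \<forall>y\<in>A. lt x y \<longleftrightarrow> lt' (f x) (f y)))"

lemma ord_iso_sym:
  assumes "ord_iso lt A lt' B"
  shows "ord_iso lt' B lt A"
proof -
  obtain f where f: "bij_betw f A B" "\<And>x y. x \<in> A \<Longrightarrow> y \<in> A \<Longrightarrow> lt x y \<longleftrightarrow> lt' (f x) (f y)"
    using assms unfolding ord_iso_def by auto
  have "bij_betw (inv_into A f) B A"
    using f(1) by (rule bij_betw_inv_into)
  moreover have "lt' x y \<longleftrightarrow> lt (inv_into A f x) (inv_into A f y)" if "x \<in> B" "y \<in> B" for x y
    using f that by (metis bij_betw_imp_surj_on f_inv_into_f inv_into_into)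
  ultimately show ?thesis
    unfolding ord_iso_def by auto
qed

lemma ord_iso_trans:
  assumes "ord_iso lt A lt' B" "ord_iso lt' B lt'' C"
  shows "ord_iso lt A lt'' C"
proof -
  obtain f where f: "bij_betw f A B" "\<And>x y. x \<in> A \<Longrightarrow> y \<in> A \<Longrightarrow> lt x y \<longleftrightarrow> lt' (f x) (f y)"
    using assms(1) unfolding ord_iso_def by auto
  obtain g where g: "bij_betw g B C" "\<And>x y. x \<in> B \<Longrightarrow> y \<in> B \<Longrightarrow> lt' x y \<longleftrightarrow> lt'' (g x) (g y)"
    using assms(2) unfolding ord_iso_def by auto
  show ?thesis
    unfolding ord_iso_def
  proof (intro exI[of _ "g \<circ> f"] conjI ballI)
    show "bij_betw (g \<circ> f) A C"
      using f(1) g(1) by (rule bij_betw_trans)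
    show "lt x y \<longleftrightarrow> lt'' ((g \<circ> f) x) ((g \<circ> f) y)" if "x \<in> A" "y \<in> A" for x y
      using f g that by (simp add: bij_betw_apply)
  qed
qed

text \<open>Both families respect \<open>R\<close>, which compares any two distinct indices, so
  asymmetry of \<open>lt\<close> and \<open>lt'\<close> makes the pieces disjoint. A point therefore
  determines its index, and the piecewise isomorphisms combine into one map.\<close>

lemma ord_iso_glue:
  assumes asym: "\<And>x y. lt x y \<Longrightarrow> \<not> lt y x"
    and asym': "\<And>x y. lt' x y \<Longrightarrow> \<not> lt' y x"
    and tot: "\<And>i j. i \<in> I \<Longrightarrow> j \<in> I \<Longrightarrow> i \<noteq> j \<Longrightarrow> R i j \<or> R j i"
    and A: "\<And>i j x y. i \<in> I \<Longrightarrow> j \<in> I \<Longrightarrow> R i j \<Longrightarrow> x \<in> A i \<Longrightarrow> y \<in> A j \<Longrightarrow> lt x y"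
    and B: "\<And>i j x y. i \<in> I \<Longrightarrow> j \<in> I \<Longrightarrow> R i j \<Longrightarrow> x \<in> B i \<Longrightarrow> y \<in> B j \<Longrightarrow> lt' x y"
    and iso: "\<And>i. i \<in> I \<Longrightarrow> ord_iso lt (A i) lt' (B i)"
  shows "ord_iso lt (\<Union>i\<in>I. A i) lt' (\<Union>i\<in>I. B i)"
proof -
  obtain f where f: "\<And>i. i \<in> I \<Longrightarrow> bij_betw (f i) (A i) (B i)"
    and f_lt: "\<And>i x y. i \<in> I \<Longrightarrow> x \<in> A i \<Longrightarrow> y \<in> A i \<Longrightarrow> lt x y \<longleftrightarrow> lt' (f i x) (f i y)"
    using iso unfolding ord_iso_def by metis
  have disjA: "i = j" if "i \<in> I" "j \<in> I" "x \<in> A i" "x \<in> A j" for i j x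
    using tot A asym that by metis
  have disjB: "i = j" if "i \<in> I" "j \<in> I" "x \<in> B i" "x \<in> B j" for i j x
    using tot B asym' that by metis
  define F where "F x = f (THE i. i \<in> I \<and> x \<in> A i) x" for x
  have F: "F x = f i x" if "i \<in> I" "x \<in> A i" for i x
  proof -
    have "(THE i. i \<in> I \<and> x \<in> A i) = i"
      using that disjA by blast
    then show ?thesis by (simp add: F_def)
  qed
  have FB: "F x \<in> B i" if "i \<in> I" "x \<in> A i" for i x
    using F f that by (metis bij_betw_apply)
  have lt_iff: "lt x y \<longleftrightarrow> lt' (F x) (F y)" if x: "i \<in> I" "x \<in> A i" and y: "j \<in> I" "y \<in> A j" for x y i j
  proof (cases "i = j")
    case True
    then show ?thesis using f_lt F x y by simp
  next
    case False
    then have "R i j \<or> R j i" using tot x y by blast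
    then show ?thesis
      using A[of i j x y] A[of j i y x] B[of i j "F x" "F y"] B[of j i "F y" "F x"] FB x y asym asym' by metis
  qed
  have inj: "inj_on F (\<Union>i\<in>I. A i)"
  proof (rule inj_onI)
    fix x y assume "x \<in> (\<Union>i\<in>I. A i)" "y \<in> (\<Union>i\<in>I. A i)" and eq: "F x = F y"
    then obtain i j where ij: "i \<in> I" "x \<in> A i" "j \<in> I" "y \<in> A j" by blast
    then have "i = j" using FB eq disjB by metis
    then show "x = y"
      using ij F f eq by (metis bij_betw_imp_inj_on inj_onD)
  qed
  have "F ` (\<Union>i\<in>I. A i) = (\<Union>i\<in>I. B i)"
  proof
    show "F ` (\<Union>i\<in>I. A i) \<subseteq> (\<Union>i\<in>I. B i)" using FB by blast
    show "(\<Union>i\<in>I. B i) \<subseteq> F ` (\<Union>i\<in>I. A i)"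
    proof
      fix y assume "y \<in> (\<Union>i\<in>I. B i)"
      then obtain i where i: "i \<in> I" "y \<in> B i" by blast
      then obtain x where "x \<in> A i" "y = f i x"
        using f by (metis bij_betw_imp_surj_on imageE)
      then show "y \<in> F ` (\<Union>i\<in>I. A i)" using i F by (metis UN_I image_eqI)
    qed
  qed
  then show ?thesis
    unfolding ord_iso_def bij_betw_def using inj lt_iff by blast
qed

text \<open>In a dense order without endpoints, a convex set is open in the order topology iff it
  has neither a minimum nor a maximum (\<open>open_convex_openin\<close>,
  \<open>openin_open_convex\<close>). This form keeps the topology out of the constructions.\<close>

definition open_convex :: "('a \<Rightarrow> 'a \<Rightarrow> bool) \<Rightarrow> 'a set \<Rightarrow> bool" where
  "open_convex lt J \<longleftrightarrow> J \<noteq> {} \<and>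
     (\<forall>x\<in>J. \<forall>y\<in>J. \<forall>z. lt x z \<and> lt z y \<longrightarrow> z \<in> J) \<and>
     (\<forall>x\<in>J. (\<exists>y\<in>J. lt y x) \<and> (\<exists>y\<in>J. lt x y))"

lemma open_convex_dual: "open_convex (\<lambda>x y. lt y x) J \<longleftrightarrow> open_convex lt J"
  unfolding open_convex_def by blast

lemma ord_iso_dual: "ord_iso (\<lambda>x y. lt y x) A (\<lambda>x y. lt' y x) B \<longleftrightarrow> ord_iso lt A lt' B"
  unfolding ord_iso_def by blast


section \<open>Homogeneous linear orders\<close>

locale linear_strict =
  fixes X :: "'a set" and lt :: "'a \<Rightarrow> 'a \<Rightarrow> bool" (infix "\<sqsubset>" 50)
  assumes irr: "\<not> x \<sqsubset> x"
    and lt_trans: "x \<sqsubset> y \<Longrightarrow> y \<sqsubset> z \<Longrightarrow> x \<sqsubset> z"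
    and carrier: "x \<sqsubset> y \<Longrightarrow> x \<in> X \<and> y \<in> X"
    and total: "x \<in> X \<Longrightarrow> y \<in> X \<Longrightarrow> x \<noteq> y \<Longrightarrow> x \<sqsubset> y \<or> y \<sqsubset> x"
begin

lemma asym: "x \<sqsubset> y \<Longrightarrow> \<not> y \<sqsubset> x"
  using irr lt_trans by blast

text \<open>Throughout, \<open>\<not> y \<sqsubset> x\<close> takes the place of a reflexive
  comparison of \<open>x\<close> with \<open>y\<close>. The mixed forms of transitivity ask for
  membership of the one point that the strict premise does not place in \<open>X\<close>.\<close>

lemma not_less_trans: "\<not> y \<sqsubset> x \<Longrightarrow> y \<sqsubset> z \<Longrightarrow> x \<in> X \<Longrightarrow> x \<sqsubset> z"
  using total carrier lt_trans by metis

lemma less_not_trans: "x \<sqsubset> y \<Longrightarrow> \<not> z \<sqsubset> y \<Longrightarrow> z \<in> X \<Longrightarrow> x \<sqsubset> z"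
  using total carrier lt_trans by metis

end

text \<open>What remains of an HLOTS when its topology is eliminated (\<open>hlots_iff\<close>). The
  locale serves for \<open>X\<close>, for its dual and, by \<open>cofinal_paths_homogeneous\<close>,
  for the space of cofinal paths.\<close>

locale homogeneous_order = linear_strict +
  assumes nonempty: "X \<noteq> {}"
    and no_min: "x \<in> X \<Longrightarrow> \<exists>y. y \<sqsubset> x"
    and no_max: "x \<in> X \<Longrightarrow> \<exists>y. x \<sqsubset> y"
    and dense: "x \<sqsubset> y \<Longrightarrow> \<exists>z. x \<sqsubset> z \<and> z \<sqsubset> y"
    and homogeneous: "J \<subseteq> X \<Longrightarrow> open_convex lt J \<Longrightarrow> ord_iso lt X lt J"
begin

lemma dual: "homogeneous_order X (\<lambda>x y. y \<sqsubset> x)"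
proof
  show "ord_iso (\<lambda>x y. y \<sqsubset> x) X (\<lambda>x y. y \<sqsubset> x) J" if "J \<subseteq> X" "open_convex (\<lambda>x y. y \<sqsubset> x) J" for J
    using homogeneous[OF that(1)] that(2)
    unfolding open_convex_dual[of lt J] ord_iso_dual[of lt X lt J] by blast
qed (use irr lt_trans carrier total nonempty no_min no_max dense in blast)+

section \<open>Countable cofinality\<close>

lemma increasing_sequence:
  assumes E: "E \<noteq> {}" and step: "\<And>e. e \<in> E \<Longrightarrow> \<exists>e'\<in>E. e \<sqsubset> e'"
    and c: "\<And>n::nat. \<exists>e\<in>E. c n \<sqsubset> e" and "E \<subseteq> X"
  obtains s :: "nat \<Rightarrow> 'a" where "\<And>n. s n \<in> E" "\<And>n. s n \<sqsubset> s (Suc n)" "\<And>n. c n \<sqsubset> s (Suc n)"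
proof -
  have up: "\<exists>e'\<in>E. e \<sqsubset> e' \<and> c n \<sqsubset> e'" if "e \<in> E" for e n
  proof -
    obtain e1 where e1: "e1 \<in> E" "c n \<sqsubset> e1" using c by blast
    obtain e2 where e2: "e2 \<in> E" "e \<sqsubset> e2" using step[OF \<open>e \<in> E\<close>] by blast
    show ?thesis using e1 e2 total[of e1 e2] \<open>E \<subseteq> X\<close> lt_trans by blast
  qed
  have "\<exists>s. \<forall>n. s n \<in> E \<and> (s n \<sqsubset> s (Suc n) \<and> c n \<sqsubset> s (Suc n))"
    by (rule dependent_nat_choice[where P="\<lambda>_ e. e \<in> E" and Q="\<lambda>n e e'. e \<sqsubset> e' \<and> c n \<sqsubset> e'"])
      (use E up in blast)+
  then show ?thesis using that by blast
qed

lemma increasing_mono: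
  assumes "\<And>n. s n \<sqsubset> s (Suc n)" "m < (n::nat)"
  shows "s m \<sqsubset> s n"
  using assms(2)
proof (induction n)
  case (Suc n)
  then show ?case using assms(1) lt_trans by (metis less_Suc_eq)
qed simp

text \<open>The points below some point of \<open>E\<close> form a copy of the whole order; so all sets \<open>E\<close> without a
  maximum have the same cofinality, which is countable because it is for an increasing sequence.\<close>

lemma open_convex_lower:
  assumes "E \<subseteq> X" "E \<noteq> {}" "\<And>e. e \<in> E \<Longrightarrow> \<exists>e'\<in>E. e \<sqsubset> e'"
  shows "open_convex lt {x. \<exists>e\<in>E. x \<sqsubset> e}"
  unfolding open_convex_def
proof (intro conjI ballI allI impI)
  show "{x. \<exists>e\<in>E. x \<sqsubset> e} \<noteq> {}" using assms no_min by blast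
  show "z \<in> {x. \<exists>e\<in>E. x \<sqsubset> e}" if "y \<in> {x. \<exists>e\<in>E. x \<sqsubset> e}" "x \<sqsubset> z \<and> z \<sqsubset> y" for x y z
    using that lt_trans by blast
  fix x assume "x \<in> {x. \<exists>e\<in>E. x \<sqsubset> e}"
  then obtain e e' y where "x \<sqsubset> e" "e \<in> E" "e' \<in> E" "e \<sqsubset> e'" "y \<sqsubset> x"
    using assms(3) no_min carrier by blast
  then show "\<exists>y\<in>{x. \<exists>e\<in>E. x \<sqsubset> e}. y \<sqsubset> x" "\<exists>y\<in>{x. \<exists>e\<in>E. x \<sqsubset> e}. x \<sqsubset> y"
    using lt_trans by blast+
qed

lemma cofinal_sequence:
  obtains c :: "nat \<Rightarrow> 'a" where "\<And>n. c n \<in> X" "\<And>n. c n \<sqsubset> c (Suc n)" "\<And>x. x \<in> X \<Longrightarrow> \<exists>n. x \<sqsubset> c n"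
proof -
  obtain x0 where "x0 \<in> X" using nonempty by blast
  then obtain s :: "nat \<Rightarrow> 'a" where s: "\<And>n. s n \<in> X" "\<And>n. s n \<sqsubset> s (Suc n)"
  proof -
    have "\<exists>e'\<in>X. e \<sqsubset> e'" if "e \<in> X" for e using no_max[OF that] carrier by blast
    moreover have "\<exists>e\<in>X. x0 \<sqsubset> e" using no_max[OF \<open>x0 \<in> X\<close>] carrier by blast
    ultimately show thesis
      using increasing_sequence[OF nonempty, of "\<lambda>_. x0"] that by (metis order_refl)
  qed
  \<comment> \<open>\<open>s\<close> need not be cofinal in \<open>X\<close>, but it is cofinal in
    \<open>W\<close>, and the isomorphism of \<open>W\<close> with \<open>X\<close> carries it to a
    cofinal sequence.\<close>
  define W where "W = {x. \<exists>e\<in>range s. x \<sqsubset> e}"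
  have "open_convex lt W"
    unfolding W_def using s by (intro open_convex_lower) blast+
  moreover have "W \<subseteq> X" unfolding W_def using carrier by blast
  ultimately have "ord_iso lt W lt X" using homogeneous ord_iso_sym by blast
  then obtain f where f: "bij_betw f W X" "\<And>x y. x \<in> W \<Longrightarrow> y \<in> W \<Longrightarrow> x \<sqsubset> y \<longleftrightarrow> f x \<sqsubset> f y"
    unfolding ord_iso_def by auto
  have sW: "s n \<in> W" for n unfolding W_def using s by blast
  show ?thesis
  proof (rule that[of "\<lambda>n. f (s n)"])
    show "f (s n) \<in> X" for n using sW f(1) by (simp add: bij_betw_apply)
    show "f (s n) \<sqsubset> f (s (Suc n))" for n using f(2)[OF sW sW] s(2) by simp
    show "\<exists>n. x \<sqsubset> f (s n)" if x: "x \<in> X" for x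
    proof -
      obtain w where w: "w \<in> W" "x = f w" using bij_betw_imp_surj_on[OF f(1)] x by blast
      then obtain n where "w \<sqsubset> s n" unfolding W_def by blast
      then have "f w \<sqsubset> f (s n)" using w f(2)[OF w(1) sW] by simp
      then show ?thesis using w by blast
    qed
  qed
qed

lemma cofinal_sequence_in:
  assumes "E \<subseteq> X" "E \<noteq> {}" "\<And>e. e \<in> E \<Longrightarrow> \<exists>e'\<in>E. e \<sqsubset> e'"
  obtains s :: "nat \<Rightarrow> 'a" where "\<And>n. s n \<in> E" "\<And>n. s n \<sqsubset> s (Suc n)" "\<And>e. e \<in> E \<Longrightarrow> \<exists>n. e \<sqsubset> s n"
proof -
  define W where "W = {x. \<exists>e\<in>E. x \<sqsubset> e}"
  have "open_convex lt W" "W \<subseteq> X"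
    unfolding W_def using assms carrier by (auto intro: open_convex_lower)
  then have "ord_iso lt X lt W" by (intro homogeneous)
  then obtain f where f: "bij_betw f X W" "\<And>x y. x \<in> X \<Longrightarrow> y \<in> X \<Longrightarrow> x \<sqsubset> y \<longleftrightarrow> f x \<sqsubset> f y"
    unfolding ord_iso_def by auto
  obtain c :: "nat \<Rightarrow> 'a" where c: "\<And>n. c n \<in> X" "\<And>n. c n \<sqsubset> c (Suc n)" "\<And>x. x \<in> X \<Longrightarrow> \<exists>n. x \<sqsubset> c n"
    using cofinal_sequence by blast
  \<comment> \<open>The sequence \<open>f (c n)\<close> is cofinal in \<open>W\<close> but may miss
    \<open>E\<close>; each of its terms is overtaken by a point of \<open>E\<close>.\<close>
  have "\<exists>e\<in>E. f (c n) \<sqsubset> e" for n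
    using f(1) c(1) bij_betw_apply W_def by fastforce
  then obtain s :: "nat \<Rightarrow> 'a" where s: "\<And>n. s n \<in> E" "\<And>n. s n \<sqsubset> s (Suc n)" "\<And>n. f (c n) \<sqsubset> s (Suc n)"
    using increasing_sequence[OF assms(2,3) _ assms(1), of "\<lambda>n. f (c n)"] by blast
  show ?thesis
  proof (rule that[of s, OF s(1,2)])
    fix e assume "e \<in> E"
    then have "e \<in> W" using assms(3) by (auto simp: W_def)
    then obtain x where x: "x \<in> X" "e = f x" using bij_betw_imp_surj_on[OF f(1)] by blast
    then obtain n where "x \<sqsubset> c n" using c by blast
    then have "e \<sqsubset> f (c n)" using f(2) x c by blast
    then show "\<exists>n. e \<sqsubset> s n" using s(3) lt_trans by blast
  qed
qed

text \<open>The decomposition \<open>(-\<infinity>, c\<^sub>0) \<union> {c\<^sub>0} \<union> (c\<^sub>0, c\<^sub>1) \<union> {c\<^sub>1} \<union> \<dots>\<close>.\<close>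

lemma omega_decomposition:
  obtains I :: "nat \<Rightarrow> 'a set" where "(\<Union>n. I n) = X"
    "\<And>n. open_convex lt (I n) \<or> (\<exists>x. I n = {x})"
    "\<And>m n x y. m < n \<Longrightarrow> x \<in> I m \<Longrightarrow> y \<in> I n \<Longrightarrow> x \<sqsubset> y"
proof -
  obtain c :: "nat \<Rightarrow> 'a" where c: "\<And>n. c n \<in> X" "\<And>n. c n \<sqsubset> c (Suc n)" "\<And>x. x \<in> X \<Longrightarrow> \<exists>n. x \<sqsubset> c n"
    using cofinal_sequence by blast
  note c_mono = increasing_mono[of c, OF c(2)]
  \<comment> \<open>Index \<open>2 * n + 1\<close> holds the point \<open>c n\<close>, and index
    \<open>2 * n\<close> the open interval that ends in \<open>c n\<close>. The interval starts at
    \<open>c (n - 1)\<close>, or is unbounded below for \<open>n = 0\<close>, where the guard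
    \<open>k > 0\<close> hides the truncated subtraction.\<close>
  define I where "I k = (if odd k then {c (k div 2)}
     else {x. (k > 0 \<longrightarrow> c (k div 2 - 1) \<sqsubset> x) \<and> x \<sqsubset> c (k div 2)})" for k
  have upper: "\<not> c (k div 2) \<sqsubset> x \<and> (even k \<longrightarrow> x \<sqsubset> c (k div 2)) \<and> x \<in> X" if "x \<in> I k" for k x
    using that irr asym carrier c(1) by (auto simp: I_def split: if_splits)
  have lower: "c (k div 2 - 1) \<sqsubset> x" if "x \<in> I k" "even k" "k > 0" for k x
    using that by (auto simp: I_def)
  show ?thesis
  proof (rule that[of I])
    show "(\<Union>n. I n) = X"
    proof
      show "(\<Union>n. I n) \<subseteq> X" using upper by blast
      show "X \<subseteq> (\<Union>n. I n)"
      proof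
        fix x assume x: "x \<in> X"
        define n where "n = (LEAST n. x \<sqsubset> c n)"
        have n: "x \<sqsubset> c n" unfolding n_def using c(3)[OF x] by (rule LeastI_ex)
        have least: "\<not> x \<sqsubset> c m" if "m < n" for m using that not_less_Least n_def by metis
        consider "n = 0" | m where "n = Suc m" "x = c m" | m where "n = Suc m" "c m \<sqsubset> x"
          using least total[OF x c(1)] by (metis lessI not0_implies_Suc)
        then show "x \<in> (\<Union>n. I n)"
        proof cases
          case 1
          then have "x \<in> I 0" using n by (simp add: I_def)
          then show ?thesis by blast
        next
          case 2
          then have "x \<in> I (2 * m + 1)" by (simp add: I_def)
          then show ?thesis by blast
        next
          case 3
          then have "x \<in> I (2 * Suc m)" using n by (simp add: I_def)
          then show ?thesis by blast
        qed
      qed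
    qed
    show "open_convex lt (I k) \<or> (\<exists>x. I k = {x})" for k
    proof (cases "odd k")
      case True
      then show ?thesis by (simp add: I_def)
    next
      case False
      have "\<exists>x. x \<in> I k"
      proof (cases "k = 0")
        case True
        then show ?thesis using no_min c(1) by (simp add: I_def)
      next
        case k: False
        then have "c (k div 2 - 1) \<sqsubset> c (k div 2)" using False by (intro c_mono) auto
        then show ?thesis using dense[of "c (k div 2 - 1)"] False by (auto simp: I_def)
      qed
      moreover have "(\<exists>y\<in>I k. y \<sqsubset> x) \<and> (\<exists>y\<in>I k. x \<sqsubset> y)" if x: "x \<in> I k" for x
      proof
        have "x \<sqsubset> c (k div 2)" using upper x False by blast
        then obtain z where z: "x \<sqsubset> z" "z \<sqsubset> c (k div 2)" using dense by blast
        then have "z \<in> I k" using x False lt_trans by (simp add: I_def) blast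
        then show "\<exists>y\<in>I k. x \<sqsubset> y" using z by blast
        show "\<exists>y\<in>I k. y \<sqsubset> x"
        proof (cases "k = 0")
          case True
          obtain y where "y \<sqsubset> x" using no_min upper x by blast
          then have "y \<in> I k" using True x lt_trans[of y x] by (simp add: I_def)
          then show ?thesis using \<open>y \<sqsubset> x\<close> by blast
        next
          case k: False
          then obtain y where y: "c (k div 2 - 1) \<sqsubset> y" "y \<sqsubset> x" using dense[OF lower[OF x]] False by blast
          then have "y \<in> I k" using k False x lt_trans[of y x] by (simp add: I_def)
          then show ?thesis using y by blast
        qed
      qed
      moreover have "z \<in> I k" if "x \<in> I k" "y \<in> I k" "x \<sqsubset> z" "z \<sqsubset> y" for x y z
        using that False lt_trans by (simp add: I_def) blast
      ultimately show ?thesis unfolding open_convex_def by blast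
    qed
    show "x \<sqsubset> y" if "m < n" "x \<in> I m" "y \<in> I n" for m n x y
    proof (cases "odd n")
      case True
      then have y: "y = c (n div 2)" using that by (simp add: I_def)
      show ?thesis
      proof (cases "m div 2 = n div 2")
        case eq: True
        then have "even m" using \<open>m < n\<close> True by presburger
        then show ?thesis using upper that y eq by metis
      next
        case False
        then have "m div 2 < n div 2" using \<open>m < n\<close> div_le_mono[of m n 2] by linarith
        then show ?thesis using upper[OF that(2)] y c_mono not_less_trans by blast
      qed
    next
      case False
      then have y: "c (n div 2 - 1) \<sqsubset> y" using lower that by auto
      have "m div 2 \<le> n div 2 - 1" using \<open>m < n\<close> False by presburger
      then have "\<not> c (n div 2 - 1) \<sqsubset> x"
        using upper[OF that(2)] c_mono lt_trans by (metis le_neq_implies_less)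
      then show ?thesis using y not_less_trans upper[OF that(2)] by blast
    qed
  qed
qed

section \<open>Well-ordered subsets and unions along them\<close>

definition well_ordered :: "'a set \<Rightarrow> bool" where
  "well_ordered D \<longleftrightarrow> D \<subseteq> X \<and> (\<forall>S\<subseteq>D. S \<noteq> {} \<longrightarrow> (\<exists>m\<in>S. \<forall>y\<in>S. \<not> y \<sqsubset> m))"

lemma well_ordered_induct [consumes 2, case_names less]:
  assumes "well_ordered D" "d \<in> D"
    and "\<And>d. d \<in> D \<Longrightarrow> (\<And>e. e \<in> D \<Longrightarrow> e \<sqsubset> d \<Longrightarrow> P e) \<Longrightarrow> P d"
  shows "P d"
proof (rule ccontr)
  assume "\<not> P d"
  then have "{d\<in>D. \<not> P d} \<noteq> {}" using assms(2) by blast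
  then obtain m where "m \<in> {d\<in>D. \<not> P d}" "\<forall>y\<in>{d\<in>D. \<not> P d}. \<not> y \<sqsubset> m"
    using assms(1) unfolding well_ordered_def by (metis (no_types, lifting) mem_Collect_eq subsetI)
  then show False using assms(3) by blast
qed

text \<open>By transfinite induction along the well-ordered set, whose cofinalities are all countable.\<close>

lemma well_ordered_union:
  fixes K :: "'a \<Rightarrow> 'b set" and bef :: "'b \<Rightarrow> 'b \<Rightarrow> bool"
  assumes D: "well_ordered D" "D \<noteq> {}"
    and bin: "\<And>K K'. good K \<Longrightarrow> good K' \<Longrightarrow> \<forall>x\<in>K. \<forall>y\<in>K'. bef x y \<Longrightarrow> good (K \<union> K')"
    and omega: "\<And>K :: nat \<Rightarrow> 'b set. (\<And>n. good (K n)) \<Longrightarrow>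
        (\<And>m n x y. m < n \<Longrightarrow> x \<in> K m \<Longrightarrow> y \<in> K n \<Longrightarrow> bef x y) \<Longrightarrow> good (\<Union>n. K n)"
    and K: "\<And>d. d \<in> D \<Longrightarrow> good (K d)"
    and bef: "\<And>d e x y. d \<in> D \<Longrightarrow> e \<in> D \<Longrightarrow> d \<sqsubset> e \<Longrightarrow> x \<in> K d \<Longrightarrow> y \<in> K e \<Longrightarrow> bef x y"
  shows "good (\<Union>d\<in>D. K d)"
proof -
  have DX: "D \<subseteq> X" using D(1) by (simp add: well_ordered_def)
  \<comment> \<open>The induction hypothesis speaks of the subsets of \<open>E\<close> bounded by an
    element of \<open>E\<close>, so only the end of \<open>E\<close> matters: a maximum splits off a
    single piece, and otherwise a cofinal sequence cuts \<open>E\<close> into omega many bounded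
    blocks.\<close>
  have step: "good (\<Union>d\<in>E. K d)"
    if E: "E \<subseteq> D" "E \<noteq> {}"
      and IH: "\<And>e E'. e \<in> E \<Longrightarrow> E' \<subseteq> E \<Longrightarrow> E' \<noteq> {} \<Longrightarrow> \<forall>x\<in>E'. x \<sqsubset> e \<Longrightarrow> good (\<Union>d\<in>E'. K d)" for E
  proof (cases "\<exists>b\<in>E. \<forall>e\<in>E. \<not> b \<sqsubset> e")
    case True
    then obtain b where b: "b \<in> E" "\<forall>e\<in>E. \<not> b \<sqsubset> e" by blast
    have below: "\<forall>x\<in>E - {b}. x \<sqsubset> b" using b E DX total by blast
    show ?thesis
    proof (cases "E = {b}")
      case True
      then show ?thesis using K E by simp
    next
      case False
      then have "good (\<Union>d\<in>E-{b}. K d)" using IH[OF b(1) _ _ below] b by blast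
      moreover have "\<forall>x\<in>\<Union>d\<in>E-{b}. K d. \<forall>y\<in>K b. bef x y"
        using bef below b E by blast
      ultimately have "good ((\<Union>d\<in>E-{b}. K d) \<union> K b)" using bin K b E by blast
      moreover have "(\<Union>d\<in>E-{b}. K d) \<union> K b = (\<Union>d\<in>E. K d)" using b by blast
      ultimately show ?thesis by simp
    qed
  next
    case False
    then obtain s :: "nat \<Rightarrow> 'a" where s: "\<And>n. s n \<in> E" "\<And>n. s n \<sqsubset> s (Suc n)" "\<And>e. e \<in> E \<Longrightarrow> \<exists>n. e \<sqsubset> s n"
      using cofinal_sequence_in[of E] E DX by (metis order_trans)
    note s_mono = increasing_mono[where s = s, OF s(2)]
    \<comment> \<open>\<open>F n\<close> is the part of \<open>E\<close> above all earlier terms and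
      at most \<open>s n\<close>. Including the right end keeps every block nonempty and strictly
      bounded by \<open>s (Suc n)\<close>, as the induction hypothesis demands.\<close>
    define F where "F n = {e\<in>E. \<not> s n \<sqsubset> e \<and> (\<forall>m<n. s m \<sqsubset> e)}" for n
    have F_lt: "x \<sqsubset> y" if "m < n" "x \<in> F m" "y \<in> F n" for m n x y
      using that E DX not_less_trans unfolding F_def by blast
    have "good (\<Union>n. \<Union>d\<in>F n. K d)"
    proof (rule omega)
      fix n
      have "F n \<subseteq> E" "s n \<in> F n" using s irr s_mono unfolding F_def by auto
      moreover have "\<forall>x\<in>F n. x \<sqsubset> s (Suc n)"
        using s E DX not_less_trans unfolding F_def by blast
      ultimately show "good (\<Union>d\<in>F n. K d)" using IH[OF s(1)] by blast
    next
      fix m n :: nat and x y assume "m < n" "x \<in> (\<Union>d\<in>F m. K d)" "y \<in> (\<Union>d\<in>F n. K d)"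
      then obtain d e where "d \<in> F m" "e \<in> F n" "x \<in> K d" "y \<in> K e" by blast
      then show "bef x y"
        using bef[of d e] F_lt[OF \<open>m < n\<close>] E unfolding F_def by blast
    qed
    moreover have "(\<Union>n. F n) = E"
    proof
      show "E \<subseteq> (\<Union>n. F n)"
      proof
        fix e assume e: "e \<in> E"
        define n where "n = (LEAST n. \<not> s n \<sqsubset> e)"
        have "\<exists>n. \<not> s n \<sqsubset> e" using s(3)[OF e] asym by blast
        then have "\<not> s n \<sqsubset> e" unfolding n_def by (rule LeastI_ex)
        moreover have "s m \<sqsubset> e" if "m < n" for m using that not_less_Least n_def by metis
        ultimately show "e \<in> (\<Union>n. F n)" using e unfolding F_def by blast
      qed
    qed (auto simp: F_def)
    ultimately show ?thesis by (metis UN_UN_flatten)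
  qed
  \<comment> \<open>The claim is about all bounded subsets rather than only the initial segments of
    \<open>D\<close>, because the blocks \<open>F n\<close> are not initial segments.\<close>
  have "\<forall>E\<subseteq>D. E \<noteq> {} \<and> (\<forall>x\<in>E. x \<sqsubset> b) \<longrightarrow> good (\<Union>d\<in>E. K d)" if "b \<in> D" for b
    using D(1) that
  proof (induction b rule: well_ordered_induct)
    case (less b)
    show ?case
    proof (intro allI impI)
      fix E assume E: "E \<subseteq> D" "E \<noteq> {} \<and> (\<forall>x\<in>E. x \<sqsubset> b)"
      show "good (\<Union>d\<in>E. K d)"
      proof (rule step)
        fix e E' assume E': "e \<in> E" "E' \<subseteq> E" "E' \<noteq> {}" "\<forall>x\<in>E'. x \<sqsubset> e"
        then have "e \<in> D" "e \<sqsubset> b" using E by auto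
        then show "good (\<Union>d\<in>E'. K d)" using less.IH[of e] E' E by (meson subset_trans)
      qed (use E in auto)
    qed
  qed
  then show ?thesis
    by (intro step[OF order_refl D(2)]) blast
qed

text \<open>\<open>well_ordered_union\<close> for singletons, with countability as the property
  \<open>good\<close>. It makes all paths countable, and hence keeps the orders of the vertices
  below \<open>Omega\<close>.\<close>

lemma well_ordered_countable:
  assumes "well_ordered D"
  shows "countable D"
proof (cases "D = {}")
  case False
  have "countable (\<Union>d\<in>D. {d})"
    by (rule well_ordered_union[OF assms False, where bef = "\<lambda>_ _. True"]) auto
  then show ?thesis by simp
qed simp

end

section \<open>Paths\<close>

definition initial_seg :: "('a \<Rightarrow> 'a \<Rightarrow> bool) \<Rightarrow> 'a set \<Rightarrow> 'a set \<Rightarrow> bool" where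
  "initial_seg lt A B \<longleftrightarrow> A \<subseteq> B \<and> (\<forall>x\<in>A. \<forall>y\<in>B. lt y x \<longrightarrow> y \<in> A)"

definition below :: "('a \<Rightarrow> 'a \<Rightarrow> bool) \<Rightarrow> 'a set \<Rightarrow> 'a \<Rightarrow> 'a set" where
  "below lt B x = {y\<in>B. lt y x}"

context linear_strict
begin

text \<open>The points that can continue a path \<open>A\<close>: those above \<open>A\<close> but not its supremum.\<close>

definition extensions :: "'a set \<Rightarrow> 'a set" where
  "extensions A = {x. \<exists>z. z \<sqsubset> x \<and> (\<forall>y\<in>A. \<not> z \<sqsubset> y)}"

text \<open>Paths are the ranges of the sharply increasing functions into \<open>X\<close>; vertices of the
  order tree correspond to bounded paths, and branches to unbounded ones.\<close>

definition is_path :: "'a set \<Rightarrow> bool" where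
  "is_path D \<longleftrightarrow> (\<forall>S\<subseteq>D. S \<noteq> {} \<longrightarrow> (\<exists>m\<in>S. \<forall>y\<in>S. \<not> y \<sqsubset> m)) \<and> (\<forall>d\<in>D. d \<in> extensions (below lt D d))"

definition bounded_paths :: "'a set set" where
  "bounded_paths = {D. is_path D \<and> (\<exists>z\<in>X. \<forall>y\<in>D. \<not> z \<sqsubset> y)}"

definition cofinal_paths :: "'a set set" where
  "cofinal_paths = {D. is_path D \<and> (\<forall>z\<in>X. \<exists>y\<in>D. z \<sqsubset> y)}"

text \<open>At the first point where two cofinal paths differ, the path that owns the point is the
  smaller one: the other, being cofinal, has its next point further up. This is the order by the
  first differing value of the increasing sequences.\<close>

definition lex :: "'a set \<Rightarrow> 'a set \<Rightarrow> bool" where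
  "lex B C \<longleftrightarrow> B \<in> cofinal_paths \<and> C \<in> cofinal_paths \<and>
     (\<exists>x. x \<in> B \<and> x \<notin> C \<and> (\<forall>y. y \<sqsubset> x \<longrightarrow> (y \<in> B \<longleftrightarrow> y \<in> C)))"

text \<open>The branches through the vertex \<open>A\<close>.\<close>

definition path_cone :: "'a set \<Rightarrow> 'a set set" where
  "path_cone A = {B\<in>cofinal_paths. initial_seg lt A B}"

text \<open>For \<open>I\<close> inside \<open>extensions A\<close>, a sum over \<open>I\<close> of
  the cones at immediate successors of \<open>A\<close>; fans are the building blocks of the later
  decompositions.\<close>

definition fan :: "'a set \<Rightarrow> 'a set \<Rightarrow> 'a set set" where
  "fan A I = (\<Union>x\<in>I. path_cone (insert x A))"

lemma extensions_subset: "extensions A \<subseteq> X"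
  unfolding extensions_def using carrier by blast

lemma extensions_above: "x \<in> extensions A \<Longrightarrow> y \<in> A \<Longrightarrow> A \<subseteq> X \<Longrightarrow> y \<sqsubset> x"
  unfolding extensions_def using not_less_trans by blast

lemma extensions_not_mem: "x \<in> extensions A \<Longrightarrow> x \<notin> A"
  unfolding extensions_def by blast

lemma extensions_up: "x \<in> extensions A \<Longrightarrow> x \<sqsubset> y \<Longrightarrow> y \<in> extensions A"
  unfolding extensions_def using lt_trans by blast

lemma extensions_antimono: "x \<in> extensions A \<Longrightarrow> B \<subseteq> A \<Longrightarrow> x \<in> extensions B"
  unfolding extensions_def by blast

lemma path_subset: "is_path D \<Longrightarrow> D \<subseteq> X"
  unfolding is_path_def using extensions_subset by blast

lemma path_min:
  assumes "is_path D" "S \<subseteq> D" "S \<noteq> {}"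
  obtains m where "m \<in> S" "\<And>y. y \<in> S \<Longrightarrow> y \<noteq> m \<Longrightarrow> m \<sqsubset> y"
proof -
  obtain m where "m \<in> S" "\<forall>y\<in>S. \<not> y \<sqsubset> m"
    using assms unfolding is_path_def by blast
  then show ?thesis using that path_subset assms(1,2) total by blast
qed

lemma path_well_ordered: "is_path D \<Longrightarrow> S \<subseteq> D \<Longrightarrow> S \<noteq> {} \<Longrightarrow> \<exists>m\<in>S. \<forall>y\<in>S. \<not> y \<sqsubset> m"
  unfolding is_path_def by blast

lemma path_extensions: "is_path D \<Longrightarrow> d \<in> D \<Longrightarrow> d \<in> extensions (below lt D d)"
  unfolding is_path_def by blast

lemma below_mono: "A \<subseteq> B \<Longrightarrow> below lt A x \<subseteq> below lt B x"
  unfolding below_def by blast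

lemma path_mono:
  assumes "is_path D" "E \<subseteq> D"
  shows "is_path E"
  unfolding is_path_def
proof (intro conjI allI ballI impI)
  show "\<exists>m\<in>S. \<forall>y\<in>S. \<not> y \<sqsubset> m" if "S \<subseteq> E" "S \<noteq> {}" for S
    using path_well_ordered[OF assms(1)] assms(2) that by blast
  show "d \<in> extensions (below lt E d)" if "d \<in> E" for d
    using path_extensions[OF assms(1)] extensions_antimono below_mono assms(2) that by (metis subsetD)
qed

lemma bounded_path_subset: "A \<in> bounded_paths \<Longrightarrow> A \<subseteq> X"
  by (simp add: bounded_paths_def path_subset)

lemma cofinal_path_subset: "A \<in> cofinal_paths \<Longrightarrow> A \<subseteq> X"
  by (simp add: cofinal_paths_def path_subset)

lemma path_cases: "is_path D \<Longrightarrow> D \<in> bounded_paths \<or> D \<in> cofinal_paths"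
  unfolding bounded_paths_def cofinal_paths_def by blast

lemma bounded_paths_mono: "D \<in> bounded_paths \<Longrightarrow> E \<subseteq> D \<Longrightarrow> E \<in> bounded_paths"
  unfolding bounded_paths_def using path_mono by blast

lemma below_bounded:
  assumes "is_path D" "d \<in> D"
  shows "below lt D d \<in> bounded_paths"
proof -
  have "is_path (below lt D d)" by (rule path_mono[OF assms(1)]) (auto simp: below_def)
  moreover have "d \<in> X" "\<forall>y\<in>below lt D d. \<not> d \<sqsubset> y"
    using path_subset assms asym by (auto simp: below_def)
  ultimately show ?thesis unfolding bounded_paths_def by blast
qed

section \<open>Initial segments and first differences\<close>

lemma initial_seg_refl [simp]: "initial_seg lt A A"
  by (simp add: initial_seg_def)

lemma initial_seg_empty [simp]: "initial_seg lt {} B"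
  by (simp add: initial_seg_def)

lemma initial_seg_trans: "initial_seg lt A B \<Longrightarrow> initial_seg lt B C \<Longrightarrow> initial_seg lt A C"
  unfolding initial_seg_def by blast

lemma initial_seg_subset: "initial_seg lt A B \<Longrightarrow> A \<subseteq> B"
  by (simp add: initial_seg_def)

lemma initial_seg_below: "initial_seg lt (below lt B x) B"
  unfolding initial_seg_def below_def using lt_trans by blast

lemma initial_seg_below_eq: "initial_seg lt A B \<Longrightarrow> x \<in> A \<Longrightarrow> below lt A x = below lt B x"
  unfolding initial_seg_def below_def by blast

lemma initial_seg_insert_below: 
  assumes "x \<in> B" "B \<subseteq> X"
  shows "initial_seg lt (insert x (below lt B x)) B"
  unfolding initial_seg_def below_def using assms lt_trans by blast

text \<open>The point \<open>x\<close> is the least element of \<open>B - A\<close>. What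
  \<open>B\<close> has below it is in \<open>A\<close>, and \<open>A\<close>, as an initial segment,
  lies below it; so \<open>x\<close> is the next value of \<open>B\<close> after
  \<open>A\<close>.\<close>

lemma initial_seg_next:
  assumes "is_path B" "initial_seg lt A B" "A \<noteq> B"
  obtains x where "x \<in> B" "x \<in> extensions A" "A = below lt B x" "initial_seg lt (insert x A) B"
proof -
  have "B - A \<noteq> {}" using assms(2,3) unfolding initial_seg_def by blast
  then obtain x where x: "x \<in> B - A" and min: "\<And>y. y \<in> B - A \<Longrightarrow> y \<noteq> x \<Longrightarrow> x \<sqsubset> y"
    using path_min[OF assms(1), of "B - A"] by blast
  have BX: "B \<subseteq> X" using path_subset[OF assms(1)] .
  have A: "A = below lt B x"
  proof (intro equalityI subsetI)
    fix y assume y: "y \<in> A"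
    then have "y \<noteq> x" "\<not> x \<sqsubset> y" "y \<in> B" using x assms(2) unfolding initial_seg_def by blast+
    then show "y \<in> below lt B x" using total[of x y] BX x unfolding below_def by blast
  next
    fix y assume "y \<in> below lt B x"
    then show "y \<in> A" using min[of y] asym irr unfolding below_def by blast
  qed
  show ?thesis
  proof (rule that[of x])
    show "x \<in> extensions A" using path_extensions[OF assms(1)] x A by blast
    show "initial_seg lt (insert x A) B" using initial_seg_insert_below[of x B] x BX A by blast
  qed (use x A in auto)
qed

text \<open>Indexes the proper initial segments by points, so that the predecessors of a vertex can
  be read off from the points of its range.\<close>

lemma proper_initial_seg_iff:
  assumes "is_path B"
  shows "initial_seg lt A B \<and> A \<noteq> B \<longleftrightarrow> (\<exists>b\<in>B. A = below lt B b)"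
proof
  assume "initial_seg lt A B \<and> A \<noteq> B"
  then show "\<exists>b\<in>B. A = below lt B b"
    using initial_seg_next[OF assms] by metis
next
  assume "\<exists>b\<in>B. A = below lt B b"
  then show "initial_seg lt A B \<and> A \<noteq> B"
    using initial_seg_below irr unfolding below_def by blast
qed

lemma path_insert:
  assumes "is_path A" "x \<in> extensions A"
  shows "is_path (insert x A)"
  unfolding is_path_def
proof (intro conjI allI ballI impI)
  have AX: "A \<subseteq> X" using path_subset[OF assms(1)] .
  have above: "y \<sqsubset> x" if "y \<in> A" for y using extensions_above[OF assms(2) that AX] .
  show "\<exists>m\<in>S. \<forall>y\<in>S. \<not> y \<sqsubset> m" if S: "S \<subseteq> insert x A" "S \<noteq> {}" for S
  proof (cases "S \<inter> A = {}")
    case True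
    then have "S = {x}" using S by blast
    then show ?thesis using irr by blast
  next
    case False
    then obtain m where "m \<in> S \<inter> A" "\<forall>y\<in>S \<inter> A. \<not> y \<sqsubset> m"
      using path_well_ordered[OF assms(1), of "S \<inter> A"] by blast
    then show ?thesis using above asym S by blast
  qed
  fix d assume d: "d \<in> insert x A"
  show "d \<in> extensions (below lt (insert x A) d)"
  proof (cases "d = x")
    case True
    have "below lt (insert x A) d \<subseteq> A" using True irr unfolding below_def by blast
    then show ?thesis using extensions_antimono[OF assms(2)] True by blast
  next
    case False
    then have "d \<in> A" using d by blast
    then have "below lt (insert x A) d = below lt A d" using above asym unfolding below_def by blast
    then show ?thesis using path_extensions[OF assms(1) \<open>d \<in> A\<close>] by simp
  qed
qed

lemma bounded_paths_insert:
  assumes "A \<in> bounded_paths" "x \<in> extensions A"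
  shows "insert x A \<in> bounded_paths"
proof -
  have "y \<sqsubset> x" if "y \<in> A" for y
    using extensions_above assms bounded_path_subset that by blast
  then have "\<forall>y\<in>insert x A. \<not> x \<sqsubset> y" using asym irr by blast
  moreover have "x \<in> X" using assms(2) extensions_subset by blast
  ultimately show ?thesis
    using assms path_insert unfolding bounded_paths_def by blast
qed

lemma initial_seg_insert:
  assumes "A \<subseteq> X" "x \<in> extensions A"
  shows "initial_seg lt A (insert x A)"
  using extensions_above[OF assms(2) _ assms(1)] asym unfolding initial_seg_def by blast

lemma initial_segs_comparable:
  assumes "initial_seg lt A C" "initial_seg lt B C" "C \<subseteq> X"
  shows "initial_seg lt A B \<or> initial_seg lt B A"
proof (cases "A \<subseteq> B")
  case True
  then show ?thesis using assms unfolding initial_seg_def by blast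
next
  case False
  then obtain a where "a \<in> A" "a \<notin> B" by blast
  then have "B \<subseteq> A"
    using assms total unfolding initial_seg_def by (metis subset_iff)
  then show ?thesis using assms unfolding initial_seg_def by blast
qed

text \<open>The first difference is the smaller of the least elements of \<open>A - B\<close> and
  \<open>B - A\<close>; each of these sets inherits a least element from a path when it is
  nonempty.\<close>

lemma separation:
  assumes "is_path A" "is_path B" "A \<noteq> B"
  obtains x where "\<And>y. y \<sqsubset> x \<Longrightarrow> y \<in> A \<longleftrightarrow> y \<in> B" "x \<in> A \<and> x \<notin> B \<or> x \<in> B \<and> x \<notin> A"
proof -
  have main: thesis
    if h1: "is_path A" and h2: "is_path B" and h3: "x \<in> A - B" and h4: "\<And>y. y \<in> A - B \<Longrightarrow> y \<noteq> x \<Longrightarrow> x \<sqsubset> y"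
      and h5: "\<And>x. (\<And>y. y \<sqsubset> x \<Longrightarrow> y \<in> A \<longleftrightarrow> y \<in> B) \<Longrightarrow> x \<in> A \<and> x \<notin> B \<or> x \<in> B \<and> x \<notin> A \<Longrightarrow> thesis"
    for A B x
  proof (cases "B - A = {}")
    case True
    then show ?thesis using h5[of x] h3 h4 asym irr by (metis Diff_iff empty_iff)
  next
    case False
    then obtain y where y: "y \<in> B - A" and min: "\<And>z. z \<in> B - A \<Longrightarrow> z \<noteq> y \<Longrightarrow> y \<sqsubset> z"
      using path_min[OF h2, of "B - A"] by blast
    then have "x \<noteq> y" using h3 by blast
    have "x \<in> X" "y \<in> X" using h1 h2 h3 y path_subset by blast+
    then consider "x \<sqsubset> y" | "y \<sqsubset> x" using total \<open>x \<noteq> y\<close> by blast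
    then show ?thesis
    proof cases
      case 1
      show ?thesis
      proof (rule h5[of x])
        show "z \<in> A \<longleftrightarrow> z \<in> B" if "z \<sqsubset> x" for z
          using \<open>z \<sqsubset> x\<close> min[of z] h4[of z] 1 asym irr lt_trans
          by (metis Diff_iff)
      qed (use h3 in blast)
    next
      case 2
      show ?thesis
      proof (rule h5[of y])
        show "z \<in> A \<longleftrightarrow> z \<in> B" if "z \<sqsubset> y" for z
          using \<open>z \<sqsubset> y\<close> min[of z] h4[of z] 2 asym irr lt_trans
          by (metis Diff_iff)
      qed (use y in blast)
    qed
  qed
  show thesis
  proof (cases "A - B = {}")
    case False
    then obtain x where "x \<in> A - B" "\<And>y. y \<in> A - B \<Longrightarrow> y \<noteq> x \<Longrightarrow> x \<sqsubset> y"
      using path_min[OF assms(1), of "A - B"] by blast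
    then show ?thesis using main[OF assms(1,2)] that by blast
  next
    case True
    then have "B - A \<noteq> {}" using assms(3) by blast
    then obtain x where "x \<in> B - A" "\<And>y. y \<in> B - A \<Longrightarrow> y \<noteq> x \<Longrightarrow> x \<sqsubset> y"
      using path_min[OF assms(2), of "B - A"] by blast
    then show ?thesis using main[OF assms(2,1)] that by blast
  qed
qed

text \<open>Every member is an initial segment of the union. A least element of a subset can
  therefore be found inside one member that it meets, and the set below a point is computed inside a
  member that contains the point.\<close>

lemma path_Union:
  assumes path: "\<And>A. A \<in> \<C> \<Longrightarrow> is_path A"
    and chain: "\<And>A B. A \<in> \<C> \<Longrightarrow> B \<in> \<C> \<Longrightarrow> initial_seg lt A B \<or> initial_seg lt B A"
  shows "is_path (\<Union>\<C>)" "\<And>A. A \<in> \<C> \<Longrightarrow> initial_seg lt A (\<Union>\<C>)"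
proof -
  show init: "initial_seg lt A (\<Union>\<C>)" if "A \<in> \<C>" for A
    using chain that unfolding initial_seg_def by blast
  show "is_path (\<Union>\<C>)"
    unfolding is_path_def
  proof (intro conjI allI ballI impI)
    show "\<exists>m\<in>S. \<forall>y\<in>S. \<not> y \<sqsubset> m" if S: "S \<subseteq> \<Union>\<C>" "S \<noteq> {}" for S
    proof -
      obtain s A where "s \<in> S" "s \<in> A" and A: "A \<in> \<C>" using S by blast
      then obtain m where m: "m \<in> S \<inter> A" "\<forall>y\<in>S \<inter> A. \<not> y \<sqsubset> m"
        using path_well_ordered[OF path[OF A], of "S \<inter> A"] by blast
      then show ?thesis using init[OF A] S unfolding initial_seg_def by blast
    qed
    show "d \<in> extensions (below lt (\<Union>\<C>) d)" if "d \<in> \<Union>\<C>" for d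
      using that path_extensions[OF path] initial_seg_below_eq[OF init] by (metis UnionE)
  qed
qed

section \<open>The lexicographic order and the cones of paths\<close>

lemma lex_irrefl: "\<not> lex B B"
  unfolding lex_def by blast

lemma lex_trans:
  assumes "lex B C" "lex C D"
  shows "lex B D"
proof -
  obtain x where x: "x \<in> B" "x \<notin> C" "\<And>y. y \<sqsubset> x \<Longrightarrow> y \<in> B \<longleftrightarrow> y \<in> C"
    using assms(1) unfolding lex_def by blast
  obtain y where y: "y \<in> C" "y \<notin> D" "\<And>z. z \<sqsubset> y \<Longrightarrow> z \<in> C \<longleftrightarrow> z \<in> D"
    using assms(2) unfolding lex_def by blast
  have BD: "B \<in> cofinal_paths" "C \<in> cofinal_paths" "D \<in> cofinal_paths"
    using assms unfolding lex_def by blast+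
  have "x \<in> X" "y \<in> X" using x(1) y(1) BD cofinal_path_subset by blast+
  moreover have "x \<noteq> y" using x y by blast
  ultimately consider "x \<sqsubset> y" | "y \<sqsubset> x" using total by blast
  then show ?thesis
  proof cases
    case 1
    then have "x \<notin> D" "\<And>z. z \<sqsubset> x \<Longrightarrow> z \<in> B \<longleftrightarrow> z \<in> D" using x y lt_trans by blast+
    then show ?thesis using x(1) BD unfolding lex_def by blast
  next
    case 2
    then have "y \<in> B" "\<And>z. z \<sqsubset> y \<Longrightarrow> z \<in> B \<longleftrightarrow> z \<in> D" using x y lt_trans by blast+
    then show ?thesis using y(2) BD unfolding lex_def by blast
  qed
qed

lemma lex_total:
  assumes "B \<in> cofinal_paths" "C \<in> cofinal_paths" "B \<noteq> C"
  shows "lex B C \<or> lex C B"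
proof -
  have "is_path B" "is_path C" using assms unfolding cofinal_paths_def by auto
  then obtain x where "\<And>y. y \<sqsubset> x \<Longrightarrow> y \<in> B \<longleftrightarrow> y \<in> C" "x \<in> B \<and> x \<notin> C \<or> x \<in> C \<and> x \<notin> B"
    using separation assms(3) by metis
  then show ?thesis using assms(1,2) unfolding lex_def by blast
qed

lemma lex_linear: "linear_strict cofinal_paths lex"
proof
  show "B \<in> cofinal_paths \<and> C \<in> cofinal_paths" if "lex B C" for B C
    using that unfolding lex_def by blast
qed (use lex_irrefl lex_trans lex_total in blast)+

lemma lexI:
  assumes "B \<in> cofinal_paths" "C \<in> cofinal_paths" "x \<in> B" "x \<notin> C"
    "\<And>y. y \<sqsubset> x \<Longrightarrow> y \<in> B \<longleftrightarrow> y \<in> C"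
  shows "lex B C"
  using assms unfolding lex_def by blast

lemma path_cone_subset: "path_cone A \<subseteq> cofinal_paths"
  unfolding path_cone_def by blast

lemma path_cone_antimono: "initial_seg lt A B \<Longrightarrow> path_cone B \<subseteq> path_cone A"
  unfolding path_cone_def using initial_seg_trans by blast

lemma path_cone_mem_iff: "B \<in> path_cone A \<Longrightarrow> a \<in> A \<Longrightarrow> y \<sqsubset> a \<Longrightarrow> y \<in> B \<longleftrightarrow> y \<in> A"
  unfolding path_cone_def initial_seg_def by blast

lemma path_cone_supset: "B \<in> path_cone A \<Longrightarrow> A \<subseteq> B"
  unfolding path_cone_def initial_seg_def by blast

lemma path_cone_below: "B \<in> cofinal_paths \<Longrightarrow> B \<in> path_cone (below lt B b)"
  unfolding path_cone_def using initial_seg_below by blast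

text \<open>The point \<open>a\<close> of \<open>A'\<close> beyond \<open>x\<close> freezes every
  path through \<open>A'\<close> up to \<open>a\<close>, so that such a path can no longer acquire
  \<open>x\<close>. If \<open>A'\<close> stopped below \<open>x\<close>, it would instead be an
  initial segment of \<open>A\<close>.\<close>

lemma lex_cones:
  assumes B: "B \<in> path_cone A" and C: "C \<in> path_cone A'"
    and x: "x \<in> A" "x \<notin> A'" "\<And>y. y \<sqsubset> x \<Longrightarrow> y \<in> A \<longleftrightarrow> y \<in> A'" and a: "a \<in> A'" "x \<sqsubset> a"
  shows "lex B C"
proof (rule lexI[of _ _ x])
  show "x \<in> B" using path_cone_supset[OF B] x(1) by blast
  show "x \<notin> C" using path_cone_mem_iff[OF C a] x(2) by blast
  show "y \<in> B \<longleftrightarrow> y \<in> C" if "y \<sqsubset> x" for y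
    using path_cone_mem_iff[OF B x(1) that] path_cone_mem_iff[OF C a(1), of y] x(3)[OF that]
      lt_trans[OF that a(2)] by blast
qed (use B C path_cone_subset in blast)+

text \<open>Let \<open>x\<close> be the first difference, in \<open>A\<close> say. Either
  \<open>A'\<close> has a point beyond \<open>x\<close>, and \<open>lex_cones\<close> separates the
  cones, or \<open>A'\<close> stops below \<open>x\<close> and is an initial segment of
  \<open>A\<close>. Cones at incomparable vertices thus lie entirely before or after one
  another.\<close>

lemma cones_trichotomy:
  assumes "is_path A" "is_path A'"
  shows "initial_seg lt A A' \<or> initial_seg lt A' A \<or>
    (\<forall>B\<in>path_cone A. \<forall>C\<in>path_cone A'. lex B C) \<or> (\<forall>B\<in>path_cone A. \<forall>C\<in>path_cone A'. lex C B)"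
proof (cases "A = A'")
  case False
  then obtain x where agree: "\<And>y. y \<sqsubset> x \<Longrightarrow> y \<in> A \<longleftrightarrow> y \<in> A'"
    and x: "x \<in> A \<and> x \<notin> A' \<or> x \<in> A' \<and> x \<notin> A"
    using separation[OF assms] by metis
  have main: "initial_seg lt B A \<or> (\<forall>C\<in>path_cone A. \<forall>E\<in>path_cone B. lex C E)"
    if "is_path A" "is_path B" "\<And>y. y \<sqsubset> x \<Longrightarrow> y \<in> A \<longleftrightarrow> y \<in> B" "x \<in> A" "x \<notin> B" for A B
  proof (cases "\<exists>a\<in>B. x \<sqsubset> a")
    case True
    then show ?thesis using lex_cones that by metis
  next
    case nex: False
    have lt: "y \<sqsubset> x" if "y \<in> B" for y
      using total[of x y] nex that \<open>x \<in> A\<close> \<open>x \<notin> B\<close> path_subset[OF \<open>is_path A\<close>] path_subset[OF \<open>is_path B\<close>] by blast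
    then have "initial_seg lt B A"
      using that(3) lt_trans unfolding initial_seg_def by blast
    then show ?thesis ..
  qed
  show ?thesis
    using x main[OF assms] main[OF assms(2,1)] agree by blast
qed simp

lemma lex_insert_cones:
  assumes "A \<subseteq> X" "x \<sqsubset> y" "x \<in> extensions A" "B \<in> path_cone (insert x A)" "C \<in> path_cone (insert y A)"
  shows "lex B C"
proof (rule lex_cones[OF assms(4,5), of x y])
  show "x \<notin> insert y A" using extensions_not_mem assms irr by blast
  show "z \<in> insert x A \<longleftrightarrow> z \<in> insert y A" if "z \<sqsubset> x" for z
    using that assms(2) irr asym by blast
qed (use assms in auto)

text \<open>A cofinal path through a bounded path \<open>A\<close> differs from \<open>A\<close>,
  hence has a next point; sorting the paths by this point gives the fan.\<close>

lemma path_cone_eq_fan: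
  assumes "A \<in> bounded_paths"
  shows "path_cone A = fan A (extensions A)"
proof
  show "path_cone A \<subseteq> fan A (extensions A)"
  proof
    fix B assume B: "B \<in> path_cone A"
    then have "is_path B" "initial_seg lt A B" unfolding path_cone_def cofinal_paths_def by auto
    moreover have "A \<noteq> B" using B assms unfolding path_cone_def cofinal_paths_def bounded_paths_def by blast
    ultimately obtain x where "x \<in> extensions A" "initial_seg lt (insert x A) B"
      using initial_seg_next by metis
    then show "B \<in> fan A (extensions A)" using B unfolding fan_def path_cone_def by blast
  qed
  show "fan A (extensions A) \<subseteq> path_cone A"
    unfolding fan_def using path_cone_antimono[OF initial_seg_insert[OF bounded_path_subset[OF assms]]] by blast
qed

end

section \<open>The space of cofinal paths is homogeneous\<close>

lemma ord_iso_image: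
  assumes "bij_betw f A B" "\<And>x y. x \<in> A \<Longrightarrow> y \<in> A \<Longrightarrow> lt x y \<longleftrightarrow> lt' (f x) (f y)" "S \<subseteq> A"
  shows "ord_iso lt S lt' (f ` S)"
  unfolding ord_iso_def
proof (intro exI[of _ f] conjI ballI)
  show "bij_betw f S (f ` S)"
    using assms(1,3) by (metis bij_betw_imp_inj_on inj_on_imp_bij_betw inj_on_subset)
qed (use assms in blast)

context homogeneous_order
begin

abbreviation good :: "'a set set \<Rightarrow> bool" where
  "good K \<equiv> ord_iso lex K lex cofinal_paths"

text \<open>With \<open>g\<close> an isomorphism of \<open>X\<close> onto
  \<open>extensions A\<close>, this appends a copy of \<open>S\<close> to \<open>A\<close>. The same
  map yields both the copy of the whole space in a cone and the reproductivity of the tree.\<close>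

definition shift :: "'a set \<Rightarrow> ('a \<Rightarrow> 'a) \<Rightarrow> 'a set \<Rightarrow> 'a set" where
  "shift A g S = A \<union> g ` S"

lemma between2: "z \<sqsubset> u \<Longrightarrow> z' \<sqsubset> u \<Longrightarrow> \<exists>w. z \<sqsubset> w \<and> z' \<sqsubset> w \<and> w \<sqsubset> u"
  using dense[of z u] dense[of z' u] total[of z z'] carrier lt_trans[of z z'] lt_trans[of z' z] by (metis lt_trans)

lemma extensions_no_min: "x \<in> extensions A \<Longrightarrow> \<exists>y\<in>extensions A. y \<sqsubset> x"
  unfolding extensions_def using dense by blast

lemma extensions_nonempty:
  assumes "A \<in> bounded_paths"
  shows "extensions A \<noteq> {}"
proof -
  obtain z where "z \<in> X" "\<forall>y\<in>A. \<not> z \<sqsubset> y" using assms unfolding bounded_paths_def by blast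
  then show ?thesis using no_max unfolding extensions_def by blast
qed

text \<open>Density gives below each extension another one, even where \<open>A\<close> has no last
  point: a supremum of \<open>A\<close> is not itself an extension. So homogeneity applies to the
  possible continuations at every vertex, limit or not.\<close>

lemma open_convex_extensions:
  assumes "A \<in> bounded_paths"
  shows "open_convex lt (extensions A)"
  unfolding open_convex_def
proof (intro conjI ballI allI impI)
  show "extensions A \<noteq> {}" using extensions_nonempty[OF assms] .
  show "z \<in> extensions A" if "x \<in> extensions A" "x \<sqsubset> z \<and> z \<sqsubset> y" for x y z
    using extensions_up that by blast
  show "\<exists>y\<in>extensions A. y \<sqsubset> x" if "x \<in> extensions A" for x
    using extensions_no_min[OF that] .
  show "\<exists>y\<in>extensions A. x \<sqsubset> y" if "x \<in> extensions A" for x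
    using that no_max extensions_up extensions_subset by blast
qed

lemma extensions_iso:
  assumes "A \<in> bounded_paths"
  obtains g where "bij_betw g X (extensions A)"
    "\<And>x y. x \<in> X \<Longrightarrow> y \<in> X \<Longrightarrow> x \<sqsubset> y \<longleftrightarrow> g x \<sqsubset> g y"
  using homogeneous[OF extensions_subset open_convex_extensions[OF assms]]
  unfolding ord_iso_def by auto

lemma empty_path: "{} \<in> bounded_paths"
  using nonempty unfolding bounded_paths_def is_path_def by blast

lemma extensions_empty: "extensions {} = X"
  unfolding extensions_def using no_min carrier by blast

lemma path_cone_empty: "path_cone {} = cofinal_paths"
  unfolding path_cone_def by simp

section \<open>Appending a copied path to a bounded path\<close>

context
  fixes A g
  assumes A: "A \<in> bounded_paths" and g: "bij_betw g X (extensions A)"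
    and g_lt: "\<And>x y. x \<in> X \<Longrightarrow> y \<in> X \<Longrightarrow> x \<sqsubset> y \<longleftrightarrow> g x \<sqsubset> g y"
begin

lemma g_ext: "x \<in> X \<Longrightarrow> g x \<in> extensions A"
  using g by (rule bij_betw_apply)

lemma g_above: "x \<in> X \<Longrightarrow> a \<in> A \<Longrightarrow> a \<sqsubset> g x"
  using extensions_above[OF g_ext _ bounded_path_subset[OF A]] .

lemma g_inj: "x \<in> X \<Longrightarrow> y \<in> X \<Longrightarrow> g x = g y \<Longrightarrow> x = y"
  using g unfolding bij_betw_def inj_on_def by blast

lemma g_surj: "y \<in> extensions A \<Longrightarrow> \<exists>x\<in>X. y = g x"
  using bij_betw_imp_surj_on[OF g] by blast

lemma shift_mem: "S \<subseteq> X \<Longrightarrow> x \<in> X \<Longrightarrow> g x \<in> shift A g S \<longleftrightarrow> x \<in> S"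
  using g_inj extensions_not_mem[OF g_ext] unfolding shift_def by blast

lemma initial_seg_shift: "S \<subseteq> X \<Longrightarrow> initial_seg lt A (shift A g S)"
  unfolding initial_seg_def shift_def using g_above asym by blast

lemma path_shift:
  assumes "is_path S"
  shows "is_path (shift A g S)"
  unfolding is_path_def
proof (intro conjI allI ballI impI)
  have SX: "S \<subseteq> X" using path_subset[OF assms] .
  have pA: "is_path A" using A unfolding bounded_paths_def by blast
  show "\<exists>m\<in>T. \<forall>y\<in>T. \<not> y \<sqsubset> m" if T: "T \<subseteq> shift A g S" "T \<noteq> {}" for T
  proof (cases "T \<inter> A = {}")
    case False
    then obtain m where m: "m \<in> T" "m \<in> A" "\<forall>y\<in>T \<inter> A. \<not> y \<sqsubset> m"
      using path_well_ordered[OF pA, of "T \<inter> A"] by blast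
    then have "\<not> y \<sqsubset> m" if "y \<in> T" for y
      using that initial_seg_shift[OF SX] T(1) unfolding initial_seg_def by blast
    then show ?thesis using m(1) by blast
  next
    case True
    define U where "U = {x\<in>S. g x \<in> T}"
    have TU: "T = g ` U" unfolding U_def using T(1) True unfolding shift_def by blast
    have "U \<subseteq> S" "U \<noteq> {}" using TU T(2) unfolding U_def by auto
    then obtain m where m: "m \<in> U" "\<forall>y\<in>U. \<not> y \<sqsubset> m" using path_well_ordered[OF assms] by blast
    then have "\<forall>y\<in>U. \<not> g y \<sqsubset> g m" using g_lt SX \<open>U \<subseteq> S\<close> by blast
    then show ?thesis using TU m(1) by blast
  qed
  show "d \<in> extensions (below lt (shift A g S) d)" if d: "d \<in> shift A g S" for d
  proof (cases "d \<in> A")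
    case True
    then show ?thesis
      using path_extensions[OF pA] initial_seg_below_eq[OF initial_seg_shift[OF SX]] by metis
  next
    case False
    then obtain x where x: "x \<in> S" "d = g x" using d unfolding shift_def by blast
    then obtain z where z: "z \<sqsubset> x" "\<forall>y\<in>below lt S x. \<not> z \<sqsubset> y"
      using path_extensions[OF assms] unfolding extensions_def by blast
    have zX: "z \<in> X" "x \<in> X" using z(1) carrier by auto
    have "\<not> g z \<sqsubset> y" if y: "y \<in> below lt (shift A g S) d" for y
    proof (cases "y \<in> A")
      case True
      then show ?thesis using g_above[OF zX(1)] asym by blast
    next
      case False
      then obtain s where s: "s \<in> S" "y = g s" "g s \<sqsubset> g x"
        using y x unfolding below_def shift_def by blast
      then have "s \<in> below lt S x" using g_lt[of s x] SX zX unfolding below_def by blast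
      then show ?thesis using z(2) s g_lt[of z s] SX zX by blast
    qed
    moreover have "g z \<sqsubset> d" using g_lt[OF zX] z(1) x by blast
    ultimately show ?thesis unfolding extensions_def by blast
  qed
qed

lemma path_unshift:
  assumes "is_path B" "initial_seg lt A B"
  obtains S where "is_path S" "B = shift A g S"
proof -
  define S where "S = {x\<in>X. g x \<in> B}"
  have SX: "S \<subseteq> X" unfolding S_def by blast
  have BX: "B \<subseteq> X" using path_subset[OF assms(1)] .
  have ext: "b \<in> extensions A" if b: "b \<in> B" "b \<notin> A" for b
  proof -
    have "a \<sqsubset> b" if "a \<in> A" for a
      using total[of a b] assms(2) b that BX unfolding initial_seg_def by blast
    then have "A \<subseteq> below lt B b" using assms(2) unfolding below_def initial_seg_def by blast
    then show ?thesis using path_extensions[OF assms(1) b(1)] extensions_antimono by blast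
  qed
  have B: "B = shift A g S"
  proof
    show "shift A g S \<subseteq> B" using assms(2) unfolding shift_def S_def initial_seg_def by blast
    show "B \<subseteq> shift A g S"
    proof
      fix b assume b: "b \<in> B"
      show "b \<in> shift A g S"
      proof (cases "b \<in> A")
        case False
        then obtain x where "x \<in> X" "b = g x" using ext[OF b] g_surj by blast
        then show ?thesis using b unfolding shift_def S_def by blast
      qed (simp add: shift_def)
    qed
  qed
  have "is_path S"
    unfolding is_path_def
  proof (intro conjI allI ballI impI)
    show "\<exists>m\<in>T. \<forall>y\<in>T. \<not> y \<sqsubset> m" if T: "T \<subseteq> S" "T \<noteq> {}" for T
    proof -
      have "g ` T \<subseteq> B" "g ` T \<noteq> {}" using T S_def by auto
      then obtain m where m: "m \<in> T" "\<forall>y\<in>T. \<not> g y \<sqsubset> g m"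
        using path_well_ordered[OF assms(1), of "g ` T"] by blast
      then show ?thesis using g_lt T(1) SX by blast
    qed
    show "x \<in> extensions (below lt S x)" if x: "x \<in> S" for x
    proof -
      have xX: "x \<in> X" and gx: "g x \<in> B" using x unfolding S_def by auto
      obtain z where z: "z \<sqsubset> g x" "\<forall>y\<in>below lt B (g x). \<not> z \<sqsubset> y"
        using path_extensions[OF assms(1) gx] unfolding extensions_def by blast
      obtain z' where z': "z' \<sqsubset> g x" "\<forall>y\<in>A. \<not> z' \<sqsubset> y"
        using g_ext[OF xX] unfolding extensions_def by blast
      \<comment> \<open>The bound \<open>z\<close> need not be an extension of \<open>A\<close>,
        hence need not be a value of \<open>g\<close>. Raising it above a bound \<open>z'\<close> of
        \<open>A\<close> makes it one, and the preimage \<open>v\<close> bounds the points of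
        \<open>S\<close> below \<open>x\<close>.\<close>
      obtain w where w: "z \<sqsubset> w" "z' \<sqsubset> w" "w \<sqsubset> g x" using between2[OF z(1) z'(1)] by blast
      then have "w \<in> extensions A" using z'(2) unfolding extensions_def by blast
      then obtain v where v: "v \<in> X" "w = g v" using g_surj by blast
      have "v \<sqsubset> x" using w(3) v g_lt[OF v(1) xX] by blast
      moreover have "\<not> v \<sqsubset> y" if y: "y \<in> below lt S x" for y
      proof
        assume "v \<sqsubset> y"
        have yX: "y \<in> X" "g y \<in> B" "y \<sqsubset> x" using y unfolding below_def S_def by auto
        then have "g y \<sqsubset> g x" using g_lt[OF yX(1) xX] by blast
        then have "g y \<in> below lt B (g x)" using yX(2) unfolding below_def by blast
        moreover have "z \<sqsubset> g y" using w(1) v g_lt[OF v(1) yX(1)] \<open>v \<sqsubset> y\<close> lt_trans by blast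
        ultimately show False using z(2) by blast
      qed
      ultimately show ?thesis unfolding extensions_def by blast
    qed
  qed
  then show ?thesis using that B by blast
qed

lemma bounded_shift:
  assumes "S \<in> bounded_paths"
  shows "shift A g S \<in> bounded_paths"
proof -
  obtain z where z: "z \<in> X" "\<forall>y\<in>S. \<not> z \<sqsubset> y" and S: "is_path S" using assms unfolding bounded_paths_def by blast
  have "\<not> g z \<sqsubset> y" if "y \<in> shift A g S" for y
    using that z g_above[OF z(1)] asym g_lt[OF z(1)] path_subset[OF S] unfolding shift_def by blast
  moreover have "g z \<in> X" using g_ext[OF z(1)] extensions_subset by blast
  ultimately show ?thesis using path_shift[OF S] unfolding bounded_paths_def by blast
qed

lemma cofinal_shift:
  assumes "S \<in> cofinal_paths"
  shows "shift A g S \<in> cofinal_paths"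
proof -
  have S: "is_path S" "\<And>z. z \<in> X \<Longrightarrow> \<exists>y\<in>S. z \<sqsubset> y" using assms unfolding cofinal_paths_def by auto
  have SX: "S \<subseteq> X" using path_subset[OF S(1)] .
  have "\<exists>y\<in>shift A g S. w \<sqsubset> y" if w: "w \<in> X" for w
  proof (cases "w \<in> extensions A")
    case True
    then obtain z where z: "z \<in> X" "w = g z" using g_surj by blast
    then obtain s where "s \<in> S" "z \<sqsubset> s" using S(2) by blast
    then have "g z \<sqsubset> g s" "s \<in> S" using g_lt[OF z(1)] SX by blast+
    then show ?thesis using z unfolding shift_def by blast
  next
    case False
    obtain s where s: "s \<in> S" using S(2)[OF w] by blast
    then have "g s \<in> extensions A" using SX g_ext by blast
    then have "w \<sqsubset> g s"
      using False extensions_up extensions_subset total[of w "g s"] w by blast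
    then show ?thesis using s unfolding shift_def by blast
  qed
  then show ?thesis using path_shift[OF S(1)] unfolding cofinal_paths_def by blast
qed

lemma inj_shift: "S \<subseteq> X \<Longrightarrow> S' \<subseteq> X \<Longrightarrow> shift A g S = shift A g S' \<Longrightarrow> S = S'"
  using shift_mem by blast

lemma bij_shift_bounded: "bij_betw (shift A g) bounded_paths {B\<in>bounded_paths. initial_seg lt A B}"
  unfolding bij_betw_def
proof
  show "inj_on (shift A g) bounded_paths"
    using inj_shift bounded_path_subset unfolding inj_on_def by blast
  show "shift A g ` bounded_paths = {B\<in>bounded_paths. initial_seg lt A B}"
  proof
    show "shift A g ` bounded_paths \<subseteq> {B\<in>bounded_paths. initial_seg lt A B}"
      using bounded_shift initial_seg_shift bounded_path_subset by blast
    show "{B\<in>bounded_paths. initial_seg lt A B} \<subseteq> shift A g ` bounded_paths"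
    proof
      fix B assume "B \<in> {B\<in>bounded_paths. initial_seg lt A B}"
      then have B: "B \<in> bounded_paths" "is_path B" "initial_seg lt A B" unfolding bounded_paths_def by auto
      then obtain S where S: "is_path S" "B = shift A g S" using path_unshift by blast
      then have "S \<in> bounded_paths"
        using path_cases[OF S(1)] cofinal_shift B(1) unfolding bounded_paths_def cofinal_paths_def by blast
      then show "B \<in> shift A g ` bounded_paths" using S(2) by blast
    qed
  qed
qed

lemma bij_shift_cofinal: "bij_betw (shift A g) cofinal_paths (path_cone A)"
  unfolding bij_betw_def
proof
  show "inj_on (shift A g) cofinal_paths"
    using inj_shift cofinal_path_subset unfolding inj_on_def by blast
  show "shift A g ` cofinal_paths = path_cone A"
  proof
    show "shift A g ` cofinal_paths \<subseteq> path_cone A"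
      using cofinal_shift initial_seg_shift cofinal_path_subset unfolding path_cone_def by blast
    show "path_cone A \<subseteq> shift A g ` cofinal_paths"
    proof
      fix B assume "B \<in> path_cone A"
      then have B: "B \<in> cofinal_paths" "is_path B" "initial_seg lt A B"
        unfolding path_cone_def cofinal_paths_def by auto
      then obtain S where S: "is_path S" "B = shift A g S" using path_unshift by blast
      then have "S \<in> cofinal_paths"
        using path_cases[OF S(1)] bounded_shift B(1) unfolding bounded_paths_def cofinal_paths_def by blast
      then show "B \<in> shift A g ` cofinal_paths" using S(2) by blast
    qed
  qed
qed

lemma initial_seg_shift_iff:
  assumes "S \<subseteq> X" "S' \<subseteq> X"
  shows "initial_seg lt (shift A g S) (shift A g S') \<longleftrightarrow> initial_seg lt S S'"
proof
  assume *: "initial_seg lt (shift A g S) (shift A g S')"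
  show "initial_seg lt S S'"
    unfolding initial_seg_def
  proof (intro conjI subsetI ballI impI)
    show "x \<in> S'" if "x \<in> S" for x
      using initial_seg_subset[OF *] that shift_mem[OF assms(2), of x] assms(1) unfolding shift_def by blast
    show "y \<in> S" if "x \<in> S" "y \<in> S'" "y \<sqsubset> x" for x y
    proof -
      have "x \<in> X" "y \<in> X" using that assms by auto
      then have "g x \<in> shift A g S" "g y \<in> shift A g S'" "g y \<sqsubset> g x"
        using that g_lt[of y x] unfolding shift_def by auto
      then have "g y \<in> shift A g S" using * unfolding initial_seg_def by blast
      then show ?thesis using shift_mem[OF assms(1) \<open>y \<in> X\<close>] by blast
    qed
  qed
next
  assume *: "initial_seg lt S S'"
  have "y \<in> shift A g S" if xy: "x \<in> shift A g S" "y \<in> shift A g S'" "y \<sqsubset> x" for x y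
  proof (cases "y \<in> A")
    case False
    then obtain t where t: "t \<in> S'" "y = g t" using xy unfolding shift_def by blast
    then have "x \<notin> A" using xy(3) g_above asym assms by blast
    then obtain s where s: "s \<in> S" "x = g s" using xy unfolding shift_def by blast
    then have "t \<sqsubset> s" using xy(3) g_lt[of t s] t assms by blast
    then have "t \<in> S" using * s t unfolding initial_seg_def by blast
    then show ?thesis using t unfolding shift_def by blast
  qed (simp add: shift_def)
  then show "initial_seg lt (shift A g S) (shift A g S')"
    using * unfolding initial_seg_def shift_def by blast
qed

lemma lex_shift:
  assumes "lex S S'"
  shows "lex (shift A g S) (shift A g S')"
proof -
  obtain x where x: "x \<in> S" "x \<notin> S'" "\<And>y. y \<sqsubset> x \<Longrightarrow> y \<in> S \<longleftrightarrow> y \<in> S'"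
    and S: "S \<in> cofinal_paths" "S' \<in> cofinal_paths" using assms unfolding lex_def by blast
  have SX: "S \<subseteq> X" "S' \<subseteq> X" using S cofinal_path_subset by auto
  then have xX: "x \<in> X" using x(1) by blast
  show ?thesis
  proof (rule lexI[of _ _ "g x"])
    show "g x \<in> shift A g S" "g x \<notin> shift A g S'" using x SX xX shift_mem by auto
    fix y assume y: "y \<sqsubset> g x"
    have "g s \<sqsubset> g x \<longleftrightarrow> s \<sqsubset> x" if "s \<in> X" for s using g_lt[OF that xX] by blast
    then have *: "s \<in> S \<longleftrightarrow> s \<in> S'" if "y = g s" "s \<in> X" for s using x(3) y that by metis
    show "y \<in> shift A g S \<longleftrightarrow> y \<in> shift A g S'" using SX * unfolding shift_def by auto
  qed (use S cofinal_shift in auto)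
qed

lemma lex_shift_iff:
  assumes "S \<in> cofinal_paths" "S' \<in> cofinal_paths"
  shows "lex S S' \<longleftrightarrow> lex (shift A g S) (shift A g S')"
  using lex_shift lex_total[OF assms] lex_irrefl lex_trans by blast

end

lemma good_path_cone:
  assumes "A \<in> bounded_paths"
  shows "good (path_cone A)"
proof -
  obtain g where g: "bij_betw g X (extensions A)" "\<And>x y. x \<in> X \<Longrightarrow> y \<in> X \<Longrightarrow> x \<sqsubset> y \<longleftrightarrow> g x \<sqsubset> g y"
    using extensions_iso[OF assms] by blast
  have "ord_iso lex cofinal_paths lex (path_cone A)"
    unfolding ord_iso_def using bij_shift_cofinal[OF assms g] lex_shift_iff[OF assms g] by blast
  then show ?thesis by (rule ord_iso_sym)
qed

section \<open>Sums of copies of the space of cofinal paths\<close>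

lemma lex_asym: "lex B C \<Longrightarrow> \<not> lex C B"
  using lex_trans lex_irrefl by blast

text \<open>Good sets are isomorphic to one another through \<open>cofinal_paths\<close>, so a sum
  of good sets depends only on its index order.\<close>

lemma good_glue:
  assumes "\<And>i j. i \<in> I \<Longrightarrow> j \<in> I \<Longrightarrow> i \<noteq> j \<Longrightarrow> R i j \<or> R j i"
    and "\<And>i j x y. i \<in> I \<Longrightarrow> j \<in> I \<Longrightarrow> R i j \<Longrightarrow> x \<in> K i \<Longrightarrow> y \<in> K j \<Longrightarrow> lex x y"
    and "\<And>i j x y. i \<in> I \<Longrightarrow> j \<in> I \<Longrightarrow> R i j \<Longrightarrow> x \<in> M i \<Longrightarrow> y \<in> M j \<Longrightarrow> lex x y"
    and "\<And>i. i \<in> I \<Longrightarrow> good (K i)" "\<And>i. i \<in> I \<Longrightarrow> good (M i)"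
  shows "ord_iso lex (\<Union>i\<in>I. K i) lex (\<Union>i\<in>I. M i)"
proof (rule ord_iso_glue[where R = R])
  show "ord_iso lex (K i) lex (M i)" if "i \<in> I" for i
    using assms(4,5)[OF that] ord_iso_sym ord_iso_trans by blast
  show "lex x y" if "i \<in> I" "j \<in> I" "R i j" "x \<in> K i" "y \<in> K j" for i j x y
    using assms(2)[OF that] .
  show "lex x y" if "i \<in> I" "j \<in> I" "R i j" "x \<in> M i" "y \<in> M j" for i j x y
    using assms(3)[OF that] .
qed (rule lex_asym assms(1), assumption+)+

text \<open>By homogeneity \<open>I\<close> is a copy of \<open>X\<close>. The fan over
  \<open>I\<close> and the whole space, which is the fan over \<open>X\<close> at the root, are then
  sums of good cones with isomorphic index orders.\<close>

lemma good_fan: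
  assumes A: "A \<in> bounded_paths" and I: "I \<subseteq> extensions A" "open_convex lt I"
  shows "good (fan A I)"
proof -
  have "ord_iso lt X lt I" using homogeneous I extensions_subset by blast
  then obtain h where h: "bij_betw h X I" "\<And>x y. x \<in> X \<Longrightarrow> y \<in> X \<Longrightarrow> x \<sqsubset> y \<longleftrightarrow> h x \<sqsubset> h y"
    unfolding ord_iso_def by auto
  have hI: "h x \<in> I" if "x \<in> X" for x using h(1) that by (rule bij_betw_apply)
  have AX: "A \<subseteq> X" using bounded_path_subset[OF A] .
  have "ord_iso lex (\<Union>x\<in>X. path_cone (insert (h x) A)) lex (\<Union>x\<in>X. path_cone {x})"
  proof (rule good_glue[where R = lt])
    show "good (path_cone (insert (h x) A))" if "x \<in> X" for x
      using good_path_cone bounded_paths_insert[OF A] hI[OF that] I(1) by blast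
    show "good (path_cone {x})" if "x \<in> X" for x
      using good_path_cone bounded_paths_insert[OF empty_path] that extensions_empty by blast
    show "lex B C" if "x \<in> X" "y \<in> X" "x \<sqsubset> y" "B \<in> path_cone {x}" "C \<in> path_cone {y}" for x y B C
      using lex_insert_cones[of "{}"] that extensions_empty by blast
    show "lex B C" if "x \<in> X" "y \<in> X" "x \<sqsubset> y" "B \<in> path_cone (insert (h x) A)" "C \<in> path_cone (insert (h y) A)" for x y B C
      using lex_insert_cones[OF AX, of "h x" "h y"] that h(2) hI[OF that(1)] I(1) by blast
  qed (use total in blast)
  moreover have "(\<Union>x\<in>X. path_cone (insert (h x) A)) = fan A I"
    using bij_betw_imp_surj_on[OF h(1)] unfolding fan_def by blast
  moreover have "(\<Union>x\<in>X. path_cone {x}) = cofinal_paths"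
    using path_cone_eq_fan[OF empty_path] path_cone_empty extensions_empty unfolding fan_def by simp
  ultimately show ?thesis by simp
qed

lemma fan_singleton: "fan A {x} = path_cone (insert x A)"
  unfolding fan_def by simp

lemma cofinal_eq_fan: "cofinal_paths = fan {} X"
  using path_cone_eq_fan[OF empty_path] path_cone_empty extensions_empty by simp

lemma fan_pieces_good:
  assumes "open_convex lt I \<or> (\<exists>x. I = {x})" "I \<subseteq> X"
  shows "good (fan {} I)"
  using assms(1)
proof
  assume "open_convex lt I"
  then show ?thesis using good_fan[OF empty_path] assms(2) extensions_empty by metis
next
  assume "\<exists>x. I = {x}"
  then obtain x where x: "I = {x}" by blast
  then have "{x} \<in> bounded_paths" using bounded_paths_insert[OF empty_path] assms(2) extensions_empty by blast
  then show ?thesis using good_path_cone x fan_singleton by metis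
qed

lemma fan_less:
  assumes "A \<subseteq> X" "\<And>x y. x \<in> I \<Longrightarrow> y \<in> J \<Longrightarrow> x \<sqsubset> y" "I \<subseteq> extensions A" "B \<in> fan A I" "C \<in> fan A J"
  shows "lex B C"
  using assms lex_insert_cones[OF assms(1)] unfolding fan_def by blast

text \<open>The cut points of \<open>X\<close> do no harm: a single point contributes a cone, an
  open piece contributes a fan, and each of them is a copy of the whole space.\<close>

lemma omega_up:
  obtains M :: "nat \<Rightarrow> 'a set set" where "(\<Union>n. M n) = cofinal_paths" "\<And>n. good (M n)"
    "\<And>m n x y. m < n \<Longrightarrow> x \<in> M m \<Longrightarrow> y \<in> M n \<Longrightarrow> lex x y"
proof -
  obtain I :: "nat \<Rightarrow> 'a set" where I: "(\<Union>n. I n) = X" "\<And>n. open_convex lt (I n) \<or> (\<exists>x. I n = {x})"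
    "\<And>m n x y. m < n \<Longrightarrow> x \<in> I m \<Longrightarrow> y \<in> I n \<Longrightarrow> x \<sqsubset> y"
    using omega_decomposition by blast
  have IX: "I n \<subseteq> X" for n using I(1) by blast
  show ?thesis
  proof (rule that[of "\<lambda>n. fan {} (I n)"])
    have "fan {} (\<Union>n. I n) = (\<Union>n. fan {} (I n))" unfolding fan_def by blast
    then show "(\<Union>n. fan {} (I n)) = cofinal_paths"
      unfolding I(1) cofinal_eq_fan by simp
    show "good (fan {} (I n))" for n using fan_pieces_good[OF I(2) IX] .
    show "lex x y" if "m < n" "x \<in> fan {} (I m)" "y \<in> fan {} (I n)" for m n x y
    proof (rule fan_less[of "{}" "I m" "I n"])
      show "x \<sqsubset> y" if "x \<in> I m" "y \<in> I n" for x y using I(3)[OF \<open>m < n\<close> that] .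
      show "I m \<subseteq> extensions {}" using IX extensions_empty by simp
    qed (use that in auto)
  qed
qed

lemma omega_down:
  obtains M :: "nat \<Rightarrow> 'a set set" where "(\<Union>n. M n) = cofinal_paths" "\<And>n. good (M n)"
    "\<And>m n x y. m < n \<Longrightarrow> x \<in> M m \<Longrightarrow> y \<in> M n \<Longrightarrow> lex y x"
proof -
  obtain I :: "nat \<Rightarrow> 'a set" where I: "(\<Union>n. I n) = X" "\<And>n. open_convex (\<lambda>x y. y \<sqsubset> x) (I n) \<or> (\<exists>x. I n = {x})"
    "\<And>m n x y. m < n \<Longrightarrow> x \<in> I m \<Longrightarrow> y \<in> I n \<Longrightarrow> y \<sqsubset> x"
    using homogeneous_order.omega_decomposition[OF dual] by blast
  have IX: "I n \<subseteq> X" for n using I(1) by blast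
  show ?thesis
  proof (rule that[of "\<lambda>n. fan {} (I n)"])
    have "fan {} (\<Union>n. I n) = (\<Union>n. fan {} (I n))" unfolding fan_def by blast
    then show "(\<Union>n. fan {} (I n)) = cofinal_paths"
      unfolding I(1) cofinal_eq_fan by simp
    show "good (fan {} (I n))" for n
      using fan_pieces_good I(2)[of n] IX unfolding open_convex_dual[of lt "I n"] by blast
    show "lex y x" if "m < n" "x \<in> fan {} (I m)" "y \<in> fan {} (I n)" for m n x y
    proof (rule fan_less[of "{}" "I n" "I m"])
      show "y \<sqsubset> x" if "y \<in> I n" "x \<in> I m" for x y using I(3)[OF \<open>m < n\<close> that(2,1)] .
      show "I n \<subseteq> extensions {}" using IX extensions_empty by simp
    qed (use that in auto)
  qed
qed

lemma good_omega_up: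
  fixes K :: "nat \<Rightarrow> 'a set set"
  assumes "\<And>n. good (K n)" "\<And>m n x y. m < n \<Longrightarrow> x \<in> K m \<Longrightarrow> y \<in> K n \<Longrightarrow> lex x y"
  shows "good (\<Union>n. K n)"
proof -
  obtain M :: "nat \<Rightarrow> 'a set set" where M: "(\<Union>n. M n) = cofinal_paths" "\<And>n. good (M n)"
    "\<And>m n x y. m < n \<Longrightarrow> x \<in> M m \<Longrightarrow> y \<in> M n \<Longrightarrow> lex x y"
    using omega_up by blast
  have "ord_iso lex (\<Union>n. K n) lex (\<Union>n. M n)"
    by (rule good_glue[where R = "(<)"]) (use assms M in auto)
  then show ?thesis using M(1) by simp
qed

lemma good_omega_down:
  fixes K :: "nat \<Rightarrow> 'a set set"
  assumes "\<And>n. good (K n)" "\<And>m n x y. m < n \<Longrightarrow> x \<in> K m \<Longrightarrow> y \<in> K n \<Longrightarrow> lex y x"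
  shows "good (\<Union>n. K n)"
proof -
  obtain M :: "nat \<Rightarrow> 'a set set" where M: "(\<Union>n. M n) = cofinal_paths" "\<And>n. good (M n)"
    "\<And>m n x y. m < n \<Longrightarrow> x \<in> M m \<Longrightarrow> y \<in> M n \<Longrightarrow> lex y x"
    using omega_down by blast
  have "ord_iso lex (\<Union>n. K n) lex (\<Union>n. M n)"
    by (rule good_glue[where R = "(>)"]) (use assms M in auto)
  then show ?thesis using M(1) by simp
qed

text \<open>Since \<open>1 + \<omega> = \<omega>\<close>.\<close>

lemma good_union:
  assumes "good K" "good K'" "\<forall>x\<in>K. \<forall>y\<in>K'. lex x y"
  shows "good (K \<union> K')"
proof -
  obtain M :: "nat \<Rightarrow> 'a set set" where M: "(\<Union>n. M n) = cofinal_paths" "\<And>n. good (M n)"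
    "\<And>m n x y. m < n \<Longrightarrow> x \<in> M m \<Longrightarrow> y \<in> M n \<Longrightarrow> lex x y"
    using omega_up by blast
  have tail: "good (\<Union>n. M (Suc n))"
  proof (rule good_omega_up)
    show "lex x y" if "m < n" "x \<in> M (Suc m)" "y \<in> M (Suc n)" for m n x y
      using M(3)[of "Suc m" "Suc n"] that by simp
  qed (rule M(2))
  \<comment> \<open>The sum of two sets is indexed by truth values, \<open>False\<close> before
    \<open>True\<close>; opposite \<open>K\<close> and \<open>K'\<close> stand \<open>M 0\<close>
    and the union of the remaining \<open>M n\<close>.\<close>
  have "ord_iso lex (\<Union>b\<in>UNIV. if b then K' else K) lex (\<Union>b\<in>UNIV. if b then \<Union>n. M (Suc n) else M 0)"
  proof (rule good_glue[where R = "(<)"])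
    show "lex x y" if "i < j" "x \<in> (if i then \<Union>n. M (Suc n) else M 0)" "y \<in> (if j then \<Union>n. M (Suc n) else M 0)"
      for i j x y
      using that M(3)[of 0] by (auto split: if_splits)
  qed (use assms M(2) tail in \<open>auto split: if_splits\<close>)
  moreover have "(\<Union>b\<in>UNIV. if b then K' else K) = K \<union> K'"
    by (auto split: if_splits)
  moreover have "(\<Union>b\<in>UNIV. if b then \<Union>n. M (Suc n) else M 0) = (\<Union>n. M n)"
  proof -
    have "x \<in> M 0 \<union> (\<Union>n. M (Suc n))" if "x \<in> M n" for x n
      using that by (cases n) auto
    then have "(\<Union>n. M n) = M 0 \<union> (\<Union>n. M (Suc n))" by blast
    then show ?thesis by (auto split: if_splits)
  qed
  ultimately show ?thesis using M(1) by simp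
qed

text \<open>The preceding term is the bound that \<open>extensions\<close> asks for, and any smaller
  point serves for the first term. A cofinal sequence gives a branch
  (\<open>cofinal_paths_nonempty\<close>), a bounded one gives vertices
  (\<open>uncountable_vertex_type\<close>).\<close>

lemma increasing_path:
  fixes c :: "nat \<Rightarrow> 'a"
  assumes c: "\<And>n. c n \<sqsubset> c (Suc n)"
  shows "is_path (range c)"
proof -
  have lt: "c m \<sqsubset> c n \<longleftrightarrow> m < n" for m n
    using increasing_mono[where s = c, OF c] irr asym by (metis linorder_neqE_nat)
  show ?thesis
    unfolding is_path_def
  proof (intro conjI allI ballI impI)
    show "\<exists>m\<in>S. \<forall>y\<in>S. \<not> y \<sqsubset> m" if S: "S \<subseteq> range c" "S \<noteq> {}" for S
    proof -
      obtain n where "c n \<in> S" using S by blast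
      then have "c (LEAST n. c n \<in> S) \<in> S" by (rule LeastI)
      moreover have "\<not> y \<sqsubset> c (LEAST n. c n \<in> S)" if y: "y \<in> S" for y
      proof -
        obtain k where k: "y = c k" using y S(1) by blast
        then have "(LEAST n. c n \<in> S) \<le> k" using y by (intro Least_le) simp
        then show ?thesis using k lt by simp
      qed
      ultimately show ?thesis by blast
    qed
    fix d assume "d \<in> range c"
    then obtain n where d: "d = c n" by blast
    obtain z where z: "z \<sqsubset> c n" "\<And>m. m < n \<Longrightarrow> \<not> z \<sqsubset> c m"
    proof (cases n)
      case 0
      then show ?thesis using that no_min c carrier by blast
    next
      case (Suc k)
      then show ?thesis using that[of "c k"] lt by simp
    qed
    then show "d \<in> extensions (below lt (range c) d)"
      unfolding extensions_def below_def using d lt by auto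
  qed
qed

section \<open>Endpoints, bounds of cones and density\<close>

lemma cofinal_paths_nonempty: "cofinal_paths \<noteq> {}"
proof -
  obtain c :: "nat \<Rightarrow> 'a" where c: "\<And>n. c n \<in> X" "\<And>n. c n \<sqsubset> c (Suc n)" "\<And>x. x \<in> X \<Longrightarrow> \<exists>n. x \<sqsubset> c n"
    using cofinal_sequence by blast
  have "is_path (range c)" by (rule increasing_path) (rule c(2))
  then show ?thesis using c(3) unfolding cofinal_paths_def by blast
qed

lemma path_cone_nonempty: "A \<in> bounded_paths \<Longrightarrow> path_cone A \<noteq> {}"
  using good_path_cone cofinal_paths_nonempty unfolding ord_iso_def by (metis bij_betw_empty1)

lemma cofinal_path_first:
  assumes "B \<in> cofinal_paths"
  obtains x where "x \<in> X" "B \<in> path_cone {x}"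
  using assms unfolding cofinal_eq_fan fan_def by blast

lemma lex_no_max:
  assumes "B \<in> cofinal_paths"
  shows "\<exists>C. lex B C"
proof -
  obtain x where x: "x \<in> X" "B \<in> path_cone {x}" using cofinal_path_first[OF assms] by blast
  then obtain y where y: "x \<sqsubset> y" using no_max by blast
  then obtain C where "C \<in> path_cone {y}"
    using path_cone_nonempty bounded_paths_insert[OF empty_path] extensions_empty carrier by blast
  then show ?thesis using lex_insert_cones[of "{}" x y] x y extensions_empty by blast
qed

lemma lex_no_min:
  assumes "B \<in> cofinal_paths"
  shows "\<exists>C. lex C B"
proof -
  obtain x where x: "x \<in> X" "B \<in> path_cone {x}" using cofinal_path_first[OF assms] by blast
  then obtain y where y: "y \<sqsubset> x" using no_min by blast
  then obtain C where "C \<in> path_cone {y}"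
    using path_cone_nonempty bounded_paths_insert[OF empty_path] extensions_empty carrier by blast
  then show ?thesis using lex_insert_cones[of "{}" y x] x y extensions_empty carrier by blast
qed

lemma path_cone_no_max_min:
  assumes "A \<in> bounded_paths" "B \<in> path_cone A"
  shows "\<exists>C\<in>path_cone A. lex B C" "\<exists>C\<in>path_cone A. lex C B"
proof -
  obtain f where f: "bij_betw f (path_cone A) cofinal_paths"
    "\<And>x y. x \<in> path_cone A \<Longrightarrow> y \<in> path_cone A \<Longrightarrow> lex x y \<longleftrightarrow> lex (f x) (f y)"
    using good_path_cone[OF assms(1)] unfolding ord_iso_def by auto
  have fB: "f B \<in> cofinal_paths" using f(1) assms(2) by (rule bij_betw_apply)
  obtain C1 where C1: "lex (f B) C1" using lex_no_max[OF fB] by blast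
  obtain C2 where C2: "lex C2 (f B)" using lex_no_min[OF fB] by blast
  have "C1 \<in> f ` path_cone A" "C2 \<in> f ` path_cone A"
    using C1 C2 bij_betw_imp_surj_on[OF f(1)] unfolding lex_def by auto
  then show "\<exists>C\<in>path_cone A. lex B C" "\<exists>C\<in>path_cone A. lex C B"
    using C1 C2 f(2) assms(2) by blast+
qed

text \<open>Follow \<open>B\<close> past a bound \<open>z\<close> of \<open>A\<close>, and one point
  further, so that \<open>A' = below lt B b\<close> contains a point \<open>b'\<close> beyond
  \<open>z\<close>. Then \<open>A'\<close> is no initial segment of \<open>A\<close>, nor
  \<open>A\<close> of \<open>A'\<close>, as \<open>B\<close> is not in the cone of \<open>A\<close>.
  So the cone at \<open>A'\<close> lies entirely above the cone at \<open>A\<close>, and it has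
  members before \<open>B\<close>.\<close>

lemma cone_bounds_no_min:
  assumes A: "A \<in> bounded_paths" and B: "B \<in> cofinal_paths" and above: "\<And>E. E \<in> path_cone A \<Longrightarrow> lex E B"
  shows "\<exists>F. lex F B \<and> (\<forall>E\<in>path_cone A. lex E F)"
proof -
  have pA: "is_path A" and pB: "is_path B" and BX: "B \<subseteq> X"
    using A B cofinal_path_subset unfolding bounded_paths_def cofinal_paths_def by blast+
  obtain z where z: "z \<in> X" "\<forall>y\<in>A. \<not> z \<sqsubset> y" using A unfolding bounded_paths_def by blast
  obtain b' where b': "b' \<in> B" "z \<sqsubset> b'" using B z(1) unfolding cofinal_paths_def by blast
  obtain b where b: "b \<in> B" "b' \<sqsubset> b" using B b' BX unfolding cofinal_paths_def by blast
  define A' where "A' = below lt B b"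
  have A': "A' \<in> bounded_paths" unfolding A'_def by (rule below_bounded[OF pB b(1)])
  have pA': "is_path A'" using A' unfolding bounded_paths_def by blast
  have "b' \<in> A'" unfolding A'_def below_def using b b' by blast
  then have 1: "\<not> initial_seg lt A' A" using z(2) b'(2) unfolding initial_seg_def by blast
  have BA': "B \<in> path_cone A'" unfolding A'_def by (rule path_cone_below[OF B])
  have 2: "\<not> initial_seg lt A A'"
    using path_cone_antimono[of A A'] BA' above lex_irrefl by blast
  obtain E where E: "E \<in> path_cone A" using path_cone_nonempty[OF A] by blast
  have "\<forall>E\<in>path_cone A. \<forall>F\<in>path_cone A'. lex E F"
    using cones_trichotomy[OF pA pA'] 1 2 above[OF E] E BA' lex_asym by blast
  moreover obtain F where "F \<in> path_cone A'" "lex F B" using path_cone_no_max_min(2)[OF A' BA'] by blast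
  ultimately show ?thesis by blast
qed

text \<open>At the first difference, \<open>B\<close> takes \<open>x\<close> and \<open>C\<close>
  takes a larger \<open>y\<close> after the same path \<open>A\<close>. Any cofinal path that takes
  a point strictly between \<open>x\<close> and \<open>y\<close> after \<open>A\<close> lies between
  \<open>B\<close> and \<open>C\<close>.\<close>

lemma lex_dense:
  assumes "lex B C"
  shows "\<exists>E. lex B E \<and> lex E C"
proof -
  obtain x where x: "x \<in> B" "x \<notin> C" "\<And>y. y \<sqsubset> x \<Longrightarrow> y \<in> B \<longleftrightarrow> y \<in> C"
    and BC: "B \<in> cofinal_paths" "C \<in> cofinal_paths" using assms unfolding lex_def by blast
  have pB: "is_path B" and pC: "is_path C" using BC unfolding cofinal_paths_def by auto
  define A where "A = below lt B x"
  have AC: "A = below lt C x" unfolding A_def below_def using x(3) by blast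
  have A: "A \<in> bounded_paths" unfolding A_def by (rule below_bounded[OF pB x(1)])
  have xA: "x \<in> extensions A" unfolding A_def by (rule path_extensions[OF pB x(1)])
  have B: "B \<in> path_cone (insert x A)"
    unfolding path_cone_def A_def using BC x(1) initial_seg_insert_below cofinal_path_subset by blast
  have "A \<noteq> C" using A BC unfolding bounded_paths_def cofinal_paths_def by blast
  then obtain y where y: "y \<in> C" "y \<in> extensions A" "initial_seg lt (insert y A) C"
    using initial_seg_next[OF pC] initial_seg_below AC by metis
  have "y \<noteq> x" using y x by blast
  moreover have "\<not> y \<sqsubset> x" using y(1,2) AC extensions_not_mem unfolding below_def by blast
  ultimately have "x \<sqsubset> y" using total xA y(2) extensions_subset by blast
  then obtain w where w: "x \<sqsubset> w" "w \<sqsubset> y" using dense by blast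
  have wA: "w \<in> extensions A" by (rule extensions_up[OF xA w(1)])
  obtain E where E: "E \<in> path_cone (insert w A)"
    using path_cone_nonempty[OF bounded_paths_insert[OF A wA]] by blast
  have C: "C \<in> path_cone (insert y A)" using BC y(3) unfolding path_cone_def by blast
  have AX: "A \<subseteq> X" by (rule bounded_path_subset[OF A])
  show ?thesis
    using lex_insert_cones[OF AX w(1) xA B E] lex_insert_cones[OF AX w(2) wA E C] by blast
qed

section \<open>Lower, upper and convex sets of cofinal paths\<close>

lemma open_convex_extensions_below:
  assumes "b \<in> extensions A"
  shows "open_convex lt {x\<in>extensions A. x \<sqsubset> b}"
  unfolding open_convex_def
proof (intro conjI ballI allI impI)
  show "{x\<in>extensions A. x \<sqsubset> b} \<noteq> {}" using extensions_no_min[OF assms] by blast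
  show "z \<in> {x\<in>extensions A. x \<sqsubset> b}"
    if "x \<in> {x\<in>extensions A. x \<sqsubset> b}" "y \<in> {x\<in>extensions A. x \<sqsubset> b}" "x \<sqsubset> z \<and> z \<sqsubset> y" for x y z
    using that extensions_up lt_trans by blast
  fix x assume x: "x \<in> {x\<in>extensions A. x \<sqsubset> b}"
  show "\<exists>y\<in>{x\<in>extensions A. x \<sqsubset> b}. y \<sqsubset> x" using x extensions_no_min[of x A] lt_trans by blast
  obtain w where "x \<sqsubset> w" "w \<sqsubset> b" using x dense by blast
  then show "\<exists>y\<in>{x\<in>extensions A. x \<sqsubset> b}. x \<sqsubset> y" using x extensions_up by blast
qed

lemma open_convex_above:
  assumes "b \<in> X"
  shows "open_convex lt {x. b \<sqsubset> x}"
  unfolding open_convex_def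
proof (intro conjI ballI allI impI)
  show "{x. b \<sqsubset> x} \<noteq> {}" using no_max[OF assms] by blast
  show "z \<in> {x. b \<sqsubset> x}" if "x \<in> {x. b \<sqsubset> x}" "y \<in> {x. b \<sqsubset> x}" "x \<sqsubset> z \<and> z \<sqsubset> y" for x y z
    using that lt_trans by blast
  show "\<exists>y\<in>{x. b \<sqsubset> x}. y \<sqsubset> x" if "x \<in> {x. b \<sqsubset> x}" for x
    using that dense by blast
  show "\<exists>y\<in>{x. b \<sqsubset> x}. x \<sqsubset> y" if "x \<in> {x. b \<sqsubset> x}" for x
    using that no_max[of x] carrier lt_trans by blast
qed

text \<open>The path along which the cut between a lower set \<open>U\<close> and its complement runs.\<close>

definition cut_path :: "'a set set \<Rightarrow> 'a set" where
  "cut_path U = \<Union>{A\<in>bounded_paths. path_cone A \<inter> U \<noteq> {} \<and> path_cone A - U \<noteq> {}}"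

context
  fixes U
  assumes lower: "\<forall>B\<in>U. \<forall>C. lex C B \<longrightarrow> C \<in> U"
begin

lemma cut_path_path: "is_path (cut_path U)"
  and cut_path_initial: "\<And>A. A \<in> bounded_paths \<Longrightarrow> path_cone A \<inter> U \<noteq> {} \<Longrightarrow> path_cone A - U \<noteq> {} \<Longrightarrow>
    initial_seg lt A (cut_path U)"
proof -
  let ?C = "{A\<in>bounded_paths. path_cone A \<inter> U \<noteq> {} \<and> path_cone A - U \<noteq> {}}"
  have path: "is_path A" if "A \<in> ?C" for A using that unfolding bounded_paths_def by blast
  \<comment> \<open>The cones at incomparable vertices would be entirely in order, and then the
    lower set \<open>U\<close> would contain the whole earlier cone, which also has points outside
    \<open>U\<close>.\<close>
  have "initial_seg lt A B \<or> initial_seg lt B A" if "A \<in> ?C" "B \<in> ?C" for A B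
    using cones_trichotomy[OF path path, OF that] that lower by blast
  note * = path_Union[of ?C, OF path this]
  show "is_path (cut_path U)" using *(1) unfolding cut_path_def by simp
  show "initial_seg lt A (cut_path U)"
    if "A \<in> bounded_paths" "path_cone A \<inter> U \<noteq> {}" "path_cone A - U \<noteq> {}" for A
    using *(2)[of A] that unfolding cut_path_def by simp
qed

text \<open>The point \<open>b\<close> lies in some vertex whose cone meets both \<open>U\<close>
  and its complement, and the cone at the segment of the cut path up to \<open>b\<close> contains
  that cone.\<close>

lemma cut_path_witnesses:
  assumes "b \<in> cut_path U"
  obtains C C' where "C \<in> U" "C \<in> path_cone (insert b (below lt (cut_path U) b))"
    "C' \<in> cofinal_paths" "C' \<notin> U" "C' \<in> path_cone (insert b (below lt (cut_path U) b))"
proof -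
  obtain A where A: "A \<in> bounded_paths" "b \<in> A" "path_cone A \<inter> U \<noteq> {}" "path_cone A - U \<noteq> {}"
    using assms unfolding cut_path_def by blast
  have "below lt (cut_path U) b = below lt A b"
    using initial_seg_below_eq[OF cut_path_initial[OF A(1,3,4)] A(2)] by simp
  then have "path_cone A \<subseteq> path_cone (insert b (below lt (cut_path U) b))"
    using path_cone_antimono[OF initial_seg_insert_below[OF A(2) bounded_path_subset[OF A(1)]]] by simp
  then show ?thesis using A(3,4) that path_cone_subset by blast
qed

lemma cut_path_separates:
  assumes "path_cone A \<inter> U \<noteq> {}" "path_cone A - U \<noteq> {}" "A \<in> bounded_paths" "x \<in> A"
  shows "x \<in> cut_path U"
  using assms unfolding cut_path_def by blast

end

text \<open>Where the cut path ends, each successor cone lies on one side of the cut. The points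
  whose cones are in \<open>W\<close> form an initial or final part \<open>I\<close> of
  \<open>extensions D\<close>: without an extreme point at the cut it is open convex, and otherwise
  one cone is split off, which \<open>good_union\<close> puts back.\<close>

lemma fan_lower_or_upper_good:
  assumes D: "D \<in> bounded_paths" and W: "W \<subseteq> cofinal_paths"
    and cones: "\<And>x. x \<in> extensions D \<Longrightarrow> path_cone (insert x D) \<subseteq> W \<or> path_cone (insert x D) \<inter> W = {}"
    and dir: "(\<forall>B\<in>W. \<forall>C. lex C B \<longrightarrow> C \<in> W) \<or> (\<forall>B\<in>W. \<forall>C. lex B C \<longrightarrow> C \<in> W)"
  shows "path_cone D \<inter> W = {} \<or> good (path_cone D \<inter> W)"
proof -
  define I where "I = {x\<in>extensions D. path_cone (insert x D) \<subseteq> W}"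
  have eq: "path_cone D \<inter> W = fan D I"
  proof
    show "fan D I \<subseteq> path_cone D \<inter> W"
      using path_cone_eq_fan[OF D] unfolding fan_def I_def by blast
    show "path_cone D \<inter> W \<subseteq> fan D I"
    proof
      fix B assume B: "B \<in> path_cone D \<inter> W"
      then obtain x where x: "x \<in> extensions D" "B \<in> path_cone (insert x D)"
        using path_cone_eq_fan[OF D] unfolding fan_def by blast
      then have "x \<in> I" using cones[OF x(1)] B unfolding I_def by blast
      then show "B \<in> fan D I" using x(2) unfolding fan_def by blast
    qed
  qed
  have IE: "I \<subseteq> extensions D" unfolding I_def by blast
  have DX: "D \<subseteq> X" by (rule bounded_path_subset[OF D])
  have ins: "insert x D \<in> bounded_paths" if "x \<in> extensions D" for x
    using bounded_paths_insert[OF D that] .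
  have fan_insert: "fan D (insert x J) = fan D J \<union> path_cone (insert x D)" for x J
    unfolding fan_def by blast
  have mem: "y \<in> I" if "y \<in> extensions D" "E \<in> path_cone (insert y D)" "E \<in> W" for y E
    using cones[OF that(1)] that unfolding I_def by blast
  show ?thesis
  proof (cases "I = {}")
    case True
    then show ?thesis using eq unfolding fan_def by blast
  next
    case ne: False
    from dir show ?thesis
    proof
      assume low: "\<forall>B\<in>W. \<forall>C. lex C B \<longrightarrow> C \<in> W"
      have down: "y \<in> I" if "x \<in> I" "y \<sqsubset> x" and yE: "y \<in> extensions D" for x y
      proof -
        have xE: "x \<in> extensions D" using that IE by blast
        obtain B where B: "B \<in> path_cone (insert x D)" using path_cone_nonempty[OF ins[OF xE]] by blast
        obtain E where E: "E \<in> path_cone (insert y D)" using path_cone_nonempty[OF ins[OF yE]] by blast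
        have "B \<in> W" using B that(1) unfolding I_def by blast
        then show ?thesis using low lex_insert_cones[OF DX that(2,3) E B] mem[OF that(3) E] by blast
      qed
      show ?thesis
      proof (cases "\<exists>b\<in>I. \<forall>x\<in>I. \<not> b \<sqsubset> x")
        case False
        have "open_convex lt I"
          unfolding open_convex_def
        proof (intro conjI ballI allI impI)
          show "z \<in> I" if "x \<in> I" "y \<in> I" "x \<sqsubset> z \<and> z \<sqsubset> y" for x y z
            using down[of y z] that extensions_up[of x D z] IE by blast
          show "\<exists>y\<in>I. y \<sqsubset> x" if "x \<in> I" for x
            using extensions_no_min[of x D] down[OF that] that IE by blast
          show "\<exists>y\<in>I. x \<sqsubset> y" if "x \<in> I" for x using False that by blast
        qed (rule ne)
        then show ?thesis using good_fan[OF D IE] eq by simp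
      next
        case True
        then obtain b where b: "b \<in> I" "\<forall>x\<in>I. \<not> b \<sqsubset> x" by blast
        have bE: "b \<in> extensions D" using b IE by blast
        have "I = insert b {x\<in>extensions D. x \<sqsubset> b}"
        proof
          show "I \<subseteq> insert b {x\<in>extensions D. x \<sqsubset> b}"
            using b total IE extensions_subset by blast
          show "insert b {x\<in>extensions D. x \<sqsubset> b} \<subseteq> I"
            using b down by blast
        qed
        then have "fan D I = fan D {x\<in>extensions D. x \<sqsubset> b} \<union> path_cone (insert b D)"
          using fan_insert by metis
        moreover have "good (fan D {x\<in>extensions D. x \<sqsubset> b} \<union> path_cone (insert b D))"
        proof (rule good_union)
          show "good (fan D {x\<in>extensions D. x \<sqsubset> b})"
            by (rule good_fan[OF D _ open_convex_extensions_below[OF bE]]) blast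
          show "good (path_cone (insert b D))" by (rule good_path_cone[OF ins[OF bE]])
          show "\<forall>B\<in>fan D {x\<in>extensions D. x \<sqsubset> b}. \<forall>C\<in>path_cone (insert b D). lex B C"
            using lex_insert_cones[OF DX] unfolding fan_def by blast
        qed
        ultimately show ?thesis using eq by simp
      qed
    next
      assume high: "\<forall>B\<in>W. \<forall>C. lex B C \<longrightarrow> C \<in> W"
      have up: "y \<in> I" if "x \<in> I" "x \<sqsubset> y" for x y
      proof -
        have xE: "x \<in> extensions D" using that IE by blast
        have yE: "y \<in> extensions D" by (rule extensions_up[OF xE that(2)])
        obtain B where B: "B \<in> path_cone (insert x D)" using path_cone_nonempty[OF ins[OF xE]] by blast
        obtain E where E: "E \<in> path_cone (insert y D)" using path_cone_nonempty[OF ins[OF yE]] by blast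
        have "B \<in> W" using B that(1) unfolding I_def by blast
        then show ?thesis using high lex_insert_cones[OF DX that(2) xE B E] mem[OF yE E] by blast
      qed
      show ?thesis
      proof (cases "\<exists>b\<in>I. \<forall>x\<in>I. \<not> x \<sqsubset> b")
        case False
        have "open_convex lt I"
          unfolding open_convex_def
        proof (intro conjI ballI allI impI)
          show "z \<in> I" if "x \<in> I" "y \<in> I" "x \<sqsubset> z \<and> z \<sqsubset> y" for x y z
            using up[of x z] that by blast
          show "\<exists>y\<in>I. y \<sqsubset> x" if "x \<in> I" for x using False that by blast
          show "\<exists>y\<in>I. x \<sqsubset> y" if "x \<in> I" for x
            using no_max[of x] up[OF that] that IE extensions_subset by blast
        qed (rule ne)
        then show ?thesis using good_fan[OF D IE] eq by simp
      next
        case True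
        then obtain b where b: "b \<in> I" "\<forall>x\<in>I. \<not> x \<sqsubset> b" by blast
        have bE: "b \<in> extensions D" using b IE by blast
        have bX: "b \<in> X" using bE extensions_subset by blast
        have sub: "{x. b \<sqsubset> x} \<subseteq> extensions D" using extensions_up[OF bE] by blast
        have "I = insert b {x. b \<sqsubset> x}"
        proof
          show "I \<subseteq> insert b {x. b \<sqsubset> x}"
            using b total IE extensions_subset by blast
          show "insert b {x. b \<sqsubset> x} \<subseteq> I" using b up by blast
        qed
        then have "fan D I = path_cone (insert b D) \<union> fan D {x. b \<sqsubset> x}"
          using fan_insert by (metis Un_commute)
        moreover have "good (path_cone (insert b D) \<union> fan D {x. b \<sqsubset> x})"
        proof (rule good_union)
          show "good (fan D {x. b \<sqsubset> x})"
            by (rule good_fan[OF D sub open_convex_above[OF bX]])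
          show "good (path_cone (insert b D))" by (rule good_path_cone[OF ins[OF bE]])
          show "\<forall>B\<in>path_cone (insert b D). \<forall>C\<in>fan D {x. b \<sqsubset> x}. lex B C"
            using lex_insert_cones[OF DX _ bE] unfolding fan_def by blast
        qed
        ultimately show ?thesis using eq by simp
      qed
    qed
  qed
qed

lemma cofinal_initial_seg_eq:
  assumes "D \<in> cofinal_paths" "B \<in> path_cone D"
  shows "B = D"
proof -
  have B: "B \<in> cofinal_paths" "initial_seg lt D B" using assms(2) unfolding path_cone_def by auto
  have "b \<in> D" if "b \<in> B" for b
  proof -
    have "b \<in> X" using that B(1) cofinal_path_subset by blast
    then obtain d where "d \<in> D" "b \<sqsubset> d" using assms(1) unfolding cofinal_paths_def by blast
    then show ?thesis using that B(2) unfolding initial_seg_def by blast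
  qed
  then show ?thesis using initial_seg_subset[OF B(2)] by blast
qed

text \<open>\<open>B\<close> leaves \<open>D\<close> by taking \<open>x\<close>, and
  \<open>b\<close> is the value of \<open>D\<close> at that place, the least point of
  \<open>D\<close> above \<open>x\<close>. It exists, since otherwise \<open>D\<close> would lie
  below \<open>x\<close> and be an initial segment of \<open>B\<close>.\<close>

lemma below_cut_eq:
  assumes "is_path D" "is_path B" "x \<in> B" "x \<notin> D" "\<And>y. y \<sqsubset> x \<Longrightarrow> y \<in> B \<longleftrightarrow> y \<in> D" "\<not> initial_seg lt D B"
  obtains b where "b \<in> D" "x \<sqsubset> b" "below lt D b = below lt B x"
proof -
  have xX: "x \<in> X" and DX: "D \<subseteq> X" using assms(1-3) path_subset by blast+
  define S where "S = {b\<in>D. x \<sqsubset> b}"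
  have "S \<noteq> {}"
  proof
    assume "S = {}"
    then have lt: "d \<sqsubset> x" if "d \<in> D" for d
      using total[of d x] that xX DX assms(4) unfolding S_def by blast
    then have "initial_seg lt D B"
      using assms(5) lt_trans unfolding initial_seg_def by blast
    then show False using assms(6) by blast
  qed
  then obtain b where bS: "b \<in> S" and minS: "\<And>y. y \<in> S \<Longrightarrow> y \<noteq> b \<Longrightarrow> b \<sqsubset> y"
    using path_min[OF assms(1), of S] unfolding S_def by blast
  have b: "b \<in> D" "x \<sqsubset> b" using bS unfolding S_def by auto
  have min: "b \<sqsubset> y" if "y \<in> D" "x \<sqsubset> y" "y \<noteq> b" for y
    using minS[of y] that unfolding S_def by blast
  have "y \<sqsubset> x" if "y \<in> D" "y \<sqsubset> b" for y
    using min[OF that(1)] that asym irr total[of y x] xX DX assms(4) by blast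
  then have "below lt D b = below lt B x"
    using assms(5) b lt_trans unfolding below_def by blast
  then show ?thesis using that b by blast
qed

text \<open>A member of \<open>U\<close> that does not follow the whole cut path \<open>D\<close>
  must leave it downward, at some \<open>b\<close> in \<open>D\<close>; \<open>K b\<close> collects
  these members. Those that stay with \<open>D\<close> longer are larger, so \<open>U\<close> is the
  sum of the fans \<open>K b\<close> along the well-ordered \<open>D\<close>, followed by what lies
  in the cone of \<open>D\<close>.\<close>

lemma good_lower:
  assumes sub: "U \<subseteq> cofinal_paths" and ne: "U \<noteq> {}"
    and lower: "\<And>B C. B \<in> U \<Longrightarrow> lex C B \<Longrightarrow> C \<in> U"
    and no_max: "\<And>B. B \<in> U \<Longrightarrow> \<exists>C\<in>U. lex B C"
  shows "good U"
proof -
  have lower': "\<forall>B\<in>U. \<forall>C. lex C B \<longrightarrow> C \<in> U" using lower by blast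
  define D where "D = cut_path U"
  define K where "K b = fan (below lt D b) {x\<in>extensions (below lt D b). x \<sqsubset> b}" for b
  note D_path = cut_path_path[OF lower', folded D_def]
  note witnesses = cut_path_witnesses[OF lower', folded D_def]
  have DX: "D \<subseteq> X" by (rule path_subset[OF D_path])
  have D_ext: "b \<in> extensions (below lt D b)" if "b \<in> D" for b by (rule path_extensions[OF D_path that])
  have D_below: "below lt D b \<in> bounded_paths" if "b \<in> D" for b by (rule below_bounded[OF D_path that])
  have KE: "\<exists>x. x \<sqsubset> b \<and> x \<in> extensions (below lt D b) \<and> x \<notin> D \<and> B \<in> path_cone (insert x (below lt D b))"
    if "B \<in> K b" for B b
    using that extensions_not_mem unfolding K_def fan_def below_def by blast
  have K_U: "K b \<subseteq> U" if b: "b \<in> D" for b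
  proof
    fix B assume "B \<in> K b"
    then obtain x where x: "x \<sqsubset> b" "x \<in> extensions (below lt D b)" "B \<in> path_cone (insert x (below lt D b))"
      using KE by blast
    obtain C where C: "C \<in> U" "C \<in> path_cone (insert b (below lt D b))" using witnesses[OF b] by blast
    show "B \<in> U"
      using lower[OF C(1) lex_insert_cones[OF _ x(1,2,3) C(2)]] DX unfolding below_def by blast
  qed
  have U_sub: "B \<in> (\<Union>b\<in>D. K b)" if B: "B \<in> U" "\<not> initial_seg lt D B" for B
  proof -
    have BL: "B \<in> cofinal_paths" "is_path B" using B sub unfolding cofinal_paths_def by auto
    obtain x where agree: "\<And>y. y \<sqsubset> x \<Longrightarrow> y \<in> B \<longleftrightarrow> y \<in> D" and x: "x \<in> B \<and> x \<notin> D \<or> x \<in> D \<and> x \<notin> B"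
      using separation[OF BL(2) D_path] B(2) by (metis initial_seg_refl)
    \<comment> \<open>If \<open>B\<close> skipped the point \<open>x\<close> of \<open>D\<close>, a
      path outside \<open>U\<close> through \<open>x\<close> would precede \<open>B\<close>.\<close>
    have "x \<in> B \<and> x \<notin> D"
    proof (rule ccontr)
      assume "\<not> (x \<in> B \<and> x \<notin> D)"
      then have xD: "x \<in> D" "x \<notin> B" using x by auto
      obtain C where C: "C \<in> cofinal_paths" "C \<notin> U" "C \<in> path_cone (insert x (below lt D x))"
        using witnesses[OF xD(1)] by blast
      have "lex C B"
      proof (rule lexI[OF C(1) BL(1) _ xD(2)])
        show "x \<in> C" using path_cone_supset[OF C(3)] by blast
        show "y \<in> C \<longleftrightarrow> y \<in> B" if "y \<sqsubset> x" for y
          using path_cone_mem_iff[OF C(3) _ that] agree[OF that] that irr unfolding below_def by blast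
      qed
      then show False using lower[OF B(1)] C(2) by blast
    qed
    then obtain b where b: "b \<in> D" "x \<sqsubset> b" "below lt D b = below lt B x"
      using below_cut_eq[OF D_path BL(2) _ _ agree B(2)] by blast
    have "x \<in> B" using \<open>x \<in> B \<and> x \<notin> D\<close> by blast
    then have "x \<in> extensions (below lt D b)" "B \<in> path_cone (insert x (below lt D b))"
      using path_extensions[OF BL(2)] initial_seg_insert_below[of x B] path_subset[OF BL(2)] BL(1) b(3)
      unfolding path_cone_def by auto
    then have "B \<in> K b" unfolding K_def fan_def using b(2) by blast
    then show ?thesis using b(1) by blast
  qed
  have before: "lex B C" if b: "b \<in> D" and B: "B \<in> K b"
    and C: "C \<in> path_cone A" and A: "b \<in> A" "\<And>y. y \<sqsubset> b \<Longrightarrow> y \<in> A \<longleftrightarrow> y \<in> D" for b B C A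
  proof -
    obtain x where x: "x \<sqsubset> b" "x \<notin> D" "B \<in> path_cone (insert x (below lt D b))" using KE[OF B] by blast
    show ?thesis
    proof (rule lex_cones[OF x(3) C _ _ _ A(1) x(1)])
      show "x \<notin> A" using A(2) x by blast
      show "y \<in> insert x (below lt D b) \<longleftrightarrow> y \<in> A" if "y \<sqsubset> x" for y
        using A(2)[OF lt_trans[OF that x(1)]] lt_trans[OF that x(1)] that irr unfolding below_def by blast
    qed simp
  qed
  have K_good: "good (K b)" if "b \<in> D" for b
    unfolding K_def
    by (rule good_fan[OF D_below[OF that] _ open_convex_extensions_below[OF D_ext[OF that]]]) blast
  have K_K: "lex B C" if de: "d \<in> D" "e \<in> D" "d \<sqsubset> e" "B \<in> K d" "C \<in> K e" for d e B C
  proof -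
    obtain x where x: "x \<sqsubset> e" "x \<in> extensions (below lt D e)" "C \<in> path_cone (insert x (below lt D e))"
      using KE[OF de(5)] by blast
    have d: "d \<in> below lt D e" using that unfolding below_def by blast
    have "d \<sqsubset> x" using extensions_above[OF x(2) d] DX unfolding below_def by blast
    then show ?thesis
      using d lt_trans[OF _ that(3)] asym by (intro before[OF that(1,4) x(3)]) (auto simp: below_def)
  qed
  have "D \<noteq> {} \<longrightarrow> good (\<Union>b\<in>D. K b)"
  proof
    assume "D \<noteq> {}"
    show "good (\<Union>b\<in>D. K b)"
    proof (rule well_ordered_union[where bef = lex])
      show "well_ordered D" using D_path DX unfolding well_ordered_def is_path_def by blast
      show "good (\<Union>n. M n)" if "\<And>n. good (M n)"
        "\<And>m n x y. m < n \<Longrightarrow> x \<in> M m \<Longrightarrow> y \<in> M n \<Longrightarrow> lex x y" for M :: "nat \<Rightarrow> 'a set set"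
        using that by (rule good_omega_up)
    qed (fact \<open>D \<noteq> {}\<close> good_union K_good K_K)+
  qed
  moreover have "path_cone D \<inter> U = {} \<or> good (path_cone D \<inter> U)"
  proof (cases "D \<in> bounded_paths")
    case True
    show ?thesis
    proof (rule fan_lower_or_upper_good[OF True sub])
      show "path_cone (insert x D) \<subseteq> U \<or> path_cone (insert x D) \<inter> U = {}" if x: "x \<in> extensions D" for x
        using cut_path_separates[OF lower', folded D_def] bounded_paths_insert[OF True x] extensions_not_mem[OF x] by blast
    qed (use lower in blast)
  next
    case False
    then have D: "D \<in> cofinal_paths" using path_cases[OF D_path] by blast
    \<comment> \<open>The cone of a cofinal \<open>D\<close> is \<open>D\<close> alone. A member
      \<open>C\<close> of \<open>U\<close> after \<open>D\<close> would skip some \<open>x\<close>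
      in \<open>D\<close>, but there are paths outside \<open>U\<close> that follow \<open>D\<close>
      beyond \<open>x\<close> and so precede \<open>C\<close>.\<close>
    have "D \<notin> U"
    proof
      assume "D \<in> U"
      then obtain C where C: "C \<in> U" "lex D C" using no_max by blast
      then obtain x where x: "x \<in> D" "x \<notin> C" "\<And>y. y \<sqsubset> x \<Longrightarrow> y \<in> D \<longleftrightarrow> y \<in> C" unfolding lex_def by blast
      obtain b where b: "b \<in> D" "x \<sqsubset> b" using D x(1) DX unfolding cofinal_paths_def by blast
      obtain E where E: "E \<in> cofinal_paths" "E \<notin> U" "E \<in> path_cone (insert b (below lt D b))"
        using witnesses[OF b(1)] by blast
      have "lex E C"
      proof (rule lexI[OF E(1) _ _ x(2)])
        show "C \<in> cofinal_paths" using C(1) sub by blast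
        show "x \<in> E" using path_cone_supset[OF E(3)] x(1) b(2) unfolding below_def by blast
        show "y \<in> E \<longleftrightarrow> y \<in> C" if "y \<sqsubset> x" for y
          using path_cone_mem_iff[OF E(3), of b y] lt_trans[OF that b(2)] x(3)[OF that] irr unfolding below_def by blast
      qed
      then show False using lower[OF C(1)] E(2) by blast
    qed
    then show ?thesis using cofinal_initial_seg_eq[OF D] by blast
  qed
  moreover have "U = (\<Union>b\<in>D. K b) \<union> (path_cone D \<inter> U)"
    using K_U U_sub sub unfolding path_cone_def by blast
  moreover have "\<forall>B\<in>\<Union>b\<in>D. K b. \<forall>C\<in>path_cone D \<inter> U. lex B C"
    using before by blast
  ultimately show ?thesis
    using ne good_union[of "\<Union>b\<in>D. K b" "path_cone D \<inter> U"] by (metis UN_empty sup_bot_left sup_bot_right)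
qed

text \<open>Reversing \<open>lex\<close> gives no order of the same form, since paths still run
  upward, so this case is treated on its own. A path in \<open>V\<close> leaves the cut path upward,
  later departures are smaller, and the fans \<open>K b\<close> form a reversed well-ordered sum
  after the part in the cone of \<open>D\<close>.\<close>

lemma good_upper:
  assumes sub: "V \<subseteq> cofinal_paths" and ne: "V \<noteq> {}"
    and upper: "\<And>B C. B \<in> V \<Longrightarrow> lex B C \<Longrightarrow> C \<in> V"
    and no_min: "\<And>B. B \<in> V \<Longrightarrow> \<exists>C\<in>V. lex C B"
  shows "good V"
proof -
  define U where "U = cofinal_paths - V"
  have subU: "U \<subseteq> cofinal_paths" unfolding U_def by blast
  have lower: "C \<in> U" if "B \<in> U" "lex C B" for B C
    using that upper unfolding U_def lex_def by blast
  have lower': "\<forall>B\<in>U. \<forall>C. lex C B \<longrightarrow> C \<in> U" using lower by blast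
  define D where "D = cut_path U"
  define K where "K b = fan (below lt D b) {x. b \<sqsubset> x}" for b
  note D_path = cut_path_path[OF lower', folded D_def]
  note witnesses = cut_path_witnesses[OF lower', folded D_def]
  have DX: "D \<subseteq> X" by (rule path_subset[OF D_path])
  have D_ext: "b \<in> extensions (below lt D b)" if "b \<in> D" for b by (rule path_extensions[OF D_path that])
  have D_below: "below lt D b \<in> bounded_paths" if "b \<in> D" for b by (rule below_bounded[OF D_path that])
  have below_X: "below lt D b \<subseteq> X" for b using DX unfolding below_def by blast
  have KE: "\<exists>x. b \<sqsubset> x \<and> B \<in> path_cone (insert x (below lt D b))" if "B \<in> K b" for B b
    using that unfolding K_def fan_def by blast
  have K_V: "K b \<subseteq> V" if b: "b \<in> D" for b
  proof
    fix B assume "B \<in> K b"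
    then obtain x where x: "b \<sqsubset> x" "B \<in> path_cone (insert x (below lt D b))"
      using KE by blast
    obtain C where C: "C \<in> cofinal_paths" "C \<notin> U" "C \<in> path_cone (insert b (below lt D b))"
      using witnesses[OF b] by blast
    show "B \<in> V"
      using upper[OF _ lex_insert_cones[OF below_X x(1) D_ext[OF b] C(3) x(2)]] C unfolding U_def by blast
  qed
  have V_sub: "B \<in> (\<Union>b\<in>D. K b)" if B: "B \<in> V" "\<not> initial_seg lt D B" for B
  proof -
    have BL: "B \<in> cofinal_paths" "is_path B" using B sub unfolding cofinal_paths_def by auto
    obtain x where agree: "\<And>y. y \<sqsubset> x \<Longrightarrow> y \<in> B \<longleftrightarrow> y \<in> D" and x: "x \<in> B \<and> x \<notin> D \<or> x \<in> D \<and> x \<notin> B"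
      using separation[OF BL(2) D_path] B(2) by (metis initial_seg_refl)
    \<comment> \<open>Were \<open>B\<close> to leave \<open>D\<close> downward at \<open>x\<close>,
      it would precede a member of \<open>U\<close> that follows \<open>D\<close> through a later
      point \<open>b\<close>.\<close>
    have xD: "x \<in> D \<and> x \<notin> B"
    proof (rule ccontr)
      assume "\<not> (x \<in> D \<and> x \<notin> B)"
      then have xB: "x \<in> B" "x \<notin> D" using x by auto
      obtain b where b: "b \<in> D" "x \<sqsubset> b" "below lt D b = below lt B x"
        using below_cut_eq[OF D_path BL(2) xB agree B(2)] by blast
      obtain C where C: "C \<in> U" "C \<in> path_cone (insert b (below lt D b))" using witnesses[OF b(1)] by blast
      have "lex B C"
      proof (rule lexI[OF BL(1) _ xB(1)])
        show "C \<in> cofinal_paths" using C(1) subU by blast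
        show "x \<notin> C" using path_cone_mem_iff[OF C(2) _ b(2)] xB(2) b(2) irr unfolding below_def by blast
        show "y \<in> B \<longleftrightarrow> y \<in> C" if "y \<sqsubset> x" for y
          using path_cone_mem_iff[OF C(2), of b y] lt_trans[OF that b(2)] agree[OF that] irr
          unfolding below_def by blast
      qed
      then show False using lower[OF C(1)] B(1) unfolding U_def by blast
    qed
    have Bx: "below lt B x = below lt D x" using agree unfolding below_def by blast
    have "below lt D x \<noteq> B" using D_below[of x] xD BL unfolding bounded_paths_def cofinal_paths_def by blast
    then obtain y where y: "y \<in> B" "y \<in> extensions (below lt D x)" "initial_seg lt (insert y (below lt D x)) B"
      using initial_seg_next[OF BL(2), of "below lt D x"] initial_seg_below[of B x] Bx by metis
    have "y \<noteq> x" "\<not> y \<sqsubset> x" using y xD extensions_not_mem[OF y(2)] Bx unfolding below_def by blast+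
    then have "x \<sqsubset> y" using total[of x y] xD y(1) DX cofinal_path_subset[OF BL(1)] by blast
    then have "B \<in> K x" using y(3) BL(1) unfolding K_def fan_def path_cone_def by blast
    then show ?thesis using xD by blast
  qed
  have before: "lex C B" if b: "b \<in> D" and B: "B \<in> K b"
    and C: "C \<in> path_cone A" and A: "b \<in> A" "\<And>y. y \<sqsubset> b \<Longrightarrow> y \<in> A \<longleftrightarrow> y \<in> D" for b B C A
  proof -
    obtain x where x: "b \<sqsubset> x" "B \<in> path_cone (insert x (below lt D b))" using KE[OF B] by blast
    show ?thesis
    proof (rule lex_cones[OF C x(2) A(1) _ _ _ x(1)])
      show "b \<notin> insert x (below lt D b)" using x(1) irr unfolding below_def by blast
      show "y \<in> A \<longleftrightarrow> y \<in> insert x (below lt D b)" if "y \<sqsubset> b" for y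
        using A(2)[OF that] that x(1) asym unfolding below_def by blast
    qed simp
  qed
  have K_good: "good (K b)" if b: "b \<in> D" for b
    unfolding K_def
  proof (rule good_fan[OF D_below[OF b] _ open_convex_above])
    show "{x. b \<sqsubset> x} \<subseteq> extensions (below lt D b)" using extensions_up[OF D_ext[OF b]] by blast
  qed (use b DX in blast)
  have K_K: "lex C B" if de: "d \<in> D" "e \<in> D" "d \<sqsubset> e" "B \<in> K d" "C \<in> K e" for d e B C
  proof -
    obtain x where x: "e \<sqsubset> x" "C \<in> path_cone (insert x (below lt D e))" using KE[OF de(5)] by blast
    have d: "d \<in> below lt D e" using that unfolding below_def by blast
    have "d \<sqsubset> x" by (rule lt_trans[OF that(3) x(1)])
    then show ?thesis
      using d lt_trans[OF _ that(3)] asym by (intro before[OF that(1,4) x(2)]) (auto simp: below_def)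
  qed
  have "D \<noteq> {} \<longrightarrow> good (\<Union>b\<in>D. K b)"
  proof
    assume "D \<noteq> {}"
    show "good (\<Union>b\<in>D. K b)"
    proof (rule well_ordered_union[where bef = "\<lambda>x y. lex y x"])
      show "well_ordered D" using D_path DX unfolding well_ordered_def is_path_def by blast
      show "good (\<Union>n. M n)" if "\<And>n. good (M n)"
        "\<And>m n x y. m < n \<Longrightarrow> x \<in> M m \<Longrightarrow> y \<in> M n \<Longrightarrow> lex y x" for M :: "nat \<Rightarrow> 'a set set"
        using that by (rule good_omega_down)
      show "good (M \<union> M')" if "good M" "good M'" "\<forall>x\<in>M. \<forall>y\<in>M'. lex y x" for M M'
        using good_union[OF that(2,1)] that(3) by (simp add: Un_commute)
    qed (fact \<open>D \<noteq> {}\<close> K_good K_K)+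
  qed
  moreover have "path_cone D \<inter> V = {} \<or> good (path_cone D \<inter> V)"
  proof (cases "D \<in> bounded_paths")
    case True
    show ?thesis
    proof (rule fan_lower_or_upper_good[OF True sub])
      show "path_cone (insert x D) \<subseteq> V \<or> path_cone (insert x D) \<inter> V = {}" if x: "x \<in> extensions D" for x
        using cut_path_separates[OF lower', folded D_def] bounded_paths_insert[OF True x]
          extensions_not_mem[OF x] path_cone_subset unfolding U_def by blast
    qed (use upper in blast)
  next
    case False
    then have D: "D \<in> cofinal_paths" using path_cases[OF D_path] by blast
    have "D \<notin> V"
    proof
      assume "D \<in> V"
      then obtain C where C: "C \<in> V" "lex C D" using no_min by blast
      then obtain x where x: "x \<in> C" "x \<notin> D" "\<And>y. y \<sqsubset> x \<Longrightarrow> y \<in> C \<longleftrightarrow> y \<in> D" unfolding lex_def by blast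
      have CL: "C \<in> cofinal_paths" using C(1) sub by blast
      have "x \<in> X" using x(1) cofinal_path_subset[OF CL] by blast
      then obtain b where b: "b \<in> D" "x \<sqsubset> b" using D unfolding cofinal_paths_def by blast
      obtain E where E: "E \<in> U" "E \<in> path_cone (insert b (below lt D b))"
        using witnesses[OF b(1)] by blast
      have "lex C E"
      proof (rule lexI[OF CL _ x(1)])
        show "E \<in> cofinal_paths" using E(1) subU by blast
        show "x \<notin> E" using path_cone_mem_iff[OF E(2) _ b(2)] x(2) b(2) irr unfolding below_def by blast
        show "y \<in> C \<longleftrightarrow> y \<in> E" if "y \<sqsubset> x" for y
          using path_cone_mem_iff[OF E(2), of b y] lt_trans[OF that b(2)] x(3)[OF that] irr unfolding below_def by blast
      qed
      then show False using lower[OF E(1)] C(1) unfolding U_def by blast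
    qed
    then show ?thesis using cofinal_initial_seg_eq[OF D] by blast
  qed
  moreover have "V = (path_cone D \<inter> V) \<union> (\<Union>b\<in>D. K b)"
    using K_V V_sub sub unfolding path_cone_def by blast
  moreover have "\<forall>B\<in>path_cone D \<inter> V. \<forall>C\<in>\<Union>b\<in>D. K b. lex B C"
    using before by blast
  ultimately show ?thesis
    using ne good_union[of "path_cone D \<inter> V" "\<Union>b\<in>D. K b"] by (metis UN_empty sup_bot_left sup_bot_right)
qed

text \<open>\<open>J\<close> is cut along a cone: for \<open>C\<close> before \<open>C'\<close> in
  \<open>J\<close>, \<open>P\<close> is the lower set generated by the cone at the first vertex of
  \<open>C\<close> that \<open>C'\<close> does not share. A cone has no last member and no least
  upper bound, so \<open>P\<close> and its complement \<open>Q\<close> are both copies of the whole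
  space. In these copies the two halves of \<open>J\<close> become an upper and a lower set.\<close>

lemma good_open_convex:
  assumes J: "J \<subseteq> cofinal_paths" "open_convex lex J"
  shows "good J"
proof -
  have convex: "z \<in> J" if "x \<in> J" "y \<in> J" "lex x z" "lex z y" for x y z
    using J(2) that unfolding open_convex_def by blast
  have up: "\<exists>y\<in>J. lex x y" and down: "\<exists>y\<in>J. lex y x" if "x \<in> J" for x
    using J(2) that unfolding open_convex_def by blast+
  obtain C where C: "C \<in> J" using J(2) unfolding open_convex_def by blast
  obtain C' where C': "C' \<in> J" "lex C C'" using up[OF C] by blast
  then obtain x where x: "x \<in> C" "x \<notin> C'" "\<And>y. y \<sqsubset> x \<Longrightarrow> y \<in> C \<longleftrightarrow> y \<in> C'" unfolding lex_def by blast
  have CL: "C \<in> cofinal_paths" "C' \<in> cofinal_paths" "is_path C" using C C' J(1) unfolding cofinal_paths_def by auto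
  have CX: "C \<subseteq> X" using cofinal_path_subset[OF CL(1)] .
  define A where "A = insert x (below lt C x)"
  have A: "A \<in> bounded_paths"
    unfolding A_def using bounded_paths_insert below_bounded path_extensions CL(3) x(1) by blast
  have CA: "C \<in> path_cone A"
    unfolding path_cone_def A_def using CL(1) initial_seg_insert_below[OF x(1) CX] by blast
  define P where "P = {B. \<exists>E\<in>path_cone A. lex B E}"
  define Q where "Q = cofinal_paths - P"
  have P_sub: "P \<subseteq> cofinal_paths" unfolding P_def lex_def by blast
  have P_lower: "B \<in> P" if "E \<in> P" "lex B E" for B E
    using that lex_trans unfolding P_def by blast
  have Q_upper: "B \<in> Q" if "E \<in> Q" "lex E B" for B E
    using that P_lower unfolding Q_def lex_def by blast
  have PQ: "lex B E" if "B \<in> P" "E \<in> Q" for B E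
    using that P_lower lex_total P_sub unfolding Q_def by blast
  have cone_P: "path_cone A \<subseteq> P"
    using path_cone_no_max_min(1)[OF A] unfolding P_def by blast
  have CP: "C \<in> P" using CA cone_P by blast
  have "C' \<notin> P"
  proof
    assume "C' \<in> P"
    then obtain E where E: "E \<in> path_cone A" "lex C' E" unfolding P_def by blast
    have "lex E C'"
    proof (rule lexI[OF _ CL(2) _ x(2)])
      show "E \<in> cofinal_paths" "x \<in> E"
        using E(1) path_cone_subset path_cone_supset unfolding A_def by blast+
      show "y \<in> E \<longleftrightarrow> y \<in> C'" if "y \<sqsubset> x" for y
        using path_cone_mem_iff[OF E(1) _ that] x(3)[OF that] that irr unfolding A_def below_def by blast
    qed
    then show False using E(2) lex_asym by blast
  qed
  then have CQ: "C' \<in> Q" using CL(2) unfolding Q_def by blast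
  have P_good: "good P"
  proof (rule good_lower[OF P_sub])
    show "\<exists>E\<in>P. lex B E" if "B \<in> P" for B using that cone_P unfolding P_def by blast
    show "P \<noteq> {}" using CP by blast
    show "C \<in> P" if "B \<in> P" "lex C B" for B C using P_lower that .
  qed
  have Q_good: "good Q"
  proof (rule good_upper)
    fix B assume B: "B \<in> Q"
    then have "lex E B" if "E \<in> path_cone A" for E
      using PQ cone_P that by blast
    then obtain F where F: "lex F B" "\<forall>E\<in>path_cone A. lex E F"
      using cone_bounds_no_min[OF A] B unfolding Q_def by blast
    then have "F \<in> Q" using lex_asym unfolding Q_def P_def lex_def by blast
    then show "\<exists>F\<in>Q. lex F B" using F(1) by blast
  next
    show "Q \<subseteq> cofinal_paths" unfolding Q_def by blast
    show "Q \<noteq> {}" using CQ by blast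
    show "C \<in> Q" if "B \<in> Q" "lex B C" for B C using Q_upper that .
  qed
  have "good (J \<inter> P)"
  proof -
    obtain f where f: "bij_betw f P cofinal_paths" "\<And>x y. x \<in> P \<Longrightarrow> y \<in> P \<Longrightarrow> lex x y \<longleftrightarrow> lex (f x) (f y)"
      using P_good unfolding ord_iso_def by auto
    have surj: "\<exists>p\<in>P. B = f p" if "B \<in> cofinal_paths" for B
      using bij_betw_imp_surj_on[OF f(1)] that by blast
    have "ord_iso lex (J \<inter> P) lex (f ` (J \<inter> P))" by (rule ord_iso_image[where A = P, OF f(1)]) (use f(2) in auto)
    moreover have "good (f ` (J \<inter> P))"
    proof (rule good_upper)
      show "f ` (J \<inter> P) \<subseteq> cofinal_paths" using bij_betw_imp_surj_on[OF f(1)] by blast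
      show "f ` (J \<inter> P) \<noteq> {}" using C CP by blast
      show "E \<in> f ` (J \<inter> P)" if B: "B \<in> f ` (J \<inter> P)" "lex B E" for B E
      proof -
        obtain j where j: "j \<in> J" "j \<in> P" "B = f j" using B(1) by blast
        obtain p where p: "p \<in> P" "E = f p" using surj B(2) unfolding lex_def by blast
        have "lex j p" using f(2)[OF j(2) p(1)] B(2) j p by simp
        then have "p \<in> J" using convex[OF j(1) C'(1)] PQ[OF p(1) CQ] by blast
        then show ?thesis using p by blast
      qed
      show "\<exists>E\<in>f ` (J \<inter> P). lex E B" if B: "B \<in> f ` (J \<inter> P)" for B
      proof -
        obtain j where j: "j \<in> J" "j \<in> P" "B = f j" using B by blast
        obtain p where p: "p \<in> J" "lex p j" using down[OF j(1)] by blast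
        have "p \<in> P" using P_lower j(2) p(2) .
        then show ?thesis using p f(2)[OF _ j(2)] j(3) by blast
      qed
    qed
    ultimately show ?thesis by (rule ord_iso_trans)
  qed
  moreover have "good (J \<inter> Q)"
  proof -
    obtain f where f: "bij_betw f Q cofinal_paths" "\<And>x y. x \<in> Q \<Longrightarrow> y \<in> Q \<Longrightarrow> lex x y \<longleftrightarrow> lex (f x) (f y)"
      using Q_good unfolding ord_iso_def by auto
    have surj: "\<exists>p\<in>Q. B = f p" if "B \<in> cofinal_paths" for B
      using bij_betw_imp_surj_on[OF f(1)] that by blast
    have "ord_iso lex (J \<inter> Q) lex (f ` (J \<inter> Q))" by (rule ord_iso_image[where A = Q, OF f(1)]) (use f(2) in auto)
    moreover have "good (f ` (J \<inter> Q))"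
    proof (rule good_lower)
      show "f ` (J \<inter> Q) \<subseteq> cofinal_paths" using bij_betw_imp_surj_on[OF f(1)] by blast
      show "f ` (J \<inter> Q) \<noteq> {}" using C'(1) CQ by blast
      show "E \<in> f ` (J \<inter> Q)" if B: "B \<in> f ` (J \<inter> Q)" "lex E B" for B E
      proof -
        obtain j where j: "j \<in> J" "j \<in> Q" "B = f j" using B(1) by blast
        obtain p where p: "p \<in> Q" "E = f p" using surj B(2) unfolding lex_def by blast
        have "lex p j" using f(2)[OF p(1) j(2)] B(2) j p by simp
        then have "p \<in> J" using convex[OF C j(1)] PQ[OF CP p(1)] by blast
        then show ?thesis using p by blast
      qed
      show "\<exists>E\<in>f ` (J \<inter> Q). lex B E" if B: "B \<in> f ` (J \<inter> Q)" for B
      proof -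
        obtain j where j: "j \<in> J" "j \<in> Q" "B = f j" using B by blast
        obtain p where p: "p \<in> J" "lex j p" using up[OF j(1)] by blast
        have "p \<in> Q" using Q_upper j(2) p(2) .
        then show ?thesis using p f(2)[OF j(2)] j(3) by blast
      qed
    qed
    ultimately show ?thesis by (rule ord_iso_trans)
  qed
  moreover have "\<forall>B\<in>J \<inter> P. \<forall>E\<in>J \<inter> Q. lex B E" using PQ by blast
  ultimately have "good ((J \<inter> P) \<union> (J \<inter> Q))" by (rule good_union)
  moreover have "(J \<inter> P) \<union> (J \<inter> Q) = J" using J(1) unfolding Q_def by blast
  ultimately show ?thesis by simp
qed

theorem cofinal_paths_homogeneous: "homogeneous_order cofinal_paths lex"
proof -
  interpret L: linear_strict cofinal_paths lex by (rule lex_linear)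
  show ?thesis
  proof
    show "ord_iso lex cofinal_paths lex J" if "J \<subseteq> cofinal_paths" "open_convex lex J" for J
      using good_open_convex[OF that] by (rule ord_iso_sym)
  qed (fact cofinal_paths_nonempty lex_no_min lex_no_max lex_dense)+
qed

text \<open>The set is the cone at a one-point path, bounded by any path through a larger point; by
  \<open>cone_bounds_no_min\<close> none of its upper bounds is least.\<close>

lemma cofinal_paths_gap:
  obtains S u where "S \<subseteq> cofinal_paths" "S \<noteq> {}" "\<And>s. s \<in> S \<Longrightarrow> lex s u"
    "\<And>s. s \<in> cofinal_paths \<Longrightarrow> (\<And>x. x \<in> S \<Longrightarrow> \<not> lex s x) \<Longrightarrow> \<exists>t. lex t s \<and> (\<forall>x\<in>S. lex x t)"
proof -
  obtain x where x: "x \<in> X" using nonempty by blast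
  obtain z where z: "x \<sqsubset> z" using no_max[OF x] by blast
  have bp: "{w} \<in> bounded_paths" if "w \<in> X" for w
    using bounded_paths_insert[OF empty_path] that extensions_empty by blast
  have "z \<in> X" using z carrier by blast
  then obtain u where u: "u \<in> path_cone {z}"
    using path_cone_nonempty[OF bp] by blast
  show ?thesis
  proof (rule that[of "path_cone {x}" u])
    show "path_cone {x} \<subseteq> cofinal_paths" by (rule path_cone_subset)
    show "path_cone {x} \<noteq> {}" by (rule path_cone_nonempty[OF bp[OF x]])
    show "lex s u" if "s \<in> path_cone {x}" for s
      using lex_insert_cones[of "{}" x z s u] u that z x extensions_empty by simp
    show "\<exists>t. lex t s \<and> (\<forall>w\<in>path_cone {x}. lex w t)"
      if s: "s \<in> cofinal_paths" and ub: "\<And>w. w \<in> path_cone {x} \<Longrightarrow> \<not> lex s w" for s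
    proof (rule cone_bounds_no_min[OF bp[OF x] s])
      show "lex E s" if "E \<in> path_cone {x}" for E
      proof -
        have "s \<notin> path_cone {x}" using path_cone_no_max_min(1)[OF bp[OF x], of s] ub by blast
        then show ?thesis using lex_total[of E s] ub[OF that] that s path_cone_subset by blast
      qed
    qed
  qed
qed

end

section \<open>HLOTS as homogeneous orders\<close>

definition strict_of :: "'a rel \<Rightarrow> 'a \<Rightarrow> 'a \<Rightarrow> bool" where
  "strict_of r x y \<longleftrightarrow> (x, y) \<in> r \<and> x \<noteq> y"

lemma linear_strict_of:
  assumes "Linear_order r"
  shows "linear_strict (Field r) (strict_of r)"
proof -
  have r: "trans r" "antisym r" "total_on (Field r) r"
    using assms by (auto simp: order_on_defs)
  show ?thesis
  proof
    show "\<not> strict_of r x x" for x by (simp add: strict_of_def)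
    show "strict_of r x z" if "strict_of r x y" "strict_of r y z" for x y z
      using that r(1,2) unfolding strict_of_def by (meson antisymD transD)
    show "x \<in> Field r \<and> y \<in> Field r" if "strict_of r x y" for x y
      using that unfolding strict_of_def Field_def by blast
    show "strict_of r x y \<or> strict_of r y x" if "x \<in> Field r" "y \<in> Field r" "x \<noteq> y" for x y
      using that r(3) unfolding strict_of_def total_on_def by blast
  qed
qed

lemma Linear_order_refl: "Linear_order r \<Longrightarrow> x \<in> Field r \<Longrightarrow> (x, x) \<in> r"
  by (simp add: order_on_defs refl_on_def)

lemma rel_iff_strict: "Linear_order r \<Longrightarrow> x \<in> Field r \<Longrightarrow> (x, y) \<in> r \<longleftrightarrow> x = y \<or> strict_of r x y"
  using Linear_order_refl[of r x] unfolding strict_of_def by auto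

lemma rel_iff_not_strict:
  assumes "Linear_order r" "x \<in> Field r" "y \<in> Field r"
  shows "(x, y) \<in> r \<longleftrightarrow> \<not> strict_of r y x"
  using linear_strict.total[OF linear_strict_of[OF assms(1)] assms(2,3)]
    linear_strict.asym[OF linear_strict_of[OF assms(1)], of x y] rel_iff_strict[OF assms(1,2)] Linear_order_refl[OF assms(1,2)]
    linear_strict.irr[OF linear_strict_of[OF assms(1)]] by metis

lemma iso_iff_ord_iso:
  assumes "Linear_order r" "Linear_order s"
  shows "(\<exists>f. iso r s f) \<longleftrightarrow> ord_iso (strict_of r) (Field r) (strict_of s) (Field s)"
proof
  assume "\<exists>f. iso r s f"
  then obtain f where f: "bij_betw f (Field r) (Field s)"
    "\<forall>a\<in>Field r. \<forall>b\<in>Field r. (a, b) \<in> r \<longleftrightarrow> (f a, f b) \<in> s"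
    unfolding iso_iff2 by blast
  moreover have "a = b \<longleftrightarrow> f a = f b" if "a \<in> Field r" "b \<in> Field r" for a b
    using f(1) that unfolding bij_betw_def inj_on_def by blast
  ultimately show "ord_iso (strict_of r) (Field r) (strict_of s) (Field s)"
    unfolding ord_iso_def strict_of_def by blast
next
  assume "ord_iso (strict_of r) (Field r) (strict_of s) (Field s)"
  then obtain f where f: "bij_betw f (Field r) (Field s)"
    "\<And>a b. a \<in> Field r \<Longrightarrow> b \<in> Field r \<Longrightarrow> strict_of r a b \<longleftrightarrow> strict_of s (f a) (f b)"
    unfolding ord_iso_def by auto
  have fs: "f a \<in> Field s" if "a \<in> Field r" for a using f(1) that by (rule bij_betw_apply)
  have "(a, b) \<in> r \<longleftrightarrow> (f a, f b) \<in> s" if "a \<in> Field r" "b \<in> Field r" for a b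
    using rel_iff_not_strict[OF assms(1) that] rel_iff_not_strict[OF assms(2) fs fs, OF that] f(2)[OF that(2,1)]
    by blast
  then show "\<exists>f. iso r s f" using f(1) unfolding iso_iff2 by blast
qed

lemma Field_Restr_linear:
  assumes "Linear_order r" "J \<subseteq> Field r"
  shows "Field (Restr r J) = J" "Linear_order (Restr r J)"
proof -
  show F: "Field (Restr r J) = J"
    using assms Linear_order_refl[OF assms(1)] unfolding Field_def by blast
  show "Linear_order (Restr r J)"
    by (rule Linear_order_Restr[OF assms(1)])
qed

lemma ord_iso_Restr:
  assumes "Linear_order r" "Linear_order s" "J \<subseteq> Field s"
  shows "(\<exists>f. iso r (Restr s J) f) \<longleftrightarrow> ord_iso (strict_of r) (Field r) (strict_of s) J"
proof -
  have "ord_iso (strict_of r) (Field r) (strict_of (Restr s J)) J \<longleftrightarrow> ord_iso (strict_of r) (Field r) (strict_of s) J"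
    unfolding ord_iso_def strict_of_def bij_betw_def by (intro ex_cong1 conj_cong ball_cong refl) auto
  then show ?thesis
    using iso_iff_ord_iso[OF assms(1) Field_Restr_linear(2)[OF assms(2,3)]]
      Field_Restr_linear(1)[OF assms(2,3)] by simp
qed

lemma topspace_lots: "topspace (lots_topology r) = Field r"
  unfolding lots_topology_def topology_generated_by_topspace
  by (auto simp: underS_def aboveS_def Field_def)

lemma openin_underS: "y \<in> Field r \<Longrightarrow> openin (lots_topology r) {x. strict_of r x y}"
  and openin_aboveS: "x \<in> Field r \<Longrightarrow> openin (lots_topology r) {y. strict_of r x y}"
proof -
  have "{x. strict_of r x y} = underS r y" for y unfolding underS_def strict_of_def by blast
  then show "y \<in> Field r \<Longrightarrow> openin (lots_topology r) {x. strict_of r x y}"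
    unfolding lots_topology_def by (intro topology_generated_by_Basis) auto
  have "{y. strict_of r x y} = aboveS r x" for x unfolding aboveS_def strict_of_def by blast
  then show "x \<in> Field r \<Longrightarrow> openin (lots_topology r) {y. strict_of r x y}"
    unfolding lots_topology_def by (intro topology_generated_by_Basis) auto
qed

lemma openin_between:
  assumes "x \<in> Field r" "y \<in> Field r"
  shows "openin (lots_topology r) {z. strict_of r x z \<and> strict_of r z y}"
  using openin_Int[OF openin_aboveS[OF assms(1)] openin_underS[OF assms(2)]]
  by (simp add: Collect_conj_eq)

lemma open_convex_openin:
  assumes r: "Linear_order r" and J: "J \<subseteq> Field r" "open_convex (strict_of r) J"
  shows "openin (lots_topology r) J" "order_convex r J"
proof -
  have "openin (lots_topology r) (\<Union>x\<in>J. \<Union>y\<in>J. {z. strict_of r x z \<and> strict_of r z y})"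
    using J(1) by (intro openin_Union) (auto intro!: openin_Union openin_between)
  moreover have "(\<Union>x\<in>J. \<Union>y\<in>J. {z. strict_of r x z \<and> strict_of r z y}) = J"
    using J(2) unfolding open_convex_def by blast
  ultimately show "openin (lots_topology r) J" by simp
  show "order_convex r J"
    unfolding order_convex_def
  proof (intro conjI ballI allI impI)
    fix x y z assume xyz: "x \<in> J" "y \<in> J" "(x, z) \<in> r \<and> (z, y) \<in> r"
    then show "z \<in> J"
      using J(2) unfolding open_convex_def strict_of_def by metis
  qed (rule J(1))
qed

text \<open>Induction on the generation of the topology. Rays and the whole field confine a point on
  at most one side, so \<open>ends\<close> supplies the missing ends of the interval.\<close>

lemma openin_interval:
  assumes lt: "linear_strict (Field r) (strict_of r)"
    and ends: "\<forall>x\<in>Field r. (\<exists>y. strict_of r y x) \<and> (\<exists>y. strict_of r x y)"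
    and U: "openin (lots_topology r) U" "x \<in> U"
  shows "\<exists>a b. strict_of r a x \<and> strict_of r x b \<and> (\<forall>z. strict_of r a z \<and> strict_of r z b \<longrightarrow> z \<in> U)"
proof -
  interpret linear_strict "Field r" "strict_of r" by (rule lt)
  have "generate_topology_on (insert (Field r) (underS r ` Field r \<union> aboveS r ` Field r)) U"
    using U(1) unfolding lots_topology_def by (simp add: openin_topology_generated_by_iff)
  then show ?thesis
    using U(2)
  proof (induction arbitrary: x)
    case (Int A B)
    then obtain a b a' b' where *: "strict_of r a x" "strict_of r x b" "strict_of r a' x" "strict_of r x b'"
      and AB: "\<And>z. strict_of r a z \<Longrightarrow> strict_of r z b \<Longrightarrow> z \<in> A" "\<And>z. strict_of r a' z \<Longrightarrow> strict_of r z b' \<Longrightarrow> z \<in> B"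
      by (metis IntD1 IntD2)
    define c where "c = (if strict_of r a a' then a' else a)"
    define d where "d = (if strict_of r b b' then b else b')"
    have X: "a \<in> Field r" "a' \<in> Field r" "b \<in> Field r" "b' \<in> Field r" using * carrier by auto
    have c: "strict_of r c x" "\<And>z. strict_of r c z \<Longrightarrow> strict_of r a z \<and> strict_of r a' z"
      using * lt_trans[of a a'] lt_trans[of a' a] total[OF X(1,2)] unfolding c_def by (auto split: if_splits)
    have d: "strict_of r x d" "\<And>z. strict_of r z d \<Longrightarrow> strict_of r z b \<and> strict_of r z b'"
      using * lt_trans[of _ b b'] lt_trans[of _ b' b] total[OF X(3,4)] unfolding d_def by (auto split: if_splits)
    show ?case using c d AB by blast
  next
    case (UN K)
    then show ?case by (meson UnionE UnionI)
  next
    case (Basis s)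
    then have xF: "x \<in> Field r"
      by (auto simp: underS_def aboveS_def Field_def)
    obtain a b where ab: "strict_of r a x" "strict_of r x b" using ends xF by blast
    from Basis consider "s = Field r" | y where "y \<in> Field r" "s = underS r y" | y where "y \<in> Field r" "s = aboveS r y"
      by blast
    then show ?case
    proof cases
      case 1
      then show ?thesis using ab carrier by blast
    next
      case 2
      then have "strict_of r x y" "\<And>z. strict_of r z y \<Longrightarrow> z \<in> s"
        using Basis(2) unfolding underS_def strict_of_def by auto
      then show ?thesis using ab by blast
    next
      case 3
      then have "strict_of r y x" "\<And>z. strict_of r y z \<Longrightarrow> z \<in> s"
        using Basis(2) unfolding aboveS_def strict_of_def by auto
      then show ?thesis using ab by blast
    qed
  qed simp
qed

lemma openin_open_convex:
  assumes r: "Linear_order r"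
    and ends: "\<forall>x\<in>Field r. (\<exists>y. strict_of r y x) \<and> (\<exists>y. strict_of r x y)"
    and dense: "\<forall>x y. strict_of r x y \<longrightarrow> (\<exists>z. strict_of r x z \<and> strict_of r z y)"
    and J: "openin (lots_topology r) J" "order_convex r J" "J \<noteq> {}"
  shows "open_convex (strict_of r) J"
proof -
  interpret linear_strict "Field r" "strict_of r" by (rule linear_strict_of[OF r])
  show ?thesis
    unfolding open_convex_def
  proof (intro conjI ballI allI impI)
    show "z \<in> J" if "x \<in> J" "y \<in> J" "strict_of r x z \<and> strict_of r z y" for x y z
      using J(2) that unfolding order_convex_def strict_of_def by blast
    fix x assume "x \<in> J"
    obtain a b where ab: "strict_of r a x" "strict_of r x b"
      "\<And>z. strict_of r a z \<Longrightarrow> strict_of r z b \<Longrightarrow> z \<in> J"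
      using openin_interval[OF linear_strict_axioms ends J(1) \<open>x \<in> J\<close>] by blast
    obtain y where y: "strict_of r a y" "strict_of r y x" using dense ab(1) by blast
    obtain z where z: "strict_of r x z" "strict_of r z b" using dense ab(2) by blast
    from y z show "\<exists>y\<in>J. strict_of r y x" "\<exists>y\<in>J. strict_of r x y"
      using ab(3) lt_trans[OF y(2) ab(2)] lt_trans[OF ab(1) z(1)] by blast+
  qed (rule J(3))
qed

lemma ord_iso_max:
  assumes "ord_iso lt A lt' B" "a \<in> A" "\<forall>x\<in>A. \<not> lt a x"
  shows "\<exists>b\<in>B. \<forall>y\<in>B. \<not> lt' b y"
proof -
  obtain f where f: "bij_betw f A B" "\<And>x y. x \<in> A \<Longrightarrow> y \<in> A \<Longrightarrow> lt x y \<longleftrightarrow> lt' (f x) (f y)"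
    using assms(1) unfolding ord_iso_def by auto
  have "\<not> lt' (f a) y" if y: "y \<in> B" for y
  proof -
    obtain x where "x \<in> A" "y = f x" using bij_betw_imp_surj_on[OF f(1)] y by blast
    then show ?thesis using f(2) assms(2,3) by blast
  qed
  then show ?thesis using bij_betw_apply[OF f(1) assms(2)] by blast
qed

text \<open>If there were a maximum, then rays \<open>(-\<infinity>, y)\<close>, being copies of the whole order, would give every
  point but a minimum an immediate predecessor, which in turn produces isolated points.\<close>

lemma (in linear_strict) homogeneous_no_max:
  assumes low: "\<And>y. y \<in> X \<Longrightarrow> {x. x \<sqsubset> y} \<noteq> {} \<Longrightarrow> ord_iso lt X lt {x. x \<sqsubset> y}"
    and up: "\<And>y. y \<in> X \<Longrightarrow> {x. y \<sqsubset> x} \<noteq> {} \<Longrightarrow> ord_iso lt X lt {x. y \<sqsubset> x}"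
    and mid: "\<And>x y. x \<in> X \<Longrightarrow> y \<in> X \<Longrightarrow> {z. x \<sqsubset> z \<and> z \<sqsubset> y} \<noteq> {} \<Longrightarrow> ord_iso lt X lt {z. x \<sqsubset> z \<and> z \<sqsubset> y}"
    and three: "a \<in> X" "b \<in> X" "c \<in> X" "a \<noteq> b" "a \<noteq> c" "b \<noteq> c"
    and M: "M \<in> X"
  shows "\<exists>y. M \<sqsubset> y"
proof (rule ccontr)
  assume "\<not> (\<exists>y. M \<sqsubset> y)"
  then have max: "\<forall>x\<in>X. \<not> M \<sqsubset> x" by blast
  obtain p q s where pqs: "p \<sqsubset> q" "q \<sqsubset> s"
    using three total lt_trans by metis
  have X: "p \<in> X" "q \<in> X" "s \<in> X" using pqs carrier by auto
  have "{x. x \<sqsubset> q} \<noteq> {}" using pqs by blast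
  then obtain q' where q': "q' \<sqsubset> q" "\<And>y. y \<sqsubset> q \<Longrightarrow> \<not> q' \<sqsubset> y"
    using ord_iso_max[OF low[OF X(2)] M max] by blast
  have q'X: "q' \<in> X" using q' carrier by blast
  \<comment> \<open>Now \<open>q\<close> is the minimum of the ray above \<open>q'\<close>, which is
    a copy of \<open>X\<close>. So \<open>X\<close> has a minimum, and the ray above
    \<open>q\<close>, again a copy, gives \<open>q\<close> an immediate successor.\<close>
  have "q \<in> {x. q' \<sqsubset> x}" "\<forall>x\<in>{x. q' \<sqsubset> x}. \<not> x \<sqsubset> q" using q' by auto
  moreover have "ord_iso (\<lambda>x y. y \<sqsubset> x) {x. q' \<sqsubset> x} (\<lambda>x y. y \<sqsubset> x) X"
    unfolding ord_iso_dual[of lt _ lt] using up[OF q'X] q'(1) by (blast intro: ord_iso_sym)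
  ultimately obtain m where m: "m \<in> X" "\<forall>x\<in>X. \<not> x \<sqsubset> m"
    using ord_iso_max[of "\<lambda>x y. y \<sqsubset> x" "{x. q' \<sqsubset> x}" "\<lambda>x y. y \<sqsubset> x" X q] by blast
  have "ord_iso (\<lambda>x y. y \<sqsubset> x) X (\<lambda>x y. y \<sqsubset> x) {x. q \<sqsubset> x}"
    unfolding ord_iso_dual[of lt _ lt] using up[OF X(2)] pqs(2) by blast
  then obtain q'' where q'': "q \<sqsubset> q''" "\<And>y. q \<sqsubset> y \<Longrightarrow> \<not> y \<sqsubset> q''"
    using ord_iso_max[of "\<lambda>x y. y \<sqsubset> x" X "\<lambda>x y. y \<sqsubset> x" "{x. q \<sqsubset> x}" m] m by blast
  have eq: "{z. q' \<sqsubset> z \<and> z \<sqsubset> q''} = {q}"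
  proof
    show "{z. q' \<sqsubset> z \<and> z \<sqsubset> q''} \<subseteq> {q}" using q' q'' total carrier by blast
  qed (use q' q'' in blast)
  have "q'' \<in> X" using q''(1) carrier by blast
  then have "ord_iso lt X lt {z. q' \<sqsubset> z \<and> z \<sqsubset> q''}"
    using mid[OF q'X] eq by blast
  then obtain f where f: "bij_betw f X {q}" unfolding eq ord_iso_def by auto
  have "f a = f b" using bij_betw_apply[OF f three(1)] bij_betw_apply[OF f three(2)] by simp
  then show False using bij_betw_imp_inj_on[OF f] three(1,2,4) by (meson inj_onD)
qed

lemma hlots_imp_homogeneous:
  assumes "hlots r"
  shows "homogeneous_order (Field r) (strict_of r)"
proof -
  have r: "Linear_order r" using assms unfolding hlots_def by blast
  interpret linear_strict "Field r" "strict_of r" by (rule linear_strict_of[OF r])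
  obtain a b c where three: "a \<in> Field r" "b \<in> Field r" "c \<in> Field r" "a \<noteq> b" "a \<noteq> c" "b \<noteq> c"
    using assms unfolding hlots_def by blast
  have hom: "ord_iso (strict_of r) (Field r) (strict_of r) J"
    if "J \<noteq> {}" "openin (lots_topology r) J" "order_convex r J" for J
    using assms that ord_iso_Restr[OF r r] unfolding hlots_def order_convex_def by blast
  have convexI: "order_convex r J"
    if "J \<subseteq> Field r" "\<And>x y z. x \<in> J \<Longrightarrow> y \<in> J \<Longrightarrow> strict_of r x z \<Longrightarrow> strict_of r z y \<Longrightarrow> z \<in> J" for J
    unfolding order_convex_def
  proof (intro conjI ballI allI impI)
    fix x y z assume "x \<in> J" "y \<in> J" "(x, z) \<in> r \<and> (z, y) \<in> r"
    then show "z \<in> J" using that(2)[of x y z] unfolding strict_of_def by blast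
  qed (rule that(1))
  have low: "ord_iso (strict_of r) (Field r) (strict_of r) {x. strict_of r x y}"
    if "y \<in> Field r" "{x. strict_of r x y} \<noteq> {}" for y
    by (rule hom[OF that(2) openin_underS[OF that(1)] convexI]) (use lt_trans carrier in blast)+
  have up: "ord_iso (strict_of r) (Field r) (strict_of r) {x. strict_of r y x}"
    if "y \<in> Field r" "{x. strict_of r y x} \<noteq> {}" for y
    by (rule hom[OF that(2) openin_aboveS[OF that(1)] convexI]) (use lt_trans carrier in blast)+
  have mid: "ord_iso (strict_of r) (Field r) (strict_of r) {z. strict_of r x z \<and> strict_of r z y}"
    if "x \<in> Field r" "y \<in> Field r" "{z. strict_of r x z \<and> strict_of r z y} \<noteq> {}" for x y
    by (rule hom[OF that(3) openin_between[OF that(1,2)] convexI]) (use lt_trans carrier in blast)+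
  have no_max: "\<exists>y. strict_of r x y" if "x \<in> Field r" for x
    by (rule homogeneous_no_max[OF low up mid three that])
  have no_min: "\<exists>y. strict_of r y x" if "x \<in> Field r" for x
  proof -
    interpret dual: linear_strict "Field r" "\<lambda>x y. strict_of r y x"
      by unfold_locales (use irr lt_trans carrier total in blast)+
    show ?thesis
    proof (rule dual.homogeneous_no_max[OF _ _ _ three that])
      show "ord_iso (\<lambda>x y. strict_of r y x) (Field r) (\<lambda>x y. strict_of r y x) {x. strict_of r y x}"
        if "y \<in> Field r" "{x. strict_of r y x} \<noteq> {}" for y
        unfolding ord_iso_dual[of "strict_of r" _ "strict_of r"] using up that .
      show "ord_iso (\<lambda>x y. strict_of r y x) (Field r) (\<lambda>x y. strict_of r y x) {x. strict_of r x y}"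
        if "y \<in> Field r" "{x. strict_of r x y} \<noteq> {}" for y
        unfolding ord_iso_dual[of "strict_of r" _ "strict_of r"] using low that .
      show "ord_iso (\<lambda>x y. strict_of r y x) (Field r) (\<lambda>x y. strict_of r y x) {z. strict_of r z x \<and> strict_of r y z}"
        if "x \<in> Field r" "y \<in> Field r" "{z. strict_of r z x \<and> strict_of r y z} \<noteq> {}" for x y
        unfolding ord_iso_dual[of "strict_of r" _ "strict_of r"] using mid[of y x] that by (simp add: conj_commute)
    qed
  qed
  \<comment> \<open>If nothing lay between, \<open>x\<close> would be the maximum of the ray below
    \<open>y\<close>, which is a copy of an order without maximum.\<close>
  have dense: "\<exists>z. strict_of r x z \<and> strict_of r z y" if xy: "strict_of r x y" for x y
  proof (rule ccontr)
    assume no: "\<not> (\<exists>z. strict_of r x z \<and> strict_of r z y)"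
    have X: "x \<in> Field r" "y \<in> Field r" using xy carrier by auto
    have "ord_iso (strict_of r) {x. strict_of r x y} (strict_of r) (Field r)"
      using low[OF X(2)] xy by (blast intro: ord_iso_sym)
    moreover have "x \<in> {x. strict_of r x y}" "\<forall>z\<in>{x. strict_of r x y}. \<not> strict_of r x z"
      using xy no by auto
    ultimately obtain M where M: "M \<in> Field r" "\<forall>z\<in>Field r. \<not> strict_of r M z"
      using ord_iso_max[of "strict_of r" "{x. strict_of r x y}" "strict_of r" "Field r" x] by blast
    then show False using no_max[OF M(1)] carrier by blast
  qed
  show ?thesis
  proof
    show "Field r \<noteq> {}" using three by blast
    show "ord_iso (strict_of r) (Field r) (strict_of r) J"
      if "J \<subseteq> Field r" "open_convex (strict_of r) J" for J
      using hom open_convex_openin[OF r that] that(2) unfolding open_convex_def by blast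
  qed (fact no_min no_max dense)+
qed

lemma homogeneous_imp_hlots:
  assumes r: "Linear_order r" and hom: "homogeneous_order (Field r) (strict_of r)"
  shows "hlots r"
proof -
  interpret homogeneous_order "Field r" "strict_of r" by (rule hom)
  obtain a b c where "strict_of r a b" "strict_of r b c"
    using nonempty no_max carrier by blast
  then have "a \<in> Field r" "b \<in> Field r" "c \<in> Field r" "a \<noteq> b" "a \<noteq> c" "b \<noteq> c"
    using carrier irr asym by blast+
  moreover have "\<exists>f. iso r (Restr r J) f"
    if "J \<noteq> {}" "openin (lots_topology r) J" "order_convex r J" for J
  proof -
    have "J \<subseteq> Field r" using that(3) unfolding order_convex_def by blast
    then show ?thesis
      unfolding ord_iso_Restr[OF r r \<open>J \<subseteq> Field r\<close>]
      using homogeneous[OF \<open>J \<subseteq> Field r\<close> openin_open_convex[OF r _ _ that(2,3,1)]] no_min no_max dense by blast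
  qed
  ultimately show ?thesis unfolding hlots_def using r by blast
qed

lemma hlots_iff: "hlots r \<longleftrightarrow> Linear_order r \<and> homogeneous_order (Field r) (strict_of r)"
  by (metis hlots_def hlots_imp_homogeneous homogeneous_imp_hlots)

section \<open>Completions\<close>

text \<open>The lower halves of Dedekind cuts. Demanding that there be no maximum gives each cut one
  representative, so a point appears as the open ray below it (\<open>ray_cut\<close>); leaving out
  the empty set and \<open>X\<close> avoids new endpoints.\<close>

definition cuts :: "'a set \<Rightarrow> ('a \<Rightarrow> 'a \<Rightarrow> bool) \<Rightarrow> 'a set set" where
  "cuts X lt = {C. C \<subseteq> X \<and> C \<noteq> {} \<and> C \<noteq> X \<and>
     (\<forall>x\<in>C. \<forall>y\<in>X. lt y x \<longrightarrow> y \<in> C) \<and> (\<forall>x\<in>C. \<exists>y\<in>C. lt x y)}"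

definition cut_rel :: "'a set \<Rightarrow> ('a \<Rightarrow> 'a \<Rightarrow> bool) \<Rightarrow> 'a set rel" where
  "cut_rel X lt = {(C, D). C \<in> cuts X lt \<and> D \<in> cuts X lt \<and> C \<subseteq> D}"

lemma cutsD:
  assumes "C \<in> cuts X lt"
  shows "C \<subseteq> X" "C \<noteq> {}" "C \<noteq> X" "\<And>x y. x \<in> C \<Longrightarrow> y \<in> X \<Longrightarrow> lt y x \<Longrightarrow> y \<in> C"
    "\<And>x. x \<in> C \<Longrightarrow> \<exists>y\<in>C. lt x y"
  using assms unfolding cuts_def mem_Collect_eq by metis+

lemma cuts_image:
  assumes f: "bij_betw f A B" "\<forall>x\<in>A. \<forall>y\<in>A. lt x y \<longleftrightarrow> lt' (f x) (f y)" and C: "C \<in> cuts A lt"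
  shows "f ` C \<in> cuts B lt'"
proof -
  note CA = cutsD(1-3)[OF C] and low = cutsD(4)[OF C] and up = cutsD(5)[OF C]
  have fA: "f ` A = B" and inj: "inj_on f A" using f(1) unfolding bij_betw_def by auto
  have "f ` C \<subseteq> B" "f ` C \<noteq> {}" using CA fA by auto
  moreover have "f ` C \<noteq> B"
    using CA fA inj by (metis inj_on_image_eq_iff order_refl)
  moreover have "y \<in> f ` C" if xy: "x \<in> f ` C" "y \<in> B" "lt' y x" for x y
  proof -
    obtain c a where ca: "c \<in> C" "x = f c" "a \<in> A" "y = f a" using xy(1,2) fA by blast
    then have "lt a c" using f(2) xy(3) CA(1) by blast
    then show ?thesis using low[OF ca(1,3)] ca(4) by blast
  qed
  moreover have "\<exists>y\<in>f ` C. lt' x y" if x: "x \<in> f ` C" for x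
  proof -
    obtain c where c: "c \<in> C" "x = f c" using x by blast
    then obtain d where d: "d \<in> C" "lt c d" using up by blast
    then have "lt' (f c) (f d)" using f(2) c(1) CA(1) by blast
    then show ?thesis using c d by blast
  qed
  ultimately show ?thesis unfolding cuts_def by blast
qed

lemma ord_iso_cuts_transfer:
  assumes "ord_iso lt A lt' B"
  shows "ord_iso (\<subset>) (cuts A lt) (\<subset>) (cuts B lt')"
proof -
  obtain f where f: "bij_betw f A B" "\<forall>x\<in>A. \<forall>y\<in>A. lt x y \<longleftrightarrow> lt' (f x) (f y)"
    using assms unfolding ord_iso_def by auto
  have inj: "inj_on f A" and fA: "f ` A = B" using f(1) unfolding bij_betw_def by auto
  have sub: "C \<subseteq> A" if "C \<in> cuts A lt" for C using that unfolding cuts_def by auto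
  define g where "g = inv_into A f"
  have g: "bij_betw g B A" unfolding g_def by (rule bij_betw_inv_into[OF f(1)])
  have fg: "f (g y) = y" "g y \<in> A" if "y \<in> B" for y
    using that fA unfolding g_def by (auto simp: f_inv_into_f inv_into_into)
  have g_lt: "\<forall>x\<in>B. \<forall>y\<in>B. lt' x y \<longleftrightarrow> lt (g x) (g y)"
    using f(2) fg by metis
  have eq: "f ` (g ` D) = D" if "D \<subseteq> B" for D
    using that fg(1) by force
  have bij: "bij_betw (image f) (cuts A lt) (cuts B lt')"
    unfolding bij_betw_def
  proof
    show "inj_on (image f) (cuts A lt)"
      using inj_on_image_eq_iff[OF inj] sub unfolding inj_on_def by blast
    show "image f ` cuts A lt = cuts B lt'"
    proof
      show "image f ` cuts A lt \<subseteq> cuts B lt'" using cuts_image[OF f] by blast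
      show "cuts B lt' \<subseteq> image f ` cuts A lt"
      proof
        fix D assume D: "D \<in> cuts B lt'"
        then have "D \<subseteq> B" unfolding cuts_def by auto
        then have "D = f ` (g ` D)" using eq by simp
        moreover have "g ` D \<in> cuts A lt" by (rule cuts_image[OF g g_lt D])
        ultimately show "D \<in> image f ` cuts A lt" by (rule image_eqI)
      qed
    qed
  qed
  have "C \<subset> D \<longleftrightarrow> f ` C \<subset> f ` D" if "C \<in> cuts A lt" "D \<in> cuts A lt" for C D
    using inj_on_image_eq_iff[OF inj] inj_on_image_subset_iff[OF inj] sub[OF that(1)] sub[OF that(2)]
    by (simp add: psubset_eq)
  then show ?thesis unfolding ord_iso_def by (intro exI[of _ "image f"] conjI ballI bij)
qed

text \<open>A complete order \<open>A\<close> in which \<open>X\<close> is densely embedded is recovered from \<open>X\<close> as its order of cuts.\<close>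

lemma ord_iso_cuts:
  assumes lin: "linear_strict Z lts" and A: "A \<subseteq> Z" "e ` X \<subseteq> A"
    and e: "\<forall>x\<in>X. \<forall>y\<in>X. lt x y \<longleftrightarrow> lts (e x) (e y)"
    and dense: "\<forall>a\<in>A. \<forall>b\<in>A. lts a b \<longrightarrow> (\<exists>x\<in>X. lts a (e x) \<and> lts (e x) b)"
    and ends: "\<forall>a\<in>A. (\<exists>b\<in>A. lts b a) \<and> (\<exists>b\<in>A. lts a b)"
    and sup: "\<forall>T\<subseteq>A. T \<noteq> {} \<and> (\<exists>u\<in>A. \<forall>t\<in>T. \<not> lts u t) \<longrightarrow>
      (\<exists>s\<in>A. (\<forall>t\<in>T. \<not> lts s t) \<and> (\<forall>v\<in>A. (\<forall>t\<in>T. \<not> lts v t) \<longrightarrow> \<not> lts v s))"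
  shows "ord_iso lts A (\<subset>) (cuts X lt)"
proof -
  interpret linear_strict Z lts by (rule lin)
  define f where "f a = {x\<in>X. lts (e x) a}" for a
  have eA: "e x \<in> A" "e x \<in> Z" if "x \<in> X" for x using that A by auto
  have cut: "f a \<in> cuts X lt" if a: "a \<in> A" for a
  proof -
    obtain b c where bc: "b \<in> A" "lts b a" "c \<in> A" "lts a c" using ends a by blast
    obtain x where x: "x \<in> X" "lts (e x) a" using dense bc(1,2) a by blast
    obtain y where y: "y \<in> X" "lts a (e y)" using dense bc(3,4) a by blast
    have "y \<notin> f a" using y(2) asym unfolding f_def by blast
    moreover have "z \<in> f a" if "w \<in> f a" "z \<in> X" "lt z w" for w z
    proof -
      have w: "w \<in> X" "lts (e w) a" using that(1) unfolding f_def by auto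
      then have "lts (e z) (e w)" using e that(2,3) by blast
      then show ?thesis using lt_trans w(2) that(2) unfolding f_def by blast
    qed
    moreover have "\<exists>z\<in>f a. lt w z" if w: "w \<in> f a" for w
    proof -
      have w: "w \<in> X" "lts (e w) a" using w unfolding f_def by auto
      obtain z where z: "z \<in> X" "lts (e w) (e z)" "lts (e z) a" using dense eA(1)[OF w(1)] a w(2) by blast
      then show ?thesis using e w(1) unfolding f_def by blast
    qed
    ultimately show ?thesis using x y(1) unfolding cuts_def f_def by blast
  qed
  have mono: "f a \<subset> f b" if ab: "a \<in> A" "b \<in> A" "lts a b" for a b
  proof -
    obtain x where x: "x \<in> X" "lts a (e x)" "lts (e x) b" using dense ab by blast
    have "f a \<subseteq> f b" using lt_trans ab(3) unfolding f_def by blast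
    moreover have "x \<in> f b" "x \<notin> f a" using x asym unfolding f_def by auto
    ultimately show ?thesis by blast
  qed
  have tot: "a = b \<or> lts a b \<or> lts b a" if "a \<in> A" "b \<in> A" for a b
    using total that A(1) by blast
  have iff: "lts a b \<longleftrightarrow> f a \<subset> f b" if "a \<in> A" "b \<in> A" for a b
    using mono[OF that] mono[OF that(2,1)] tot[OF that] by blast
  have "inj_on f A"
    unfolding inj_on_def using tot mono by blast
  moreover have "f ` A = cuts X lt"
  proof
    show "f ` A \<subseteq> cuts X lt" using cut by blast
    show "cuts X lt \<subseteq> f ` A"
    proof
      fix C assume cut: "C \<in> cuts X lt"
      note C = cutsD(1-3)[OF cut] and low = cutsD(4)[OF cut] and up = cutsD(5)[OF cut]
      have ub: "\<forall>t\<in>e ` C. \<not> lts (e d) t" if d: "d \<in> X" "d \<notin> C" for d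
      proof
        fix t assume "t \<in> e ` C"
        then obtain c where c: "c \<in> C" "t = e c" by blast
        then show "\<not> lts (e d) t" using low[OF c(1) d(1)] d e C(1) by blast
      qed
      obtain d where d: "d \<in> X" "d \<notin> C" using C by blast
      have T: "e ` C \<subseteq> A" "e ` C \<noteq> {}" "\<exists>u\<in>A. \<forall>t\<in>e ` C. \<not> lts u t"
        using ub[OF d] eA(1)[OF d(1)] C A by blast+
      obtain s where s: "s \<in> A" "\<forall>t\<in>e ` C. \<not> lts s t"
        "\<forall>v\<in>A. (\<forall>t\<in>e ` C. \<not> lts v t) \<longrightarrow> \<not> lts v s"
        using sup T by metis
      have "f s = C"
      proof
        show "f s \<subseteq> C"
        proof
          fix x assume "x \<in> f s"
          then have x: "x \<in> X" "lts (e x) s" unfolding f_def by auto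
          show "x \<in> C"
          proof (rule ccontr)
            assume "x \<notin> C"
            then have "\<not> lts (e x) s" using s(3) ub[OF x(1)] eA(1)[OF x(1)] by blast
            then show False using x(2) by blast
          qed
        qed
        show "C \<subseteq> f s"
        proof
          fix x assume x: "x \<in> C"
          \<comment> \<open>Because \<open>C\<close> has no maximum, its points are mapped strictly
            below the supremum \<open>s\<close>, even when \<open>s\<close> itself is in the image
            of \<open>e\<close>.\<close>
          obtain y where y: "y \<in> C" "lt x y" using up[OF x] by blast
          have "lts (e x) (e y)" using e x y C(1) by blast
          moreover have "\<not> lts s (e y)" using s(2) y(1) by blast
          ultimately have "lts (e x) s" using less_not_trans s(1) A(1) by blast
          then show "x \<in> f s" using x C(1) unfolding f_def by blast
        qed
      qed
      then show "C \<in> f ` A" using s(1) by (metis imageI)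
    qed
  qed
  ultimately show ?thesis
    unfolding ord_iso_def bij_betw_def using iff by (intro exI[of _ f] conjI ballI)
qed

text \<open>\<open>complete_order\<close> speaks of sets bounded on both sides. Dropping from
  \<open>T\<close> the points below some \<open>t0\<close> of \<open>T\<close> bounds it below and
  leaves its upper bounds unchanged.\<close>

lemma complete_sup:
  assumes s: "Linear_order s" "complete_order s"
    and T: "T \<subseteq> Field s" "T \<noteq> {}" and u: "u \<in> Field s" "\<forall>t\<in>T. \<not> strict_of s u t"
  shows "\<exists>z\<in>Field s. (\<forall>t\<in>T. \<not> strict_of s z t) \<and>
    (\<forall>v\<in>Field s. (\<forall>t\<in>T. \<not> strict_of s v t) \<longrightarrow> \<not> strict_of s v z)"
proof -
  interpret linear_strict "Field s" "strict_of s" by (rule linear_strict_of[OF s(1)])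
  obtain t0 where t0: "t0 \<in> T" using T(2) by blast
  define T' where "T' = {t\<in>T. \<not> strict_of s t t0}"
  have T'F: "T' \<subseteq> Field s" using T(1) unfolding T'_def by blast
  have t0T': "t0 \<in> T'" using t0 irr unfolding T'_def by blast
  have above: "v \<in> Above s T' \<longleftrightarrow> v \<in> Field s \<and> (\<forall>t\<in>T'. \<not> strict_of s v t)" for v
    unfolding Above_def using rel_iff_not_strict[OF s(1)] T'F by blast
  have "u \<in> Above s T'" using above u unfolding T'_def by blast
  moreover have "t0 \<in> Under s T'"
    unfolding Under_def using rel_iff_not_strict[OF s(1)] t0 T T'F unfolding T'_def by blast
  ultimately obtain z where "is_supremum s T' z"
    using s(2) T'F t0T' unfolding complete_order_def by blast
  then have z: "z \<in> Above s T'" "\<forall>v\<in>Above s T'. (z, v) \<in> s" unfolding is_supremum_def by auto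
  have zF: "z \<in> Field s" using z(1) above by blast
  have "\<not> strict_of s z t" if t: "t \<in> T" for t
  proof (cases "strict_of s t t0")
    case True
    then show ?thesis using z(1) above t0T' lt_trans by blast
  next
    case False
    then show ?thesis using z(1) above t unfolding T'_def by blast
  qed
  moreover have "\<not> strict_of s v z" if "v \<in> Field s" "\<forall>t\<in>T. \<not> strict_of s v t" for v
  proof -
    have "v \<in> Above s T'" using above that unfolding T'_def by blast
    then show ?thesis using z(2) rel_iff_not_strict[OF s(1) zF that(1)] by blast
  qed
  ultimately show ?thesis using zF by blast
qed

text \<open>An infimum is obtained as the supremum of the lower bounds.\<close>

lemma complete_orderI:
  assumes "\<And>T. T \<subseteq> Field s \<Longrightarrow> T \<noteq> {} \<Longrightarrow> Above s T \<noteq> {} \<Longrightarrow> \<exists>z. is_supremum s T z"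
  shows "complete_order s"
  unfolding complete_order_def
proof (intro allI impI conjI; elim conjE)
  fix T assume T: "T \<subseteq> Field s" "T \<noteq> {}" "Above s T \<noteq> {}" "Under s T \<noteq> {}"
  show "\<exists>z. is_supremum s T z" using assms T by blast
  have "T \<subseteq> Above s (Under s T)" using T(1) unfolding Above_def Under_def by blast
  then have ne: "Above s (Under s T) \<noteq> {}" using T(2) by blast
  have "Under s T \<subseteq> Field s" unfolding Under_def by blast
  then obtain z where z: "z \<in> Above s (Under s T)" "\<forall>u\<in>Above s (Under s T). (z, u) \<in> s"
    using assms[OF _ T(4) ne] unfolding is_supremum_def by blast
  then have "is_infimum s T z"
    using \<open>T \<subseteq> Above s (Under s T)\<close> unfolding is_infimum_def Under_def Above_def by blast
  then show "\<exists>z. is_infimum s T z" by blast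
qed

lemma homogeneous_no_ends:
  assumes "Linear_order r" "homogeneous_order (Field r) (strict_of r)"
  shows "\<not> has_max r" "\<not> has_min r"
proof -
  interpret homogeneous_order "Field r" "strict_of r" by (rule assms(2))
  show "\<not> has_max r"
    unfolding has_max_def using no_max carrier rel_iff_not_strict[OF assms(1)] by blast
  show "\<not> has_min r"
    unfolding has_min_def using no_min carrier rel_iff_not_strict[OF assms(1)] by blast
qed

lemma completion_chlots:
  assumes r: "hlots r" and s: "is_completion r s"
  shows "chlots s"
proof -
  have hom: "homogeneous_order (Field r) (strict_of r)" and lin_r: "Linear_order r"
    using r hlots_iff by auto
  interpret R: homogeneous_order "Field r" "strict_of r" by (rule hom)
  have lin: "Linear_order s" and complete: "complete_order s" and order_dense: "order_dense s"
    using s unfolding is_completion_def by auto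
  interpret linear_strict "Field s" "strict_of s" by (rule linear_strict_of[OF lin])
  obtain e where e: "e ` Field r \<subseteq> Field s" "\<forall>x\<in>Field r. \<forall>y\<in>Field r. (x, y) \<in> r \<longleftrightarrow> (e x, e y) \<in> s"
    and closure: "lots_topology s closure_of (e ` Field r) = Field s"
    using s unfolding is_completion_def by blast
  have "\<not> has_max s" "\<not> has_min s"
    using s homogeneous_no_ends[OF lin_r hom] unfolding is_completion_def by auto
  then have ends: "\<forall>a\<in>Field s. (\<exists>b\<in>Field s. strict_of s b a) \<and> (\<exists>b\<in>Field s. strict_of s a b)"
    unfolding has_max_def has_min_def using rel_iff_not_strict[OF lin] by blast
  have e_lt: "\<forall>x\<in>Field r. \<forall>y\<in>Field r. strict_of r x y \<longleftrightarrow> strict_of s (e x) (e y)"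
  proof (intro ballI)
    fix x y assume xy: "x \<in> Field r" "y \<in> Field r"
    then have "e x \<in> Field s" "e y \<in> Field s" using e(1) by auto
    then show "strict_of r x y \<longleftrightarrow> strict_of s (e x) (e y)"
      using e(2) xy rel_iff_not_strict[OF lin_r xy(2,1)] rel_iff_not_strict[OF lin, of "e y" "e x"] by blast
  qed
  have dense_s: "\<exists>z. strict_of s a z \<and> strict_of s z b" if "strict_of s a b" for a b
    using order_dense that unfolding order_dense_def strict_of_def by metis
  \<comment> \<open>Topological density becomes order density: by \<open>order_dense\<close> there
    is a point between \<open>a\<close> and \<open>b\<close>, so the open interval is a
    neighbourhood of it and meets the image of \<open>r\<close>.\<close>
  have dense: "\<forall>a\<in>Field s. \<forall>b\<in>Field s. strict_of s a b \<longrightarrow>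
    (\<exists>x\<in>Field r. strict_of s a (e x) \<and> strict_of s (e x) b)"
  proof (intro ballI impI)
    fix a b assume ab: "a \<in> Field s" "b \<in> Field s" "strict_of s a b"
    then obtain z where z: "strict_of s a z" "strict_of s z b" using dense_s by blast
    then have "z \<in> lots_topology s closure_of (e ` Field r)" using closure carrier by blast
    then have "\<forall>T. z \<in> T \<and> openin (lots_topology s) T \<longrightarrow> (\<exists>y\<in>e ` Field r. y \<in> T)"
      unfolding in_closure_of by blast
    moreover have "z \<in> {z. strict_of s a z \<and> strict_of s z b}" using z by simp
    ultimately have "\<exists>y\<in>e ` Field r. y \<in> {z. strict_of s a z \<and> strict_of s z b}"
      using openin_between[OF ab(1,2)] by metis
    then show "\<exists>x\<in>Field r. strict_of s a (e x) \<and> strict_of s (e x) b" by blast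
  qed
  \<comment> \<open>Used for the whole field and for an open convex \<open>J\<close>; in both cases
    the order is recovered from the points of \<open>r\<close> that it contains.\<close>
  have iso: "ord_iso (strict_of s) J (\<subset>) (cuts {x\<in>Field r. e x \<in> J} (strict_of r))"
    if J: "J \<subseteq> Field s" "\<forall>x\<in>J. \<forall>y\<in>J. \<forall>z. strict_of s x z \<and> strict_of s z y \<longrightarrow> z \<in> J"
      "\<forall>a\<in>J. (\<exists>b\<in>J. strict_of s b a) \<and> (\<exists>b\<in>J. strict_of s a b)" for J
  proof (rule ord_iso_cuts[OF linear_strict_axioms J(1), of e])
    show "\<forall>x\<in>{x\<in>Field r. e x \<in> J}. \<forall>y\<in>{x\<in>Field r. e x \<in> J}. strict_of r x y \<longleftrightarrow> strict_of s (e x) (e y)"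
      using e_lt by blast
    show "\<forall>a\<in>J. \<forall>b\<in>J. strict_of s a b \<longrightarrow>
        (\<exists>x\<in>{x\<in>Field r. e x \<in> J}. strict_of s a (e x) \<and> strict_of s (e x) b)"
      using dense J(1,2) by blast
    show "\<forall>T\<subseteq>J. T \<noteq> {} \<and> (\<exists>u\<in>J. \<forall>t\<in>T. \<not> strict_of s u t) \<longrightarrow>
      (\<exists>z\<in>J. (\<forall>t\<in>T. \<not> strict_of s z t) \<and> (\<forall>v\<in>J. (\<forall>t\<in>T. \<not> strict_of s v t) \<longrightarrow> \<not> strict_of s v z))"
    proof (intro allI impI, elim conjE bexE)
      fix T u assume T: "T \<subseteq> J" "T \<noteq> {}" and u: "u \<in> J" "\<forall>t\<in>T. \<not> strict_of s u t"
      obtain z where z: "z \<in> Field s" "\<forall>t\<in>T. \<not> strict_of s z t"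
        "\<forall>v\<in>Field s. (\<forall>t\<in>T. \<not> strict_of s v t) \<longrightarrow> \<not> strict_of s v z"
        using complete_sup[OF lin complete _ T(2) _ u(2)] T(1) u(1) J(1) by blast
      \<comment> \<open>The supremum taken in \<open>s\<close> is squeezed between a point of
        \<open>T\<close> and a bound in \<open>J\<close>, so convexity keeps it in
        \<open>J\<close>.\<close>
      obtain t where t: "t \<in> T" using T(2) by blast
      have "\<not> strict_of s z t" "\<not> strict_of s u z" using z t u J(1) by auto
      then have "z = t \<or> z = u \<or> strict_of s t z \<and> strict_of s z u"
        using total[of z t] total[of z u] z(1) t T(1) u(1) J(1) by blast
      then have "z \<in> J" using J(2) t T(1) u(1) by blast
      then show "\<exists>z\<in>J. (\<forall>t\<in>T. \<not> strict_of s z t) \<and> (\<forall>v\<in>J. (\<forall>t\<in>T. \<not> strict_of s v t) \<longrightarrow> \<not> strict_of s v z)"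
        using z J(1) by blast
    qed
  qed (use J(3) in auto)
  have "homogeneous_order (Field s) (strict_of s)"
  proof
    show "Field s \<noteq> {}" using e(1) R.nonempty by blast
    show "\<exists>y. strict_of s y x" "\<exists>y. strict_of s x y" if "x \<in> Field s" for x
      using ends that by blast+
    show "ord_iso (strict_of s) (Field s) (strict_of s) J" if J: "J \<subseteq> Field s" "open_convex (strict_of s) J" for J
    proof -
      define J0 where "J0 = {x\<in>Field r. e x \<in> J}"
      have conv: "\<forall>x\<in>J. \<forall>y\<in>J. \<forall>z. strict_of s x z \<and> strict_of s z y \<longrightarrow> z \<in> J"
        and J_ends: "\<forall>a\<in>J. (\<exists>b\<in>J. strict_of s b a) \<and> (\<exists>b\<in>J. strict_of s a b)" and J_ne: "J \<noteq> {}"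
        using J(2) unfolding open_convex_def by - ((elim conjE)?, assumption)+
      have isoJ: "ord_iso (strict_of s) J (\<subset>) (cuts J0 (strict_of r))"
        unfolding J0_def by (rule iso[OF J(1) conv J_ends])
      have eq: "{x\<in>Field r. e x \<in> Field s} = Field r" using e(1) by blast
      have "\<forall>x\<in>Field s. \<forall>y\<in>Field s. \<forall>z. strict_of s x z \<and> strict_of s z y \<longrightarrow> z \<in> Field s"
        using carrier by blast
      then have iso_s: "ord_iso (strict_of s) (Field s) (\<subset>) (cuts (Field r) (strict_of r))"
        using iso[OF order_refl _ ends] unfolding eq by blast
      have "open_convex (strict_of r) J0"
        unfolding open_convex_def
      proof (intro conjI ballI allI impI)
        obtain a where a: "a \<in> J" using J_ne by blast
        then obtain b where "b \<in> J" "strict_of s a b" using J_ends by metis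
        note ab = a this
        then obtain x where "x \<in> Field r" "strict_of s a (e x)" "strict_of s (e x) b" using dense J(1) by blast
        then show "J0 \<noteq> {}" using conv ab unfolding J0_def by blast
        show "z \<in> J0" if "x \<in> J0" "y \<in> J0" "strict_of r x z \<and> strict_of r z y" for x y z
        proof -
          have X: "x \<in> Field r" "y \<in> Field r" "e x \<in> J" "e y \<in> J" using that unfolding J0_def by auto
          have "z \<in> Field r" using that(3) R.carrier by blast
          then have "strict_of s (e x) (e z)" "strict_of s (e z) (e y)" using e_lt X(1,2) that(3) by auto
          then show ?thesis using conv X \<open>z \<in> Field r\<close> unfolding J0_def by blast
        qed
        fix x assume "x \<in> J0"
        then have x: "x \<in> Field r" "e x \<in> J" unfolding J0_def by auto
        obtain a b where ab: "a \<in> J" "b \<in> J" "strict_of s a (e x)" "strict_of s (e x) b" using J_ends x(2) by metis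
        obtain y where y: "y \<in> Field r" "strict_of s a (e y)" "strict_of s (e y) (e x)" using dense ab x(2) J(1) by blast
        obtain z where z: "z \<in> Field r" "strict_of s (e x) (e z)" "strict_of s (e z) b" using dense ab x(2) J(1) by blast
        have "e y \<in> J" "e z \<in> J" using conv ab x(2) y z by blast+
        then show "\<exists>y\<in>J0. strict_of r y x" "\<exists>y\<in>J0. strict_of r x y"
          using x y z e_lt unfolding J0_def by blast+
      qed
      moreover have "J0 \<subseteq> Field r" unfolding J0_def by blast
      ultimately have "ord_iso (strict_of r) (Field r) (strict_of r) J0" using R.homogeneous by blast
      then have "ord_iso (\<subset>) (cuts (Field r) (strict_of r)) (\<subset>) (cuts J0 (strict_of r))"
        by (rule ord_iso_cuts_transfer)
      then show ?thesis using iso_s isoJ ord_iso_sym ord_iso_trans by metis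
    qed
  qed (rule dense_s)
  then show ?thesis using lin complete hlots_iff unfolding chlots_def by blast
qed

lemma (in homogeneous_order) cuts_linear:
  assumes "C \<in> cuts X lt" "D \<in> cuts X lt"
  shows "C \<subseteq> D \<or> D \<subseteq> C"
proof (rule ccontr)
  assume "\<not> (C \<subseteq> D \<or> D \<subseteq> C)"
  then obtain x y where xy: "x \<in> C" "x \<notin> D" "y \<in> D" "y \<notin> C" by blast
  then have "x \<in> X" "y \<in> X" "x \<noteq> y" using cutsD(1)[OF assms(1)] cutsD(1)[OF assms(2)] by auto
  then have "x \<sqsubset> y \<or> y \<sqsubset> x" using total by blast
  then show False
    using cutsD(4)[OF assms(1) xy(1) \<open>y \<in> X\<close>] cutsD(4)[OF assms(2) xy(3) \<open>x \<in> X\<close>] xy by blast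
qed

lemma (in homogeneous_order) ray_cut:
  assumes "x \<in> X"
  shows "{y. y \<sqsubset> x} \<in> cuts X lt"
proof -
  have "{y. y \<sqsubset> x} \<subseteq> X" "{y. y \<sqsubset> x} \<noteq> {}" "{y. y \<sqsubset> x} \<noteq> X"
    using carrier no_min[OF assms] assms irr by blast+
  moreover have "\<forall>y\<in>{y. y \<sqsubset> x}. \<forall>z\<in>X. z \<sqsubset> y \<longrightarrow> z \<in> {y. y \<sqsubset> x}" using lt_trans by blast
  moreover have "\<forall>y\<in>{y. y \<sqsubset> x}. \<exists>z\<in>{y. y \<sqsubset> x}. y \<sqsubset> z" using dense by blast
  ultimately show ?thesis unfolding cuts_def by blast
qed

text \<open>Keeps the assertion about all completions from being vacuous. A point of
  \<open>r\<close> is embedded as the open ray below it, and suprema are unions.\<close>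

lemma cut_rel_completion:
  assumes "hlots r"
  shows "is_completion r (cut_rel (Field r) (strict_of r))"
proof -
  have hom: "homogeneous_order (Field r) (strict_of r)" and lin_r: "Linear_order r"
    using assms hlots_iff by auto
  interpret homogeneous_order "Field r" "strict_of r" by (rule hom)
  let ?cuts = "cuts (Field r) (strict_of r)"
  define s where "s = cut_rel (Field r) (strict_of r)"
  have s_iff: "(C, D) \<in> s \<longleftrightarrow> C \<in> ?cuts \<and> D \<in> ?cuts \<and> C \<subseteq> D" for C D
    unfolding s_def cut_rel_def by simp
  have Field_s: "Field s = ?cuts"
    using s_iff by (auto simp: Field_def Domain_iff Range_iff)
  have cutD: "C \<subseteq> Field r" "C \<noteq> {}" "C \<noteq> Field r" "\<And>x y. x \<in> C \<Longrightarrow> strict_of r y x \<Longrightarrow> y \<in> C"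
    "\<And>x. x \<in> C \<Longrightarrow> \<exists>y\<in>C. strict_of r x y" if "C \<in> ?cuts" for C
    using cutsD[OF that] carrier by metis+
  have lin: "Linear_order s"
    unfolding order_on_defs Field_s
    using cuts_linear s_iff by (auto simp: refl_on_def trans_def antisym_def total_on_def)
  interpret S: linear_strict "Field s" "strict_of s" by (rule linear_strict_of[OF lin])
  have strict_iff: "strict_of s C D \<longleftrightarrow> C \<in> ?cuts \<and> D \<in> ?cuts \<and> C \<subset> D" for C D
    unfolding strict_of_def s_iff by blast
  define e where "e x = {y. strict_of r y x}" for x
  have e_cut: "e x \<in> ?cuts" if "x \<in> Field r" for x unfolding e_def by (rule ray_cut[OF that])
  have e_below: "e x \<subset> C" if "C \<in> ?cuts" "x \<in> C" for x C
    unfolding e_def using cutD(4)[OF that] irr that(2) by blast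
  have e_above: "C \<subset> e y" if C: "C \<in> ?cuts" "x \<in> Field r" "x \<notin> C" "strict_of r x y" for C x y
  proof -
    have "z \<in> e y" if "z \<in> C" for z
    proof -
      have "\<not> strict_of r x z" using cutD(4)[OF C(1) that] C(3) by blast
      moreover have "z \<in> Field r" using cutD(1)[OF C(1)] that by blast
      ultimately show ?thesis unfolding e_def using not_less_trans C(4) by blast
    qed
    moreover have "x \<in> e y" unfolding e_def using C(4) by blast
    ultimately show ?thesis using C(3) by blast
  qed
  have dense: "\<exists>x\<in>Field r. strict_of s C (e x) \<and> strict_of s (e x) D" if CD: "strict_of s C D" for C D
  proof -
    have C: "C \<in> ?cuts" and D: "D \<in> ?cuts" using CD strict_iff by auto
    obtain x where x: "x \<in> D" "x \<notin> C" using CD strict_iff by blast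
    obtain y where y: "y \<in> D" "strict_of r x y" using cutD(5)[OF D x(1)] by blast
    have X: "x \<in> Field r" "y \<in> Field r" using y(2) carrier by auto
    have "C \<subset> e y" "e y \<subset> D" using e_above[OF C X(1) x(2) y(2)] e_below[OF D y(1)] by auto
    then show ?thesis using strict_iff e_cut[OF X(2)] X(2) C D by blast
  qed
  have up: "\<exists>D. strict_of s C D" if C: "C \<in> Field s" for C
  proof -
    have C: "C \<in> ?cuts" using C Field_s by blast
    obtain x where x: "x \<in> Field r" "x \<notin> C" using cutD(1,3)[OF C] by blast
    obtain y where y: "strict_of r x y" using no_max[OF x(1)] by blast
    then have "y \<in> Field r" using carrier by blast
    then show ?thesis using e_above[OF C x y] e_cut strict_iff C by blast
  qed
  have down: "\<exists>D. strict_of s D C" if C: "C \<in> Field s" for C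
  proof -
    have C: "C \<in> ?cuts" using C Field_s by blast
    obtain x where x: "x \<in> C" using cutD(2)[OF C] by blast
    then have "x \<in> Field r" using cutD(1)[OF C] by blast
    then show ?thesis using e_below[OF C x] e_cut strict_iff C by blast
  qed
  have complete: "complete_order s"
  proof (rule complete_orderI)
    fix T assume T: "T \<subseteq> Field s" "T \<noteq> {}" "Above s T \<noteq> {}"
    then obtain U where "U \<in> Above s T" by blast
    then have U: "U \<in> ?cuts" "\<forall>C\<in>T. C \<subseteq> U" unfolding Above_def by (auto simp: s_iff Field_s)
    have T_cuts: "C \<in> ?cuts" if "C \<in> T" for C using T(1) that Field_s by blast
    obtain C0 where C0: "C0 \<in> T" using T(2) by blast
    have sub: "\<Union>T \<subseteq> U" using U(2) by blast
    then have "\<Union>T \<subseteq> Field r" "\<Union>T \<noteq> Field r" using cutD(1,3)[OF U(1)] by blast+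
    moreover have "\<Union>T \<noteq> {}" using C0 cutD(2)[OF T_cuts[OF C0]] by blast
    moreover have "\<forall>x\<in>\<Union>T. \<forall>y\<in>Field r. strict_of r y x \<longrightarrow> y \<in> \<Union>T"
      using cutD(4)[OF T_cuts] by (metis Union_iff)
    moreover have "\<forall>x\<in>\<Union>T. \<exists>y\<in>\<Union>T. strict_of r x y"
      using cutD(5)[OF T_cuts] by (metis Union_iff)
    ultimately have cut: "\<Union>T \<in> ?cuts" unfolding cuts_def by blast
    have "is_supremum s T (\<Union>T)"
      unfolding is_supremum_def
    proof (intro conjI ballI)
      show "\<Union>T \<in> Above s T" unfolding Above_def Field_s using cut s_iff T_cuts by blast
      show "(\<Union>T, U) \<in> s" if "U \<in> Above s T" for U
        using that cut s_iff unfolding Above_def Field_s by blast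
    qed
    then show "\<exists>z. is_supremum s T z" by blast
  qed
  have closure: "lots_topology s closure_of (e ` Field r) = Field s"
  proof
    show "lots_topology s closure_of (e ` Field r) \<subseteq> Field s"
      using closure_of_subset_topspace topspace_lots by metis
    show "Field s \<subseteq> lots_topology s closure_of (e ` Field r)"
    proof
      fix C assume C: "C \<in> Field s"
      show "C \<in> lots_topology s closure_of (e ` Field r)"
        unfolding in_closure_of topspace_lots
      proof (intro conjI allI impI; (elim conjE)?)
        fix T assume T: "C \<in> T" "openin (lots_topology s) T"
        have "\<forall>x\<in>Field s. (\<exists>y. strict_of s y x) \<and> (\<exists>y. strict_of s x y)" using up down by blast
        then obtain a b where ab: "strict_of s a C" "strict_of s C b"
          and T_ab: "\<forall>z. strict_of s a z \<and> strict_of s z b \<longrightarrow> z \<in> T"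
          using openin_interval[OF S.linear_strict_axioms _ T(2,1)] by blast
        obtain x where x: "x \<in> Field r" "strict_of s a (e x)" "strict_of s (e x) C" using dense[OF ab(1)] by blast
        then have "e x \<in> T" using T_ab S.lt_trans ab(2) by blast
        then show "\<exists>y. y \<in> e ` Field r \<and> y \<in> T" using x(1) by blast
      qed (rule C)
    qed
  qed
  have embed: "(x, y) \<in> r \<longleftrightarrow> (e x, e y) \<in> s" if xy: "x \<in> Field r" "y \<in> Field r" for x y
  proof
    assume "(x, y) \<in> r"
    then have "\<not> strict_of r y x" using rel_iff_not_strict[OF lin_r xy] by blast
    then have "e x \<subseteq> e y" unfolding e_def using less_not_trans xy by blast
    then show "(e x, e y) \<in> s" using s_iff e_cut xy by blast
  next
    assume "(e x, e y) \<in> s"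
    then have "e x \<subseteq> e y" using s_iff by blast
    then have "\<not> strict_of r y x" unfolding e_def using irr by blast
    then show "(x, y) \<in> r" using rel_iff_not_strict[OF lin_r xy] by blast
  qed
  have "order_dense s"
    unfolding order_dense_def using dense unfolding strict_of_def by blast
  moreover have "\<not> has_max s" "\<not> has_min s"
    unfolding has_max_def has_min_def
    using up down S.carrier rel_iff_not_strict[OF lin] by blast+
  moreover have "e ` Field r \<subseteq> Field s" using e_cut Field_s by blast
  ultimately show ?thesis
    unfolding is_completion_def s_def[symmetric]
    using lin complete closure embed homogeneous_no_ends[OF lin_r hom] by blast
qed

lemma homogeneous_order_iso:
  assumes hom: "homogeneous_order A lt" and lin: "linear_strict B lt'" and iso: "ord_iso lt' B lt A"
  shows "homogeneous_order B lt'"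
proof -
  interpret A: homogeneous_order A lt by (rule hom)
  interpret B: linear_strict B lt' by (rule lin)
  obtain f where f: "bij_betw f B A" "\<And>x y. x \<in> B \<Longrightarrow> y \<in> B \<Longrightarrow> lt' x y \<longleftrightarrow> lt (f x) (f y)"
    using iso unfolding ord_iso_def by auto
  have fA: "f x \<in> A" if "x \<in> B" for x using f(1) that by (rule bij_betw_apply)
  have surj: "\<exists>x\<in>B. y = f x" if "y \<in> A" for y using bij_betw_imp_surj_on[OF f(1)] that by blast
  show ?thesis
  proof
    show "B \<noteq> {}" using A.nonempty surj by blast
    show "\<exists>y. lt' y x" if x: "x \<in> B" for x
    proof -
      obtain a where a: "lt a (f x)" using A.no_min[OF fA[OF x]] by blast
      then obtain y where "y \<in> B" "a = f y" using surj A.carrier by blast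
      then show ?thesis using f(2)[of y x] a x by blast
    qed
    show "\<exists>y. lt' x y" if x: "x \<in> B" for x
    proof -
      obtain a where a: "lt (f x) a" using A.no_max[OF fA[OF x]] by blast
      then obtain y where "y \<in> B" "a = f y" using surj A.carrier by blast
      then show ?thesis using f(2)[of x y] a x by blast
    qed
    show "\<exists>z. lt' x z \<and> lt' z y" if xy: "lt' x y" for x y
    proof -
      have X: "x \<in> B" "y \<in> B" using xy B.carrier by auto
      obtain a where a: "lt (f x) a" "lt a (f y)" using A.dense f(2)[OF X] xy by blast
      then obtain z where "z \<in> B" "a = f z" using surj A.carrier by blast
      then show ?thesis using f(2)[of x z] f(2)[of z y] a X by blast
    qed
    show "ord_iso lt' B lt' J" if J: "J \<subseteq> B" "open_convex lt' J" for J
    proof -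
      have "open_convex lt (f ` J)"
        unfolding open_convex_def
      proof (intro conjI ballI allI impI)
        show "f ` J \<noteq> {}" using J(2) unfolding open_convex_def by blast
        fix x assume "x \<in> f ` J"
        then obtain j where j: "j \<in> J" "x = f j" by blast
        then obtain k l where "k \<in> J" "l \<in> J" "lt' k j" "lt' j l" using J(2) unfolding open_convex_def by blast
        then show "\<exists>y\<in>f ` J. lt y x" "\<exists>y\<in>f ` J. lt x y" using f(2) j J(1) by blast+
      next
        fix x y z assume xyz: "x \<in> f ` J" "y \<in> f ` J" "lt x z \<and> lt z y"
        then obtain j k where jk: "j \<in> J" "k \<in> J" "x = f j" "y = f k" by blast
        obtain w where w: "w \<in> B" "z = f w" using surj A.carrier xyz(3) by blast
        have "lt' j w" "lt' w k" using f(2) jk w xyz(3) J(1) by blast+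
        then have "w \<in> J" using J(2) jk unfolding open_convex_def by blast
        then show "z \<in> f ` J" using w(2) by blast
      qed
      moreover have "f ` J \<subseteq> A" using fA J(1) by blast
      ultimately have 1: "ord_iso lt A lt (f ` J)" using A.homogeneous by blast
      have "ord_iso lt' J lt (f ` J)"
        unfolding ord_iso_def
      proof (intro exI[of _ f] conjI ballI)
        show "bij_betw f J (f ` J)"
          using bij_betw_imp_inj_on[OF f(1)] J(1) by (meson inj_on_imp_bij_betw inj_on_subset)
      qed (use f(2) J(1) in blast)
      then show ?thesis using ord_iso_trans[OF ord_iso_trans[OF iso 1]] ord_iso_sym by blast
    qed
  qed
qed

section \<open>Ordinals and trees\<close>

lemma order_type_less_iff:
  assumes "Well_order r" "Well_order s"
  shows "order_type r < order_type s \<longleftrightarrow> (r, s) \<in> ordLess"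
  using less_ordinal.abs_eq[OF ordIso_reflexive[OF assms(1)] ordIso_reflexive[OF assms(2)]] .

lemma order_type_eq:
  assumes "(r, s) \<in> ordIso"
  shows "order_type r = order_type s"
  using Quotient_rel_abs[OF Quotient_ordinal] assms by blast

lemma order_type_surj:
  obtains r where "Well_order r" "order_type r = \<alpha>"
proof -
  have "(rep_ordinal \<alpha>, rep_ordinal \<alpha>) \<in> ordIso"
    using Quotient_rep_reflp[OF Quotient_ordinal] .
  then have "Well_order (rep_ordinal \<alpha>)" by (simp add: ordIso_def)
  then show ?thesis using that Quotient_abs_rep[OF Quotient_ordinal] by blast
qed

lemma order_type_segment_mono:
  assumes r: "Well_order r" and "(x, y) \<in> r" "x \<noteq> y"
  shows "order_type (Restr r (underS r x)) < order_type (Restr r (underS r y))"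
proof -
  have wo: "wo_rel r" using r by (simp add: wo_rel_def)
  have of: "wo_rel.ofilter r (underS r z)" for z by (rule wo_rel.underS_ofilter[OF wo])
  have "trans r" "antisym r" using r by (auto simp: order_on_defs)
  then have "underS r x \<subseteq> underS r y" "x \<in> underS r y" "x \<notin> underS r x"
    using assms(2,3) unfolding underS_def by (auto dest: transD antisymD)
  then have "(Restr r (underS r x), Restr r (underS r y)) \<in> ordLess"
    using ofilter_subset_ordLess[OF r of of] by blast
  then show ?thesis
    using order_type_less_iff[OF Well_order_Restr[OF r] Well_order_Restr[OF r]] by blast
qed

text \<open>A point is sent to the order type of its initial segment, so that a well-order is
  recovered as the set of the smaller ordinals.\<close>

lemma lessThan_order_type:
  assumes r: "Well_order r"
  shows "{..<order_type r} = (\<lambda>x. order_type (Restr r (underS r x))) ` Field r"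
proof
  show "{..<order_type r} \<subseteq> (\<lambda>x. order_type (Restr r (underS r x))) ` Field r"
  proof
    fix \<beta> assume \<beta>: "\<beta> \<in> {..<order_type r}"
    obtain q where q: "Well_order q" "order_type q = \<beta>" using order_type_surj by blast
    then have "(q, r) \<in> ordLess" using \<beta> order_type_less_iff[OF q(1) r] by simp
    then obtain a where "a \<in> Field r" "(q, Restr r (underS r a)) \<in> ordIso"
      using ordLess_iff_ordIso_Restr[OF r q(1)] by blast
    then show "\<beta> \<in> (\<lambda>x. order_type (Restr r (underS r x))) ` Field r"
      using order_type_eq q(2) by blast
  qed
  show "(\<lambda>x. order_type (Restr r (underS r x))) ` Field r \<subseteq> {..<order_type r}"
  proof
    fix \<beta> assume "\<beta> \<in> (\<lambda>x. order_type (Restr r (underS r x))) ` Field r"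
    then obtain x where x: "x \<in> Field r" "\<beta> = order_type (Restr r (underS r x))" by blast
    then have "(Restr r (underS r x), r) \<in> ordLess" by (intro underS_Restr_ordLess r) auto
    then show "\<beta> \<in> {..<order_type r}"
      using order_type_less_iff[OF Well_order_Restr[OF r] r] x(2) by blast
  qed
qed

lemma order_type_segment_iff:
  assumes r: "Well_order r" and xy: "x \<in> Field r" "y \<in> Field r"
  shows "order_type (Restr r (underS r x)) < order_type (Restr r (underS r y)) \<longleftrightarrow> strict_of r x y"
proof -
  have "Linear_order r" using r by (simp add: well_order_on_def)
  then have "x = y \<or> strict_of r x y \<or> strict_of r y x"
    using linear_strict.total[OF linear_strict_of xy] by blast
  moreover have "strict_of r x y \<Longrightarrow> \<not> strict_of r y x"
    using linear_strict.asym[OF linear_strict_of[OF \<open>Linear_order r\<close>]] .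
  ultimately show ?thesis
    using order_type_segment_mono[OF r] less_asym unfolding strict_of_def by (metis less_irrefl)
qed

lemma is_treeD:
  assumes "is_tree T"
  shows "prec T \<subseteq> nodes T \<times> nodes T" "irrefl (prec T)" "trans (prec T)"
    "\<And>p. p \<in> nodes T \<Longrightarrow> Well_order (pred_order T p)" "\<And>p. p \<in> nodes T \<Longrightarrow> Field (pred_order T p) = preds T p"
proof -
  show "prec T \<subseteq> nodes T \<times> nodes T" "irrefl (prec T)" "trans (prec T)"
    using assms unfolding is_tree_def by auto
  fix p assume "p \<in> nodes T"
  then have "well_order_on (preds T p) (pred_order T p)" using assms unfolding is_tree_def by blast
  then show "Well_order (pred_order T p)" "Field (pred_order T p) = preds T p"
    using well_order_on_Well_order by blast+
qed

text \<open>The predecessor order of a predecessor \<open>q\<close> of \<open>p\<close> is the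
  initial segment below \<open>q\<close> in that of \<open>p\<close>, so
  \<open>lessThan_order_type\<close> applies.\<close>

lemma lessThan_node_ord:
  assumes T: "is_tree T" and p: "p \<in> nodes T"
  shows "{..<node_ord T p} = node_ord T ` preds T p"
proof -
  have "Restr (pred_order T p) (underS (pred_order T p) q) = pred_order T q" if q: "q \<in> preds T p" for q
  proof -
    have "underS (pred_order T p) q = preds T q"
      using is_treeD(1-3)[OF T] q unfolding underS_def pred_order_def preds_def irrefl_def trans_def by blast
    moreover have "preds T q \<subseteq> preds T p"
      using is_treeD(3)[OF T] q unfolding preds_def trans_def by blast
    ultimately show ?thesis unfolding pred_order_def by blast
  qed
  then show ?thesis
    unfolding node_ord_def lessThan_order_type[OF is_treeD(4)[OF T p]] is_treeD(5)[OF T p] by simp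
qed

lemma node_ord_mono:
  assumes "is_tree T" "(q, p) \<in> prec T"
  shows "node_ord T q < node_ord T p"
proof -
  have "q \<in> preds T p" "p \<in> nodes T" using is_treeD(1)[OF assms(1)] assms(2) unfolding preds_def by auto
  then show ?thesis using lessThan_node_ord[OF assms(1), of p] by blast
qed

text \<open>\<open>ord_succ\<close> is a \<open>LEAST\<close>, and the node \<open>p'\<close> above
  \<open>p\<close> guarantees that the type has an ordinal beyond the order of \<open>p\<close>. A
  node above \<open>p\<close> of the next order is then one with nothing in between, because the
  orders of the predecessors of a node leave no gaps.\<close>

lemma succs_iff:
  assumes T: "is_tree T" and ext: "(p, p') \<in> prec T"
  shows "q \<in> succs T p \<longleftrightarrow> (p, q) \<in> prec T \<and> \<not> (\<exists>s. (p, s) \<in> prec T \<and> (s, q) \<in> prec T)"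
proof
  have sub: "prec T \<subseteq> nodes T \<times> nodes T" by (rule is_treeD(1)[OF T])
  have gr: "node_ord T p < ord_succ (node_ord T p)"
    unfolding ord_succ_def using node_ord_mono[OF T ext] by (rule LeastI)
  show "(p, q) \<in> prec T \<and> \<not> (\<exists>s. (p, s) \<in> prec T \<and> (s, q) \<in> prec T)" if "q \<in> succs T p"
  proof
    have q: "q = p \<or> (p, q) \<in> prec T" "node_ord T q = ord_succ (node_ord T p)"
      using that unfolding succs_def cone_def by auto
    then show "(p, q) \<in> prec T" using gr by auto
    show "\<not> (\<exists>s. (p, s) \<in> prec T \<and> (s, q) \<in> prec T)"
    proof
      assume "\<exists>s. (p, s) \<in> prec T \<and> (s, q) \<in> prec T"
      then obtain s where "node_ord T p < node_ord T s" "node_ord T s < ord_succ (node_ord T p)"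
        using node_ord_mono[OF T] q(2) by metis
      then show False unfolding ord_succ_def using not_less_Least by blast
    qed
  qed
  show "q \<in> succs T p" if q: "(p, q) \<in> prec T \<and> \<not> (\<exists>s. (p, s) \<in> prec T \<and> (s, q) \<in> prec T)"
  proof -
    have nodes: "p \<in> nodes T" "q \<in> nodes T" using q sub by auto
    have "ord_succ (node_ord T p) = node_ord T q"
      unfolding ord_succ_def
    proof (rule Least_equality)
      show "node_ord T p < node_ord T q" using node_ord_mono[OF T] q by blast
      show "node_ord T q \<le> \<beta>" if \<beta>: "node_ord T p < \<beta>" for \<beta>
      proof (rule ccontr)
        assume "\<not> node_ord T q \<le> \<beta>"
        then have "\<beta> \<in> {..<node_ord T q}" by simp
        then obtain s where s: "s \<in> preds T q" "\<beta> = node_ord T s"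
          using lessThan_node_ord[OF T nodes(2)] by blast
        have p: "p \<in> preds T q" using q nodes unfolding preds_def by blast
        have "Linear_order (pred_order T q)"
          using is_treeD(4)[OF T nodes(2)] by (simp add: well_order_on_def)
        then have "total_on (preds T q) (pred_order T q)"
          using is_treeD(5)[OF T nodes(2)] by (simp add: order_on_defs)
        then have "p = s \<or> (p, s) \<in> prec T \<or> (s, p) \<in> prec T"
          using p s(1) unfolding total_on_def pred_order_def by blast
        then show False
          using q s node_ord_mono[OF T] \<beta> unfolding preds_def by (metis (no_types, lifting) less_asym less_irrefl mem_Collect_eq)
      qed
    qed
    then show ?thesis using q nodes unfolding succs_def cone_def by simp
  qed
qed

section \<open>The order tree in terms of paths\<close>

locale order_tree_base =
  fixes r :: "'a rel"
  assumes chlots: "chlots r"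
begin

lemma linear: "Linear_order r" and complete: "complete_order r"
  using chlots hlots_iff unfolding chlots_def by auto

sublocale homogeneous_order "Field r" "strict_of r"
  using chlots hlots_iff unfolding chlots_def by auto

abbreviation lt (infix "\<sqsubset>" 50) where "x \<sqsubset> y \<equiv> strict_of r x y"

section \<open>Suprema in the bulleted order, and vertices as bounded paths\<close>

lemma bullet_iff:
  "(x, y) \<in> bullet r \<longleftrightarrow> x \<in> {Min_pt, Max_pt} \<union> Pt ` Field r \<and> y \<in> {Min_pt, Max_pt} \<union> Pt ` Field r \<and>
    (x = Min_pt \<or> y = Max_pt \<or> (\<exists>a b. x = Pt a \<and> y = Pt b \<and> (a, b) \<in> r))"
  unfolding bullet_def Let_def by simp

lemma bullet_Pt_iff: "(Pt a, y) \<in> bullet r \<longleftrightarrow> a \<in> Field r \<and> (y = Max_pt \<or> (\<exists>b. y = Pt b \<and> (a, b) \<in> r))"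
  unfolding bullet_iff by (auto simp: Field_def)

lemma Field_bullet: "Field (bullet r) = {Min_pt, Max_pt} \<union> Pt ` Field r"
proof
  show "Field (bullet r) \<subseteq> {Min_pt, Max_pt} \<union> Pt ` Field r"
  proof
    fix x assume "x \<in> Field (bullet r)"
    then obtain y where "(x, y) \<in> bullet r \<or> (y, x) \<in> bullet r" unfolding Field_def by blast
    then show "x \<in> {Min_pt, Max_pt} \<union> Pt ` Field r" unfolding bullet_iff by blast
  qed
  have "(x, Max_pt) \<in> bullet r" if "x \<in> {Min_pt, Max_pt} \<union> Pt ` Field r" for x
    using that unfolding bullet_iff by blast
  then show "{Min_pt, Max_pt} \<union> Pt ` Field r \<subseteq> Field (bullet r)"
    by (meson FieldI1 subsetI)
qed

lemma Above_bullet: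
  assumes S: "S \<subseteq> Field r" "S \<noteq> {}"
  shows "Above (bullet r) (Pt ` S) = insert Max_pt (Pt ` {u\<in>Field r. \<forall>x\<in>S. \<not> u \<sqsubset> x})"
proof -
  have "Pt u \<in> Above (bullet r) (Pt ` S) \<longleftrightarrow> u \<in> {u\<in>Field r. \<forall>x\<in>S. \<not> u \<sqsubset> x}" for u
  proof -
    have "(x, u) \<in> r \<longleftrightarrow> \<not> u \<sqsubset> x" if "u \<in> Field r" "x \<in> S" for x
      using rel_iff_not_strict[OF linear _ that(1)] S(1) that(2) by blast
    then show ?thesis
      unfolding Above_def Field_bullet using S(1) by (auto simp: bullet_Pt_iff)
  qed
  moreover have "Max_pt \<in> Above (bullet r) (Pt ` S)"
    unfolding Above_def Field_bullet using S(1) by (auto simp: bullet_Pt_iff)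
  moreover have "Min_pt \<notin> Above (bullet r) (Pt ` S)"
    unfolding Above_def using S(2) by (auto simp: bullet_Pt_iff)
  moreover have "Above (bullet r) (Pt ` S) \<subseteq> {Min_pt, Max_pt} \<union> Pt ` Field r"
    unfolding Above_def Field_bullet by blast
  ultimately show ?thesis by blast
qed

lemma bullet_antisym: "(x, y) \<in> bullet r \<Longrightarrow> (y, x) \<in> bullet r \<Longrightarrow> x = y"
  unfolding bullet_iff using linear by (auto simp: order_on_defs dest: antisymD)

lemma the_supremum: "is_supremum (bullet r) A s \<Longrightarrow> (THE s. is_supremum (bullet r) A s) = s"
  unfolding is_supremum_def using bullet_antisym by (intro the_equality) auto

text \<open>By completeness the supremum of \<open>S\<close> is a point of \<open>X\<close> if
  \<open>S\<close> is bounded, and \<open>Max_pt\<close> otherwise. A point of \<open>X\<close> lies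
  strictly above it iff some bound of \<open>S\<close> lies below that point, which is the form used
  in \<open>extensions\<close>.\<close>

lemma supremum_less:
  fixes S
  defines "s \<equiv> THE s. is_supremum (bullet r) (Pt ` S) s"
  assumes S: "S \<subseteq> Field r" "S \<noteq> {}"
  shows "y \<in> Field r \<Longrightarrow> s \<in> underS (bullet r) (Pt y) \<longleftrightarrow> (\<exists>z. z \<sqsubset> y \<and> (\<forall>x\<in>S. \<not> z \<sqsubset> x))" (is "_ \<Longrightarrow> ?L1 \<longleftrightarrow> ?R1")
    and "s \<in> underS (bullet r) Max_pt \<longleftrightarrow> (\<exists>z\<in>Field r. \<forall>x\<in>S. \<not> z \<sqsubset> x)" (is "?L2 \<longleftrightarrow> ?R2")
proof -
  show "?L1 \<longleftrightarrow> ?R1" if y: "y \<in> Field r"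
  proof (cases ?R2)
    case True
    then obtain z where z: "z \<in> Field r" "\<forall>x\<in>S. \<not> z \<sqsubset> x"
      and least: "\<forall>v\<in>Field r. (\<forall>x\<in>S. \<not> v \<sqsubset> x) \<longrightarrow> \<not> v \<sqsubset> z"
      using complete_sup[OF linear complete S] by metis
    have "is_supremum (bullet r) (Pt ` S) (Pt z)"
      unfolding is_supremum_def Above_bullet[OF S]
      using z least rel_iff_not_strict[OF linear] by (auto simp: bullet_Pt_iff)
    then have "s = Pt z" unfolding s_def by (rule the_supremum)
    then have "?L1 \<longleftrightarrow> z \<sqsubset> y"
      using z(1) by (auto simp: underS_def bullet_Pt_iff strict_of_def)
    also have "\<dots> \<longleftrightarrow> ?R1"
      using z least not_less_trans carrier by blast
    finally show ?thesis .
  next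
    case False
    have "is_supremum (bullet r) (Pt ` S) Max_pt"
      unfolding is_supremum_def Above_bullet[OF S] using False by (auto simp: bullet_iff)
    then have "s = Max_pt" unfolding s_def by (rule the_supremum)
    then have "\<not> ?L1" by (simp add: underS_def bullet_iff)
    moreover have "\<not> ?R1" using False carrier by blast
    ultimately show ?thesis by blast
  qed
  show "?L2 \<longleftrightarrow> ?R2"
  proof (cases ?R2)
    case True
    then obtain z where z: "z \<in> Field r" "\<forall>x\<in>S. \<not> z \<sqsubset> x"
      and least: "\<forall>v\<in>Field r. (\<forall>x\<in>S. \<not> v \<sqsubset> x) \<longrightarrow> \<not> v \<sqsubset> z"
      using complete_sup[OF linear complete S] by metis
    have "is_supremum (bullet r) (Pt ` S) (Pt z)"
      unfolding is_supremum_def Above_bullet[OF S]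
      using z least rel_iff_not_strict[OF linear] by (auto simp: bullet_Pt_iff)
    then have "s = Pt z" unfolding s_def by (rule the_supremum)
    then show ?thesis using True z(1) by (simp add: underS_def bullet_Pt_iff)
  next
    case False
    have "is_supremum (bullet r) (Pt ` S) Max_pt"
      unfolding is_supremum_def Above_bullet[OF S] using False by (auto simp: bullet_iff)
    then have "s = Max_pt" unfolding s_def by (rule the_supremum)
    then show ?thesis using False by (simp add: underS_def)
  qed
qed

text \<open>Rids the definition of suprema, in the form of \<open>is_path\<close> and
  \<open>bounded_paths\<close>. At the least index \<open>hat\<close> is \<open>Min_pt\<close>, and
  since \<open>X\<close> has no minimum the condition on \<open>z\<close> holds there as
  well.\<close>

lemma vertex_iff:
  "vertex_of_order r \<alpha> p \<longleftrightarrow> dom p = {..<\<alpha>} \<and> ran p \<subseteq> Field r \<and>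
    (\<forall>i<\<alpha>. \<exists>z. z \<sqsubset> the (p i) \<and> (\<forall>j<i. \<not> z \<sqsubset> the (p j))) \<and>
    (\<exists>z\<in>Field r. \<forall>j<\<alpha>. \<not> z \<sqsubset> the (p j))"
proof (cases "dom p = {..<\<alpha>} \<and> ran p \<subseteq> Field r")
  case True
  have mem: "the (p i) \<in> Field r" if i: "i < \<alpha>" for i
  proof -
    have "i \<in> dom p" using True i by blast
    then obtain x where "p i = Some x" by blast
    then show ?thesis using True by (auto simp: ran_def)
  qed
  have img: "(\<lambda>j. Pt (the (p j))) ` {..<i} = Pt ` ((\<lambda>j. the (p j)) ` {..<i})" for i by (simp add: image_image)
  have S: "(\<lambda>j. the (p j)) ` {..<i} \<subseteq> Field r" if "i \<le> \<alpha>" for i using mem that by auto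
  have "hat r p i \<in> underS (bullet r) (Pt (the (p i))) \<longleftrightarrow> (\<exists>z. z \<sqsubset> the (p i) \<and> (\<forall>j<i. \<not> z \<sqsubset> the (p j)))"
    if i: "i < \<alpha>" for i
  proof (cases "{..<i} = {}")
    case True
    then have "hat r p i = Min_pt" by (simp add: hat_def)
    moreover have "\<not> j < i" for j using True by blast
    ultimately show ?thesis using mem[OF i] no_min by (auto simp: underS_def bullet_iff)
  next
    case False
    then have ne: "(\<lambda>j. the (p j)) ` {..<i} \<noteq> {}" by blast
    have "hat r p i = (THE s. is_supremum (bullet r) (Pt ` ((\<lambda>j. the (p j)) ` {..<i})) s)"
      using False by (simp add: hat_def img)
    then show ?thesis using supremum_less(1)[OF S[OF less_imp_le[OF i]] ne mem[OF i]] by auto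
  qed
  moreover have "hat r p \<alpha> \<in> underS (bullet r) Max_pt \<longleftrightarrow> (\<exists>z\<in>Field r. \<forall>j<\<alpha>. \<not> z \<sqsubset> the (p j))"
  proof (cases "{..<\<alpha>} = {}")
    case True
    then have "hat r p \<alpha> = Min_pt" by (simp add: hat_def)
    moreover have "\<not> j < \<alpha>" for j using True by blast
    ultimately show ?thesis using nonempty by (auto simp: underS_def bullet_iff)
  next
    case False
    then have ne: "(\<lambda>j. the (p j)) ` {..<\<alpha>} \<noteq> {}" by blast
    have "hat r p \<alpha> = (THE s. is_supremum (bullet r) (Pt ` ((\<lambda>j. the (p j)) ` {..<\<alpha>})) s)"
      using False by (simp add: hat_def img)
    then show ?thesis using supremum_less(2)[OF S[OF order_refl] ne] by auto
  qed
  ultimately show ?thesis unfolding vertex_of_order_def using True by auto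
qed (auto simp: vertex_of_order_def)

lemma vertexD:
  assumes "p \<in> vertices r"
  shows "\<exists>\<alpha>. dom p = {..<\<alpha>}" "\<And>i j. i \<in> dom p \<Longrightarrow> j < i \<Longrightarrow> j \<in> dom p"
    "\<And>i. i \<in> dom p \<Longrightarrow> the (p i) \<in> ran p"
    "\<And>i j. i \<in> dom p \<Longrightarrow> j < i \<Longrightarrow> the (p j) \<sqsubset> the (p i)"
    "\<And>i. i \<in> dom p \<Longrightarrow> \<exists>z. z \<sqsubset> the (p i) \<and> (\<forall>j<i. \<not> z \<sqsubset> the (p j))"
    "ran p \<subseteq> Field r" "\<exists>z\<in>Field r. \<forall>y\<in>ran p. \<not> z \<sqsubset> y"
proof -
  obtain \<alpha> where "vertex_of_order r \<alpha> p" using assms unfolding vertices_def by blast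
  then have p: "dom p = {..<\<alpha>}" "ran p \<subseteq> Field r"
    and iso: "\<And>i. i < \<alpha> \<Longrightarrow> \<exists>z. z \<sqsubset> the (p i) \<and> (\<forall>j<i. \<not> z \<sqsubset> the (p j))"
    and bd: "\<exists>z\<in>Field r. \<forall>j<\<alpha>. \<not> z \<sqsubset> the (p j)"
    unfolding vertex_iff by auto
  have down: "j \<in> dom p" if "i \<in> dom p" "j < i" for i j
    using that p(1) less_trans by blast
  have mem: "the (p i) \<in> ran p" if "i \<in> dom p" for i
    using that by (auto simp: ran_def)
  have mono: "the (p j) \<sqsubset> the (p i)" if ij: "i \<in> dom p" "j < i" for i j
  proof -
    obtain z where "z \<sqsubset> the (p i)" "\<not> z \<sqsubset> the (p j)" using iso[of i] ij p(1) by blast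
    then show ?thesis using not_less_trans mem[OF down[OF ij]] p(2) by blast
  qed
  have bound: "\<exists>z\<in>Field r. \<forall>y\<in>ran p. \<not> z \<sqsubset> y"
  proof -
    obtain z where z: "z \<in> Field r" "\<forall>j<\<alpha>. \<not> z \<sqsubset> the (p j)" using bd by blast
    have "\<not> z \<sqsubset> y" if y: "y \<in> ran p" for y
    proof -
      obtain i where i: "p i = Some y" using y by (auto simp: ran_def)
      then have "i < \<alpha>" using p(1) by blast
      then show ?thesis using z(2) i by force
    qed
    then show ?thesis using z(1) by blast
  qed
  have iso': "\<exists>z. z \<sqsubset> the (p i) \<and> (\<forall>j<i. \<not> z \<sqsubset> the (p j))" if "i \<in> dom p" for i
    using iso[of i] that p(1) by blast
  show "\<exists>\<alpha>. dom p = {..<\<alpha>}" using p(1) by blast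
  show "\<And>i j. i \<in> dom p \<Longrightarrow> j < i \<Longrightarrow> j \<in> dom p" "\<And>i. i \<in> dom p \<Longrightarrow> the (p i) \<in> ran p"
    "\<And>i j. i \<in> dom p \<Longrightarrow> j < i \<Longrightarrow> the (p j) \<sqsubset> the (p i)"
    "\<And>i. i \<in> dom p \<Longrightarrow> \<exists>z. z \<sqsubset> the (p i) \<and> (\<forall>j<i. \<not> z \<sqsubset> the (p j))"
    "ran p \<subseteq> Field r" "\<exists>z\<in>Field r. \<forall>y\<in>ran p. \<not> z \<sqsubset> y"
    by (fact down mem mono iso' p(2) bound)+
qed

lemma ran_mem: "y \<in> ran p \<Longrightarrow> \<exists>i\<in>dom p. y = the (p i)"
  by (force simp: ran_def)

lemma ran_bounded_path:
  assumes "p \<in> vertices r"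
  shows "ran p \<in> bounded_paths"
proof -
  note p = vertexD[OF assms]
  have "is_path (ran p)"
    unfolding is_path_def
  proof (intro conjI allI ballI impI)
    show "\<exists>m\<in>S. \<forall>y\<in>S. \<not> y \<sqsubset> m" if S: "S \<subseteq> ran p" "S \<noteq> {}" for S
    proof -
      define P where "P i \<longleftrightarrow> i \<in> dom p \<and> the (p i) \<in> S" for i
      obtain y where y: "y \<in> S" using S(2) by blast
      then obtain i where "i \<in> dom p" "y = the (p i)" using ran_mem[of y p] S(1) by blast
      then have "P i" using y unfolding P_def by blast
      then have k: "P (LEAST i. P i)" by (rule LeastI)
      have "\<not> y \<sqsubset> the (p (LEAST i. P i))" if y: "y \<in> S" for y
      proof -
        obtain j where j: "j \<in> dom p" "y = the (p j)" using y S(1) ran_mem[of y p] by blast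
        then have "P j" using y unfolding P_def by blast
        then have "(LEAST i. P i) \<le> j" by (rule Least_le)
        then have "(LEAST i. P i) = j \<or> the (p (LEAST i. P i)) \<sqsubset> the (p j)"
          using p(4)[OF j(1)] by (metis le_neq_trans)
        then show ?thesis using j(2) irr asym by metis
      qed
      then show ?thesis using k unfolding P_def by blast
    qed
    show "d \<in> extensions (below lt (ran p) d)" if d: "d \<in> ran p" for d
    proof -
      obtain i where i: "i \<in> dom p" "d = the (p i)" using ran_mem[OF d] by blast
      obtain z where z: "z \<sqsubset> the (p i)" "\<forall>j<i. \<not> z \<sqsubset> the (p j)" using p(5)[OF i(1)] by blast
      have "\<not> z \<sqsubset> y" if y: "y \<in> below lt (ran p) d" for y
      proof -
        obtain j where j: "j \<in> dom p" "y = the (p j)" "y \<sqsubset> d" using y ran_mem[of y p] unfolding below_def by blast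
        then have "j \<noteq> i" "\<not> i < j" using p(4)[OF j(1), of i] irr asym i(2) by auto
        then show ?thesis using z(2) j(2) by simp
      qed
      then show ?thesis using z(1) i(2) unfolding extensions_def by blast
    qed
  qed
  then show ?thesis using p(7) unfolding bounded_paths_def by blast
qed

lemma Well_order_path:
  assumes "is_path D"
  shows "Well_order (Restr r D)" "Field (Restr r D) = D"
proof -
  have DX: "D \<subseteq> Field r" by (rule path_subset[OF assms])
  show F: "Field (Restr r D) = D" by (rule Field_Restr_linear(1)[OF linear DX])
  have "wf (Restr r D - Id)"
    unfolding wf_eq_minimal
  proof (intro allI impI)
    fix Q x assume x: "x \<in> (Q :: 'a set)"
    show "\<exists>z\<in>Q. \<forall>y. (y, z) \<in> Restr r D - Id \<longrightarrow> y \<notin> Q"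
    proof (cases "Q \<inter> D = {}")
      case True
      then show ?thesis using x by blast
    next
      case False
      then obtain m where "m \<in> Q \<inter> D" "\<forall>y\<in>Q \<inter> D. \<not> y \<sqsubset> m"
        using path_well_ordered[OF assms, of "Q \<inter> D"] by blast
      then show ?thesis unfolding strict_of_def by blast
    qed
  qed
  then show "Well_order (Restr r D)"
    unfolding well_order_on_def using Linear_order_Restr[OF linear] by blast
qed

text \<open>The vertex enumerates \<open>D\<close> in increasing order, sending the position
  \<open>pos d\<close> of a point to \<open>d\<close>. Positions are order types of subsets of
  \<open>'a\<close>, so they exist in \<open>'a ordinal\<close>.\<close>

lemma vertex_exists:
  assumes "D \<in> bounded_paths"
  shows "\<exists>p\<in>vertices r. ran p = D"
proof -
  have D: "is_path D" and DX: "D \<subseteq> Field r" using assms path_subset unfolding bounded_paths_def by blast+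
  define \<rho> where "\<rho> = Restr r D"
  have wo: "Well_order \<rho>" and F: "Field \<rho> = D" unfolding \<rho>_def using Well_order_path[OF D] by auto
  define pos where "pos d = order_type (Restr \<rho> (underS \<rho> d))" for d
  have img: "{..<order_type \<rho>} = pos ` D"
    using lessThan_order_type[OF wo] unfolding pos_def F .
  have mono: "pos d < pos e \<longleftrightarrow> d \<sqsubset> e" if "d \<in> D" "e \<in> D" for d e
    using order_type_segment_iff[OF wo, of d e] that unfolding pos_def F by (auto simp: strict_of_def \<rho>_def)
  have inj: "inj_on pos D"
    using mono total DX irr unfolding inj_on_def by (metis less_irrefl subsetD)
  define p where "p i = (if i < order_type \<rho> then Some (inv_into D pos i) else None)" for i
  have dom: "dom p = {..<order_type \<rho>}" unfolding p_def by (auto split: if_splits)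
  have p_pos: "p (pos d) = Some d" if "d \<in> D" for d
    using that img inj unfolding p_def by (auto simp: inv_into_f_f)
  have pos_ex: "\<exists>d\<in>D. i = pos d" if "i < order_type \<rho>" for i using img that by blast
  have "ran p = D"
  proof
    show "ran p \<subseteq> D" using pos_ex p_pos dom by (force simp: ran_def)
    show "D \<subseteq> ran p" using p_pos by (auto simp: ran_def)
  qed
  moreover have "\<exists>z. z \<sqsubset> the (p i) \<and> (\<forall>j<i. \<not> z \<sqsubset> the (p j))" if i: "i < order_type \<rho>" for i
  proof -
    obtain d where d: "d \<in> D" "i = pos d" using pos_ex[OF i] by blast
    obtain z where z: "z \<sqsubset> d" "\<forall>y\<in>below lt D d. \<not> z \<sqsubset> y"
      using path_extensions[OF D d(1)] unfolding extensions_def by blast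
    have "\<not> z \<sqsubset> the (p j)" if j: "j < i" for j
    proof -
      obtain e where e: "e \<in> D" "j = pos e" using pos_ex[OF less_trans[OF j i]] by blast
      then have "e \<sqsubset> d" using j d mono by blast
      then show ?thesis using z(2) e p_pos[OF e(1)] unfolding below_def by simp
    qed
    then show ?thesis using z(1) d p_pos[OF d(1)] by auto
  qed
  moreover have "\<exists>z\<in>Field r. \<forall>j<order_type \<rho>. \<not> z \<sqsubset> the (p j)"
  proof -
    obtain z where z: "z \<in> Field r" "\<forall>y\<in>D. \<not> z \<sqsubset> y" using assms unfolding bounded_paths_def by blast
    then show ?thesis using pos_ex p_pos by (metis option.sel)
  qed
  ultimately have "vertex_of_order r (order_type \<rho>) p" using dom DX unfolding vertex_iff by blast
  then show ?thesis using \<open>ran p = D\<close> unfolding vertices_def by blast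
qed

text \<open>A restriction of an increasing enumeration lists an initial segment. Conversely the
  enumerations agree index by index, by induction, since neither of them can skip a point.\<close>

lemma map_le_iff_initial_seg:
  assumes p: "p \<in> vertices r" and q: "q \<in> vertices r"
  shows "q \<subseteq>\<^sub>m p \<longleftrightarrow> initial_seg lt (ran q) (ran p)"
proof -
  note p = vertexD[OF p] and q = vertexD[OF q]
  have less: "j < i" if "i \<in> dom p" "j \<in> dom p" "the (p j) \<sqsubset> the (p i)" for i j
    using p(4)[OF that(2), of i] that(3) irr asym by (metis linorder_neqE)
  have inj: "i = j" if "i \<in> dom p" "j \<in> dom p" "the (p i) = the (p j)" for i j
    using p(4) that irr by (metis linorder_neqE)
  show ?thesis
  proof
    assume le: "q \<subseteq>\<^sub>m p"
    have eq: "i \<in> dom p \<and> q i = p i" if "i \<in> dom q" for i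
      using le that map_le_implies_dom_le[OF le] unfolding map_le_def by blast
    show "initial_seg lt (ran q) (ran p)"
      unfolding initial_seg_def
    proof (intro conjI subsetI ballI impI)
      fix x assume "x \<in> ran q"
      then obtain i where "i \<in> dom q" "x = the (q i)" using ran_mem[of x q] by blast
      then show "x \<in> ran p" using eq[of i] p(3)[of i] by simp
    next
      fix x y assume "x \<in> ran q" "y \<in> ran p" "y \<sqsubset> x"
      then obtain i j where ij: "i \<in> dom q" "x = the (q i)" "j \<in> dom p" "y = the (p j)"
        using ran_mem[of x q] ran_mem[of y p] by blast
      then have "j < i" using less[of i j] eq[of i] \<open>y \<sqsubset> x\<close> by simp
      then have "j \<in> dom q" using q(2)[OF ij(1)] by blast
      then show "y \<in> ran q" using eq[of j] q(3)[of j] ij by simp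
    qed
  next
    assume seg: "initial_seg lt (ran q) (ran p)"
    have "i \<in> dom q \<longrightarrow> i \<in> dom p \<and> p i = q i" for i
    proof (induction i rule: less_induct)
      case (less i)
      show ?case
      proof
        assume i: "i \<in> dom q"
        have IH: "j \<in> dom p \<and> p j = q j" if "j < i" for j using less.IH[OF that] q(2)[OF i that] by blast
        have "the (q i) \<in> ran p" using q(3)[OF i] seg unfolding initial_seg_def by blast
        then obtain k where k: "k \<in> dom p" "the (q i) = the (p k)" using ran_mem[of "the (q i)" p] by blast
        have "\<not> k < i"
        proof
          assume "k < i"
          then have "the (q k) \<sqsubset> the (q i)" "p k = q k" using q(4)[OF i] IH by auto
          then show False using k(2) irr by simp
        qed
        moreover have "\<not> i < k"
        proof
          \<comment> \<open>Then \<open>p i\<close> lies below \<open>q i\<close> and belongs to the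
            range of \<open>q\<close>, so \<open>q\<close> lists it at some \<open>j < i\<close>.
            There \<open>p\<close> and \<open>q\<close> agree, so \<open>p\<close> would list the
            point twice.\<close>
          assume ik: "i < k"
          have i_p: "i \<in> dom p" by (rule p(2)[OF k(1) ik])
          then have "the (p i) \<sqsubset> the (q i)" using p(4)[OF k(1) ik] k(2) by simp
          then have "the (p i) \<in> ran q" using seg p(3)[OF i_p] q(3)[OF i] unfolding initial_seg_def by blast
          then obtain j where j: "j \<in> dom q" "the (p i) = the (q j)" using ran_mem[of "the (p i)" q] by blast
          have "the (q j) \<sqsubset> the (q i)" using j(2) \<open>the (p i) \<sqsubset> the (q i)\<close> by simp
          then have "\<not> i < j" "j \<noteq> i" using q(4)[OF j(1), of i] asym irr by auto
          then have "j < i" by simp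
          then have "the (p i) = the (p j)" "j \<in> dom p" using IH[of j] j(2) by auto
          then show False using inj[OF i_p] \<open>j < i\<close> by blast
        qed
        ultimately have "k = i" by simp
        then show "i \<in> dom p \<and> p i = q i" using k i by (metis domD option.sel)
      qed
    qed
    then show "q \<subseteq>\<^sub>m p" unfolding map_le_def by simp
  qed
qed


section \<open>The order tree as a tree of bounded paths\<close>

abbreviation T :: "'a vertex bitree" where "T \<equiv> order_tree r"

abbreviation iseg :: "'a set \<Rightarrow> 'a set \<Rightarrow> bool" where "iseg \<equiv> initial_seg lt"

text \<open>The inverse of \<open>ran\<close> on bounded paths, by which nodes are handled as sets
  from here on.\<close>

definition vert :: "'a set \<Rightarrow> 'a vertex" where
  "vert D = inv_into (vertices r) ran D"

lemma ran_inj: "p \<in> vertices r \<Longrightarrow> q \<in> vertices r \<Longrightarrow> ran p = ran q \<Longrightarrow> p = q"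
  using map_le_iff_initial_seg by (metis initial_seg_refl map_le_antisym)

lemma ran_vertices: "ran ` vertices r = bounded_paths"
  using ran_bounded_path vertex_exists by blast

lemma vert_mem: "D \<in> bounded_paths \<Longrightarrow> vert D \<in> vertices r"
  unfolding vert_def ran_vertices[symmetric] by (rule inv_into_into)

lemma ran_vert: "D \<in> bounded_paths \<Longrightarrow> ran (vert D) = D"
  unfolding vert_def using f_inv_into_f[of D ran "vertices r"] ran_vertices by simp

lemma vert_ran: "p \<in> vertices r \<Longrightarrow> vert (ran p) = p"
  using ran_inj vert_mem ran_vert ran_bounded_path by metis

lemma vert_inj: "D \<in> bounded_paths \<Longrightarrow> E \<in> bounded_paths \<Longrightarrow> vert D = vert E \<Longrightarrow> D = E"
  using ran_vert by metis

lemma nodes_T: "nodes T = vertices r"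
  by (simp add: order_tree_def)

lemma prec_iff: "(q, p) \<in> prec T \<longleftrightarrow>
    q \<in> vertices r \<and> p \<in> vertices r \<and> iseg (ran q) (ran p) \<and> ran q \<noteq> ran p"
  unfolding order_tree_def using map_le_iff_initial_seg ran_inj by auto

lemma bounded_is_path: "D \<in> bounded_paths \<Longrightarrow> is_path D"
  unfolding bounded_paths_def by blast

lemma prec_below_iff:
  assumes "p \<in> vertices r"
  shows "(q, p) \<in> prec T \<longleftrightarrow> (\<exists>d\<in>ran p. q = vert (below lt (ran p) d))"
proof -
  have P: "is_path (ran p)" using bounded_is_path[OF ran_bounded_path[OF assms]] .
  show ?thesis
  proof
    assume "(q, p) \<in> prec T"
    then have q: "q \<in> vertices r" "iseg (ran q) (ran p) \<and> ran q \<noteq> ran p" unfolding prec_iff by auto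
    then obtain d where "d \<in> ran p" "ran q = below lt (ran p) d"
      using proper_initial_seg_iff[OF P] by blast
    then show "\<exists>d\<in>ran p. q = vert (below lt (ran p) d)"
      using vert_ran[OF q(1)] by metis
  next
    assume "\<exists>d\<in>ran p. q = vert (below lt (ran p) d)"
    then obtain d where d: "d \<in> ran p" "q = vert (below lt (ran p) d)" by blast
    then have "q \<in> vertices r" "ran q = below lt (ran p) d"
      using vert_mem ran_vert below_bounded[OF P d(1)] by auto
    then show "(q, p) \<in> prec T"
      using proper_initial_seg_iff[OF P] d(1) assms unfolding prec_iff by blast
  qed
qed

lemma below_eq_iff:
  assumes "D \<subseteq> Field r" "x \<in> D" "y \<in> D"
  shows "below lt D x = below lt D y \<longleftrightarrow> x = y"
proof
  assume *: "below lt D x = below lt D y"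
  have "\<not> x \<sqsubset> y" "\<not> y \<sqsubset> x"
    using * assms(2,3) irr unfolding below_def by blast+
  then show "x = y" using total assms by blast
qed simp

lemma below_iseg_iff:
  assumes "D \<subseteq> Field r" "x \<in> D" "y \<in> D"
  shows "iseg (below lt D x) (below lt D y) \<longleftrightarrow> \<not> y \<sqsubset> x"
proof
  assume "iseg (below lt D x) (below lt D y)"
  then have "below lt D x \<subseteq> below lt D y" by (rule initial_seg_subset)
  then show "\<not> y \<sqsubset> x" using assms(3) irr unfolding below_def by blast
next
  assume *: "\<not> y \<sqsubset> x"
  have "z \<sqsubset> y" if "z \<sqsubset> x" for z
    using less_not_trans[OF that *] assms by blast
  then show "iseg (below lt D x) (below lt D y)"
    unfolding initial_seg_def below_def using lt_trans by blast
qed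

text \<open>Under \<open>e\<close>, a point \<open>d\<close> of the range of \<open>p\<close> stands
  for the predecessor of \<open>p\<close> that stops short of \<open>d\<close>. The order of a node
  is therefore the order type of its range.\<close>

lemma pred_order_eq:
  assumes p: "p \<in> vertices r"
  defines "e \<equiv> \<lambda>d. vert (below lt (ran p) d)"
  shows "pred_order T p = dir_image (Restr r (ran p)) e" "preds T p = e ` ran p" "inj_on e (ran p)"
proof -
  have P: "is_path (ran p)" using bounded_is_path[OF ran_bounded_path[OF p]] .
  have PX: "ran p \<subseteq> Field r" by (rule path_subset[OF P])
  have bb: "below lt (ran p) d \<in> bounded_paths" if "d \<in> ran p" for d
    by (rule below_bounded[OF P that])
  show preds: "preds T p = e ` ran p"
    unfolding preds_def nodes_T e_def using prec_below_iff[OF p] prec_iff by blast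
  show inj: "inj_on e (ran p)"
    unfolding inj_on_def e_def using vert_inj[OF bb bb] below_eq_iff[OF PX] by blast
  have iff: "e x = e y \<or> (e x, e y) \<in> prec T \<longleftrightarrow> (x, y) \<in> r" if xy: "x \<in> ran p" "y \<in> ran p" for x y
  proof -
    have "(e x, e y) \<in> prec T \<longleftrightarrow> \<not> y \<sqsubset> x \<and> x \<noteq> y"
      unfolding prec_iff e_def ran_vert[OF bb[OF xy(1)]] ran_vert[OF bb[OF xy(2)]]
      using below_iseg_iff[OF PX xy] below_eq_iff[OF PX xy] vert_mem bb xy by blast
    moreover have "e x = e y \<longleftrightarrow> x = y" using inj xy unfolding inj_on_def by blast
    moreover have "(x, y) \<in> r \<longleftrightarrow> \<not> y \<sqsubset> x" using rel_iff_not_strict[OF linear] xy PX by blast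
    ultimately show ?thesis using irr by blast
  qed
  show "pred_order T p = dir_image (Restr r (ran p)) e"
    unfolding pred_order_def preds dir_image_def using iff by fastforce
qed

lemma pred_well_order:
  assumes "p \<in> vertices r"
  shows "well_order_on (preds T p) (pred_order T p)"
proof -
  have P: "is_path (ran p)" using bounded_is_path[OF ran_bounded_path[OF assms]] .
  note wo = Well_order_path[OF P]
  have "Well_order (pred_order T p)"
    unfolding pred_order_eq(1)[OF assms]
    by (rule Well_order_dir_image[OF wo(1)]) (use pred_order_eq(3)[OF assms] wo(2) in simp)
  moreover have "Field (pred_order T p) = preds T p"
    unfolding pred_order_eq(1,2)[OF assms] dir_image_Field wo(2) ..
  ultimately show ?thesis by simp
qed

lemma vert_empty_root: "is_root T (vert {})"
  unfolding is_root_def nodes_T prec_iff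
  using vert_mem[OF empty_path] ran_vert[OF empty_path] ran_inj by auto

lemma tree: "is_tree T"
  unfolding is_tree_def
proof (intro conjI ballI)
  show "prec T \<subseteq> nodes T \<times> nodes T" using prec_iff nodes_T by auto
  show "irrefl (prec T)" using prec_iff by (auto intro: irreflI)
  show "trans (prec T)"
  proof (rule transI)
    fix a b c assume "(a, b) \<in> prec T" "(b, c) \<in> prec T"
    then show "(a, c) \<in> prec T"
      unfolding prec_iff using initial_seg_trans initial_seg_subset by (metis subset_antisym)
  qed
  show "\<exists>z. is_root T z" using vert_empty_root by blast
qed (use pred_well_order nodes_T in auto)

lemma root: "root_of T = vert {}"
  unfolding root_of_def
proof (rule the_equality)
  show "z = vert {}" if "is_root T z" for z
  proof (rule ccontr)
    assume "z \<noteq> vert {}"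
    then have "(z, vert {}) \<in> prec T" "(vert {}, z) \<in> prec T"
      using that vert_empty_root unfolding is_root_def by metis+
    then show False using tree unfolding is_tree_def by (meson irreflD transD)
  qed
qed (rule vert_empty_root)

lemma prec_insert:
  assumes p: "p \<in> vertices r" and x: "x \<in> extensions (ran p)"
  shows "(p, vert (insert x (ran p))) \<in> prec T"
proof -
  have b: "insert x (ran p) \<in> bounded_paths" by (rule bounded_paths_insert[OF ran_bounded_path[OF p] x])
  have "ran p \<subseteq> Field r" by (rule bounded_path_subset[OF ran_bounded_path[OF p]])
  then have "iseg (ran p) (insert x (ran p))" using initial_seg_insert x by blast
  moreover have "x \<notin> ran p" by (rule extensions_not_mem[OF x])
  ultimately show ?thesis unfolding prec_iff ran_vert[OF b] using p vert_mem[OF b] by blast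
qed

lemma succs_eq:
  assumes p: "p \<in> vertices r"
  shows "succs T p = (\<lambda>x. vert (insert x (ran p))) ` extensions (ran p)"
proof -
  have bp: "ran p \<in> bounded_paths" by (rule ran_bounded_path[OF p])
  \<comment> \<open>Provides the proper extension of \<open>p\<close> that \<open>succs_iff\<close>
    requires.\<close>
  obtain x0 where "x0 \<in> extensions (ran p)" using extensions_nonempty[OF bp] by blast
  note iff = succs_iff[OF tree prec_insert[OF p this]]
  show ?thesis
  proof
    show "succs T p \<subseteq> (\<lambda>x. vert (insert x (ran p))) ` extensions (ran p)"
    proof
      fix q assume "q \<in> succs T p"
      then have q: "(p, q) \<in> prec T" "\<And>s. (p, s) \<in> prec T \<Longrightarrow> (s, q) \<notin> prec T" unfolding iff by auto
      have qv: "q \<in> vertices r" using q(1) prec_iff by blast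
      obtain x where x: "x \<in> extensions (ran p)" "iseg (insert x (ran p)) (ran q)"
        using initial_seg_next[OF bounded_is_path[OF ran_bounded_path[OF qv]], of "ran p"] q(1)
        unfolding prec_iff by blast
      have b: "insert x (ran p) \<in> bounded_paths" by (rule bounded_paths_insert[OF bp x(1)])
      have "(vert (insert x (ran p)), q) \<notin> prec T" using q(2) prec_insert[OF p x(1)] by blast
      then have "insert x (ran p) = ran q"
        unfolding prec_iff ran_vert[OF b] using vert_mem[OF b] qv x(2) by blast
      then have "q = vert (insert x (ran p))" using vert_ran[OF qv] by simp
      then show "q \<in> (\<lambda>x. vert (insert x (ran p))) ` extensions (ran p)" using x(1) by blast
    qed
    show "(\<lambda>x. vert (insert x (ran p))) ` extensions (ran p) \<subseteq> succs T p"
    proof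
      fix q assume "q \<in> (\<lambda>x. vert (insert x (ran p))) ` extensions (ran p)"
      then obtain x where x: "x \<in> extensions (ran p)" "q = vert (insert x (ran p))" by blast
      have b: "insert x (ran p) \<in> bounded_paths" by (rule bounded_paths_insert[OF bp x(1)])
      have "\<not> ((p, s) \<in> prec T \<and> (s, q) \<in> prec T)" for s
      proof
        assume "(p, s) \<in> prec T \<and> (s, q) \<in> prec T"
        then have "ran p \<subseteq> ran s" "ran p \<noteq> ran s" "ran s \<subseteq> insert x (ran p)" "ran s \<noteq> insert x (ran p)"
          unfolding prec_iff x(2) ran_vert[OF b] using initial_seg_subset by blast+
        then show False by blast
      qed
      then show "q \<in> succs T p" unfolding iff using prec_insert[OF p x(1)] x(2) by blast
    qed
  qed
qed

lemma insert_vert_inj: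
  assumes "p \<in> vertices r"
  shows "inj_on (\<lambda>x. vert (insert x (ran p))) (extensions (ran p))"
proof (rule inj_onI)
  fix x y assume xy: "x \<in> extensions (ran p)" "y \<in> extensions (ran p)" "vert (insert x (ran p)) = vert (insert y (ran p))"
  then have "insert x (ran p) = insert y (ran p)"
    using vert_inj bounded_paths_insert[OF ran_bounded_path[OF assms]] by blast
  then show "x = y" using extensions_not_mem[OF xy(1)] by blast
qed

text \<open>Domains are ordinals over \<open>'a\<close>, whereas orders of nodes are ordinals over
  the vertex type. The definition of \<open>sord\<close> by domains and that of \<open>succs\<close>
  by orders are therefore brought together through ranges: one more index means one more point, and
  the new point is the value at \<alpha>.\<close>

lemma dom_succ_iff:
  assumes p: "p \<in> vertices r" and q: "q \<in> vertices r" and dom: "dom p = {..<\<alpha>}"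
  shows "dom q = {..\<alpha>} \<and> p \<subseteq>\<^sub>m q \<longleftrightarrow> (\<exists>x\<in>extensions (ran p). ran q = insert x (ran p))"
    and "x \<in> extensions (ran p) \<Longrightarrow> ran q = insert x (ran p) \<Longrightarrow> the (q \<alpha>) = x"
proof -
  note p' = vertexD[OF p] and q' = vertexD[OF q]
  have inj: "i = j" if "i \<in> dom q" "j \<in> dom q" "the (q i) = the (q j)" for i j
    using q'(4) that irr by (metis linorder_neqE)
  have conv: "dom q = {..\<alpha>} \<and> p \<subseteq>\<^sub>m q \<and> the (q \<alpha>) = x"
    if x: "x \<in> extensions (ran p)" "ran q = insert x (ran p)" for x
  proof -
    have xn: "x \<notin> ran p" by (rule extensions_not_mem[OF x(1)])
    have "iseg (ran p) (ran q)"
      unfolding x(2) by (rule initial_seg_insert[OF p'(6) x(1)])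
    then have le: "p \<subseteq>\<^sub>m q" using map_le_iff_initial_seg[OF q p] by blast
    have eq: "q j = p j" "j \<in> dom q" if "j < \<alpha>" for j
      using le map_le_implies_dom_le[OF le] that dom unfolding map_le_def by auto
    have val: "the (q j) \<in> ran p" if "j < \<alpha>" for j
      using p'(3)[of j] that dom eq(1)[OF that] by simp
    have "the (q i) = x" if i: "i \<in> dom q" "\<not> i < \<alpha>" for i
    proof (rule ccontr)
      assume "the (q i) \<noteq> x"
      then have "the (q i) \<in> ran p" using q'(3)[OF i(1)] x(2) by blast
      then obtain j where j: "j \<in> dom p" "the (q i) = the (p j)" using ran_mem[of "the (q i)" p] by blast
      then have "j < \<alpha>" using dom by blast
      then have "i = j" using inj[OF i(1) eq(2)] eq(1) j(2) by simp
      then show False using i(2) \<open>j < \<alpha>\<close> by blast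
    qed
    note top = this
    obtain i where i: "i \<in> dom q" "x = the (q i)" using ran_mem[of x q] x(2) by blast
    have "\<not> i < \<alpha>" using val[of i] i(2) xn by blast
    have "\<alpha> \<in> dom q"
      using q'(2)[OF i(1), of \<alpha>] \<open>\<not> i < \<alpha>\<close> i(1) by (metis linorder_neqE)
    then have a: "the (q \<alpha>) = x" using top by blast
    have "k = \<alpha>" if "k \<in> dom q" "\<not> k < \<alpha>" for k
      using inj[OF that(1) \<open>\<alpha> \<in> dom q\<close>] top[OF that] a by simp
    then have "dom q = {..\<alpha>}"
      using eq(2) \<open>\<alpha> \<in> dom q\<close> by (metis atMost_iff le_less set_eqI)
    then show ?thesis using le a by blast
  qed
  show "dom q = {..\<alpha>} \<and> p \<subseteq>\<^sub>m q \<longleftrightarrow> (\<exists>x\<in>extensions (ran p). ran q = insert x (ran p))"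
  proof
    assume *: "dom q = {..\<alpha>} \<and> p \<subseteq>\<^sub>m q"
    have seg: "iseg (ran p) (ran q)" using * map_le_iff_initial_seg[OF q p] by blast
    have eq: "q j = p j" if "j < \<alpha>" for j
      using * that dom unfolding map_le_def by auto
    have sub: "ran q \<subseteq> insert (the (q \<alpha>)) (ran p)"
    proof
      fix y assume "y \<in> ran q"
      then obtain i where i: "i \<in> dom q" "y = the (q i)" using ran_mem[of y q] by blast
      then have "i = \<alpha> \<or> i < \<alpha>" using * by auto
      then show "y \<in> insert (the (q \<alpha>)) (ran p)"
        using i(2) eq[of i] p'(3)[of i] dom by auto
    qed
    have "the (q \<alpha>) \<notin> ran p"
    proof
      assume "the (q \<alpha>) \<in> ran p"
      then obtain j where j: "j \<in> dom p" "the (q \<alpha>) = the (p j)" using ran_mem[of "the (q \<alpha>)" p] by blast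
      then have "j < \<alpha>" using dom by blast
      then have "\<alpha> = j" using inj[of \<alpha> j] j(2) eq[of j] * by auto
      then show False using \<open>j < \<alpha>\<close> by blast
    qed
    moreover have "the (q \<alpha>) \<in> ran q" using q'(3)[of \<alpha>] * by auto
    ultimately have "ran p \<noteq> ran q" by blast
    then obtain x where "x \<in> ran q" "x \<in> extensions (ran p)"
      using initial_seg_next[OF bounded_is_path[OF ran_bounded_path[OF q]] seg] by blast
    moreover have "x \<notin> ran p" using extensions_not_mem[OF calculation(2)] .
    ultimately show "\<exists>x\<in>extensions (ran p). ran q = insert x (ran p)"
      using sub initial_seg_subset[OF seg] by blast
  next
    assume "\<exists>x\<in>extensions (ran p). ran q = insert x (ran p)"
    then show "dom q = {..\<alpha>} \<and> p \<subseteq>\<^sub>m q" using conv by blast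
  qed
  show "the (q \<alpha>) = x" if "x \<in> extensions (ran p)" "ran q = insert x (ran p)"
    using conv[OF that] by blast
qed

lemma sord_eq:
  assumes p: "p \<in> vertices r"
  shows "sord T p = dir_image (Restr r (extensions (ran p))) (\<lambda>x. vert (insert x (ran p)))"
proof -
  obtain \<alpha> where dom: "dom p = {..<\<alpha>}" using vertexD(1)[OF p] by blast
  have \<alpha>: "{..<\<alpha>} = {..<\<beta>} \<longleftrightarrow> \<alpha> = \<beta>" for \<beta> using lessThan_eq_iff by blast
  have b: "insert x (ran p) \<in> bounded_paths" if "x \<in> extensions (ran p)" for x
    by (rule bounded_paths_insert[OF ran_bounded_path[OF p] that])
  have iff: "q \<in> vertices r \<and> dom q = {..\<alpha>} \<and> p \<subseteq>\<^sub>m q \<longleftrightarrow>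
      (\<exists>x\<in>extensions (ran p). q = vert (insert x (ran p)))" for q
    using dom_succ_iff(1)[OF p _ dom, of q] vert_mem[OF b] ran_vert[OF b] vert_ran[of q] by metis
  have val: "the (vert (insert x (ran p)) \<alpha>) = x" if "x \<in> extensions (ran p)" for x
    by (rule dom_succ_iff(2)[OF p vert_mem[OF b[OF that]] dom that ran_vert[OF b[OF that]]])
  have "(q, q') \<in> sord T p \<longleftrightarrow>
      (q, q') \<in> dir_image (Restr r (extensions (ran p))) (\<lambda>x. vert (insert x (ran p)))" for q q'
  proof -
    have "(q, q') \<in> sord T p \<longleftrightarrow> (q \<in> vertices r \<and> dom q = {..\<alpha>} \<and> p \<subseteq>\<^sub>m q) \<and>
       (q' \<in> vertices r \<and> dom q' = {..\<alpha>} \<and> p \<subseteq>\<^sub>m q') \<and> (the (q \<alpha>), the (q' \<alpha>)) \<in> r"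
      unfolding order_tree_def bitree.simps split_conv mem_Collect_eq dom \<alpha> by blast
    also have "\<dots> \<longleftrightarrow> (\<exists>x\<in>extensions (ran p). \<exists>y\<in>extensions (ran p).
        q = vert (insert x (ran p)) \<and> q' = vert (insert y (ran p)) \<and> (x, y) \<in> r)"
      unfolding iff using val by metis
    also have "\<dots> \<longleftrightarrow> (q, q') \<in> dir_image (Restr r (extensions (ran p))) (\<lambda>x. vert (insert x (ran p)))"
      unfolding dir_image_def by blast
    finally show ?thesis .
  qed
  then show ?thesis by auto
qed

lemma sord_iff:
  assumes p: "p \<in> vertices r" and xy: "x \<in> extensions (ran p)" "y \<in> extensions (ran p)"
  shows "(vert (insert x (ran p)), vert (insert y (ran p))) \<in> sord T p \<longleftrightarrow> (x, y) \<in> r"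
  unfolding sord_eq[OF p] dir_image_def
  using insert_vert_inj[OF p] xy unfolding inj_on_def by blast

lemma bi_ordered_T: "bi_ordered T"
  unfolding bi_ordered_def nodes_T
proof
  fix p assume p: "p \<in> vertices r"
  have F: "Field (Restr r (extensions (ran p))) = extensions (ran p)"
    by (rule Field_Restr_linear(1)[OF linear extensions_subset])
  have "Linear_order (sord T p)"
    unfolding sord_eq[OF p]
    by (rule Linear_order_dir_image[OF Linear_order_Restr[OF linear]]) (use insert_vert_inj[OF p] F in simp)
  moreover have "Field (sord T p) = succs T p"
    unfolding sord_eq[OF p] succs_eq[OF p] dir_image_Field F ..
  ultimately show "linear_order_on (succs T p) (sord T p)" by simp
qed

lemma root_succs_iso: "\<exists>f. iso (sord T (root_of T)) r f"
proof -
  have p: "vert {} \<in> vertices r" and ran: "ran (vert {}) = {}"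
    using vert_mem ran_vert empty_path by auto
  define u where "u x = vert {x}" for x
  have S: "sord T (vert {}) = dir_image r u"
    unfolding sord_eq[OF p] ran extensions_empty u_def by (simp add: Restr_Field)
  have inj: "inj_on u (Field r)"
    using insert_vert_inj[OF p] unfolding u_def ran extensions_empty .
  define f where "f = inv_into (Field r) u"
  have fu: "f (u x) = x" if "x \<in> Field r" for x unfolding f_def using inj that by (rule inv_into_f_f)
  have "bij_betw f (Field (dir_image r u)) (Field r)"
    unfolding dir_image_Field f_def using inj by (intro bij_betw_inv_into inj_on_imp_bij_betw)
  moreover have "(a, b) \<in> dir_image r u \<longleftrightarrow> (f a, f b) \<in> r"
    if ab: "a \<in> Field (dir_image r u)" "b \<in> Field (dir_image r u)" for a b
  proof -
    obtain x y where xy: "x \<in> Field r" "a = u x" "y \<in> Field r" "b = u y"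
      using ab unfolding dir_image_Field by blast
    have "(u x, u y) \<in> dir_image r u \<longleftrightarrow> (x, y) \<in> r"
    proof
      assume "(u x, u y) \<in> dir_image r u"
      then obtain c d where cd: "(c, d) \<in> r" "u x = u c" "u y = u d" unfolding dir_image_def by blast
      then have "c \<in> Field r" "d \<in> Field r" by (auto intro: FieldI1 FieldI2)
      then have "x = c" "y = d" using inj_onD[OF inj] cd xy(1,3) by blast+
      then show "(x, y) \<in> r" using cd(1) by simp
    qed (auto simp: dir_image_def)
    then show ?thesis using xy fu by simp
  qed
  ultimately show ?thesis unfolding root S iso_iff2 by blast
qed

lemma reproductive_T: "reproductive T"
  unfolding reproductive_def nodes_T
proof
  fix p assume p: "p \<in> vertices r"
  define A where "A = ran p"
  have A: "A \<in> bounded_paths" unfolding A_def by (rule ran_bounded_path[OF p])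
  obtain g where g: "bij_betw g (Field r) (extensions A)"
    "\<And>x y. x \<in> Field r \<Longrightarrow> y \<in> Field r \<Longrightarrow> x \<sqsubset> y \<longleftrightarrow> g x \<sqsubset> g y"
    using extensions_iso[OF A] by blast
  have gF: "g x \<in> Field r" if "x \<in> Field r" for x
    using bij_betw_apply[OF g(1) that] extensions_subset by blast
  have g_rel: "(g x, g y) \<in> r \<longleftrightarrow> (x, y) \<in> r" if "x \<in> Field r" "y \<in> Field r" for x y
    using rel_iff_not_strict[OF linear that] rel_iff_not_strict[OF linear gF gF, OF that] g(2)[OF that(2,1)] by blast
  have sb: "shift A g S \<in> bounded_paths" if "S \<in> bounded_paths" for S
    by (rule bounded_shift[OF A g that])
  define f :: "'a vertex \<Rightarrow> 'a vertex" where "f q = vert (shift A g (ran q))" for q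
  have f_mem: "f q \<in> vertices r" and ran_f: "ran (f q) = shift A g (ran q)" if "q \<in> vertices r" for q
    unfolding f_def using vert_mem ran_vert sb ran_bounded_path that by auto
  have cone: "cone T p = {q\<in>vertices r. iseg A (ran q)}"
    unfolding cone_def nodes_T prec_iff A_def using p ran_inj by auto
  have b1: "bij_betw ran (vertices r) bounded_paths"
    unfolding bij_betw_def inj_on_def using ran_inj ran_vertices by blast
  have b2: "bij_betw vert {B\<in>bounded_paths. iseg A B} {q\<in>vertices r. iseg A (ran q)}"
    unfolding bij_betw_def
  proof
    show "inj_on vert {B\<in>bounded_paths. iseg A B}" unfolding inj_on_def using vert_inj by blast
    show "vert ` {B\<in>bounded_paths. iseg A B} = {q\<in>vertices r. iseg A (ran q)}"
    proof
      show "vert ` {B\<in>bounded_paths. iseg A B} \<subseteq> {q\<in>vertices r. iseg A (ran q)}"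
        using vert_mem ran_vert by auto
      show "{q\<in>vertices r. iseg A (ran q)} \<subseteq> vert ` {B\<in>bounded_paths. iseg A B}"
      proof
        fix q assume "q \<in> {q\<in>vertices r. iseg A (ran q)}"
        then show "q \<in> vert ` {B\<in>bounded_paths. iseg A B}"
          using vert_ran[of q] ran_bounded_path[of q] by (intro image_eqI[of _ _ "ran q"]) auto
      qed
    qed
  qed
  have "bij_betw (vert \<circ> (shift A g \<circ> ran)) (vertices r) (cone T p)"
    unfolding cone by (rule bij_betw_trans[OF bij_betw_trans[OF b1 bij_shift_bounded[OF A g]] b2])
  moreover have "vert \<circ> (shift A g \<circ> ran) = f" unfolding f_def by auto
  ultimately have bij: "bij_betw f (vertices r) (cone T p)" by simp
  have RX: "ran q \<subseteq> Field r" if "q \<in> vertices r" for q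
    using bounded_path_subset ran_bounded_path that by blast
  have prec: "(q, q') \<in> prec T \<longleftrightarrow> (f q, f q') \<in> prec T" if qq: "q \<in> vertices r" "q' \<in> vertices r" for q q'
    unfolding prec_iff ran_f[OF qq(1)] ran_f[OF qq(2)]
    using initial_seg_shift_iff[OF A g RX[OF qq(1)] RX[OF qq(2)]] inj_shift[OF A g RX[OF qq(1)] RX[OF qq(2)]] f_mem qq by auto
  have sord: "(a, b) \<in> sord T q \<longleftrightarrow> (f a, f b) \<in> sord T (f q)"
    if q: "q \<in> vertices r" and ab: "a \<in> succs T q" "b \<in> succs T q" for q a b
  proof -
    obtain x y where x: "x \<in> extensions (ran q)" "a = vert (insert x (ran q))"
      and y: "y \<in> extensions (ran q)" "b = vert (insert y (ran q))"
      using ab unfolding succs_eq[OF q] by blast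
    have shift_insert: "shift A g (insert z S) = insert (g z) (shift A g S)" for z S
      unfolding shift_def by blast
    have f_insert: "f (vert (insert z (ran q))) = vert (insert (g z) (ran (f q)))" if z: "z \<in> extensions (ran q)" for z
      unfolding ran_f[OF q] shift_insert[symmetric]
      unfolding f_def ran_vert[OF bounded_paths_insert[OF ran_bounded_path[OF q] z]] ..
    \<comment> \<open>The shifted range with \<open>g z\<close> added is again a path, and all its
      other points lie below \<open>g z\<close>.\<close>
    have ext: "g z \<in> extensions (ran (f q))" if z: "z \<in> extensions (ran q)" for z
    proof -
      have b: "insert z (ran q) \<in> bounded_paths" by (rule bounded_paths_insert[OF ran_bounded_path[OF q] z])
      have zF: "z \<in> Field r" using z extensions_subset by blast
      have "y \<sqsubset> g z" if y: "y \<in> shift A g (ran q)" for y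
      proof (cases "y \<in> A")
        case True
        then show ?thesis using g_above[OF A g zF] by blast
      next
        case False
        then obtain s where "s \<in> ran q" "y = g s" using y unfolding shift_def by blast
        then show ?thesis using extensions_above[OF z _ RX[OF q]] g(2)[OF _ zF] RX[OF q] by blast
      qed
      then have "shift A g (ran q) \<subseteq> below lt (insert (g z) (shift A g (ran q))) (g z)"
        unfolding below_def by blast
      moreover have "g z \<in> extensions (below lt (insert (g z) (shift A g (ran q))) (g z))"
        using path_extensions[OF bounded_is_path[OF sb[OF b]]] unfolding shift_insert by blast
      ultimately show ?thesis unfolding ran_f[OF q] using extensions_antimono by blast
    qed
    have "(f a, f b) \<in> sord T (f q) \<longleftrightarrow> (g x, g y) \<in> r"
      unfolding x(2) y(2) f_insert[OF x(1)] f_insert[OF y(1)]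
      by (rule sord_iff[OF f_mem[OF q] ext[OF x(1)] ext[OF y(1)]])
    also have "\<dots> \<longleftrightarrow> (x, y) \<in> r" using g_rel x(1) y(1) extensions_subset by blast
    also have "\<dots> \<longleftrightarrow> (a, b) \<in> sord T q" unfolding x(2) y(2) using sord_iff[OF q x(1) y(1)] by blast
    finally show ?thesis by blast
  qed
  show "\<exists>f. bij_betw f (vertices r) (cone T p) \<and>
        (\<forall>q\<in>vertices r. \<forall>q'\<in>vertices r. (q, q') \<in> prec T \<longleftrightarrow> (f q, f q') \<in> prec T) \<and>
        (\<forall>q\<in>vertices r. \<forall>a\<in>succs T q. \<forall>b\<in>succs T q.
           (a, b) \<in> sord T q \<longleftrightarrow> (f a, f b) \<in> sord T (f q))"
    by (rule exI[of _ f]) (use bij prec sord in blast)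
qed


section \<open>Branches as cofinal paths\<close>

definition trace :: "'a vertex set \<Rightarrow> 'a set" where
  "trace x = \<Union>(ran ` x)"

definition branch :: "'a set \<Rightarrow> 'a vertex set" where
  "branch B = {p\<in>vertices r. iseg (ran p) B}"

lemma branches_iff:
  "x \<in> branches T \<longleftrightarrow>
    (x \<subseteq> vertices r \<and> (\<forall>p\<in>x. \<forall>q\<in>x. iseg (ran p) (ran q) \<or> iseg (ran q) (ran p))) \<and>
    \<not> (\<exists>y. (y \<subseteq> vertices r \<and> (\<forall>p\<in>y. \<forall>q\<in>y. iseg (ran p) (ran q) \<or> iseg (ran q) (ran p))) \<and> x \<subset> y)"
proof -
  have chain: "pred_on.chain (nodes T) (\<lambda>p q. (p, q) \<in> prec T) y \<longleftrightarrow>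
    y \<subseteq> vertices r \<and> (\<forall>p\<in>y. \<forall>q\<in>y. iseg (ran p) (ran q) \<or> iseg (ran q) (ran p))" for y
  proof -
    have "(\<lambda>p q. (p, q) \<in> prec T)\<^sup>=\<^sup>= p q \<longleftrightarrow> iseg (ran p) (ran q)" if "p \<in> vertices r" "q \<in> vertices r" for p q
      using that ran_inj[OF that] by (auto simp: prec_iff)
    then show ?thesis unfolding pred_on.chain_def nodes_T by blast
  qed
  show ?thesis unfolding branches_def pred_on.maxchain_def chain by blast
qed

text \<open>A bounded trace would have an extension, giving a vertex above the whole branch against
  maximality. The vertices that are initial segments of the trace form a chain containing the
  branch, so by maximality they are the branch.\<close>

lemma trace_cofinal:
  assumes x: "x \<in> branches T"
  shows "trace x \<in> cofinal_paths" "x = branch (trace x)"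
proof -
  have xv: "x \<subseteq> vertices r" and chain: "\<And>p q. p \<in> x \<Longrightarrow> q \<in> x \<Longrightarrow> iseg (ran p) (ran q) \<or> iseg (ran q) (ran p)"
    and max: "\<And>y. y \<subseteq> vertices r \<Longrightarrow> (\<And>p q. p \<in> y \<Longrightarrow> q \<in> y \<Longrightarrow> iseg (ran p) (ran q) \<or> iseg (ran q) (ran p)) \<Longrightarrow> \<not> x \<subset> y"
    using x unfolding branches_iff by blast+
  have pc: "is_path A" if "A \<in> ran ` x" for A
    using that xv ran_bounded_path bounded_is_path by blast
  have cc: "iseg A B \<or> iseg B A" if "A \<in> ran ` x" "B \<in> ran ` x" for A B
    using that chain by blast
  have B: "is_path (trace x)" and init: "iseg A (trace x)" if "A \<in> ran ` x" for A
    using path_Union[OF pc cc] that unfolding trace_def by blast+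
  have path: "is_path (trace x)"
    using path_Union(1)[OF pc cc] unfolding trace_def by blast
  show "trace x \<in> cofinal_paths"
  proof (rule ccontr)
    assume "trace x \<notin> cofinal_paths"
    then have b: "trace x \<in> bounded_paths" using path_cases[OF path] by blast
    obtain y where y: "y \<in> extensions (trace x)" using extensions_nonempty[OF b] by blast
    have yb: "insert y (trace x) \<in> bounded_paths" by (rule bounded_paths_insert[OF b y])
    define q where "q = vert (insert y (trace x))"
    have q: "q \<in> vertices r" "ran q = insert y (trace x)" unfolding q_def using vert_mem[OF yb] ran_vert[OF yb] by auto
    have "iseg (ran p) (ran q)" if "p \<in> x" for p
      unfolding q(2) using initial_seg_trans[OF init initial_seg_insert[OF bounded_path_subset[OF b] y]] that by blast
    then have "\<not> x \<subset> insert q x"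
      using chain q(1) xv by (intro max) auto
    then have "q \<in> x" by blast
    then have "y \<in> trace x" using q(2) unfolding trace_def by blast
    then show False using extensions_not_mem[OF y] by blast
  qed
  have "x \<subseteq> branch (trace x)" unfolding branch_def using init xv by blast
  moreover have "\<not> x \<subset> branch (trace x)"
  proof (rule max)
    show "iseg (ran p) (ran q) \<or> iseg (ran q) (ran p)" if "p \<in> branch (trace x)" "q \<in> branch (trace x)" for p q
      using initial_segs_comparable[OF _ _ path_subset[OF path]] that unfolding branch_def by blast
  qed (auto simp: branch_def)
  ultimately show "x = branch (trace x)" by blast
qed

lemma trace_branch:
  assumes B: "B \<in> cofinal_paths"
  shows "trace (branch B) = B"
proof -
  have pB: "is_path B" using B unfolding cofinal_paths_def by blast
  have "b \<in> trace (branch B)" if b: "b \<in> B" for b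
  proof -
    have "b \<in> Field r" using cofinal_path_subset[OF B] b by blast
    then obtain c where c: "c \<in> B" "b \<sqsubset> c" using B unfolding cofinal_paths_def by blast
    have bb: "below lt B c \<in> bounded_paths" by (rule below_bounded[OF pB c(1)])
    have "vert (below lt B c) \<in> branch B"
      unfolding branch_def using vert_mem[OF bb] ran_vert[OF bb] initial_seg_below by auto
    then have "below lt B c \<subseteq> trace (branch B)"
      unfolding trace_def using ran_vert[OF bb] by blast
    then show ?thesis using b c(2) unfolding below_def by blast
  qed
  moreover have "trace (branch B) \<subseteq> B"
    unfolding trace_def branch_def using initial_seg_subset by blast
  ultimately show ?thesis by blast
qed

text \<open>A vertex \<open>s\<close> comparable with all of \<open>branch B\<close> but outside it
  would contain every proper initial segment of \<open>B\<close>, hence \<open>B\<close> itself; but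
  a subset of a bounded path is bounded.\<close>

lemma branch_mem:
  assumes B: "B \<in> cofinal_paths"
  shows "branch B \<in> branches T"
proof -
  have pB: "is_path B" and BX: "B \<subseteq> Field r" using B cofinal_path_subset unfolding cofinal_paths_def by blast+
  have "\<not> branch B \<subset> y"
    if y: "y \<subseteq> vertices r" "\<forall>p\<in>y. \<forall>q\<in>y. iseg (ran p) (ran q) \<or> iseg (ran q) (ran p)" for y
  proof
    assume sub: "branch B \<subset> y"
    then obtain s where s: "s \<in> y" "s \<notin> branch B" by blast
    have sv: "s \<in> vertices r" using s(1) y(1) by blast
    have "b \<in> ran s" if b: "b \<in> B" for b
    proof -
      obtain c where c: "c \<in> B" "b \<sqsubset> c" using B b BX unfolding cofinal_paths_def by blast
      have bb: "below lt B c \<in> bounded_paths" by (rule below_bounded[OF pB c(1)])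
      define p where "p = vert (below lt B c)"
      have p: "p \<in> branch B" "ran p = below lt B c"
        unfolding branch_def p_def using vert_mem[OF bb] ran_vert[OF bb] initial_seg_below by auto
      then have "iseg (ran p) (ran s) \<or> iseg (ran s) (ran p)" using y(2) s(1) sub by blast
      moreover have "\<not> iseg (ran s) (ran p)"
        using initial_seg_trans p s(2) sv unfolding branch_def by blast
      ultimately have "below lt B c \<subseteq> ran s" using initial_seg_subset p(2) by metis
      then show ?thesis using b c(2) unfolding below_def by blast
    qed
    then have "B \<in> bounded_paths" using bounded_paths_mono[OF ran_bounded_path[OF sv]] by blast
    then show False using B unfolding bounded_paths_def cofinal_paths_def by blast
  qed
  moreover have "iseg (ran p) (ran q) \<or> iseg (ran q) (ran p)" if "p \<in> branch B" "q \<in> branch B" for p q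
    using initial_segs_comparable[OF _ _ BX] that unfolding branch_def by blast
  moreover have "branch B \<subseteq> vertices r" unfolding branch_def by blast
  ultimately show ?thesis unfolding branches_iff by blast
qed

lemma bij_trace: "bij_betw trace (branches T) cofinal_paths"
  unfolding bij_betw_def
proof
  show "inj_on trace (branches T)"
    unfolding inj_on_def using trace_cofinal(2) by metis
  show "trace ` branches T = cofinal_paths"
    using trace_cofinal(1) trace_branch branch_mem by (metis image_eqI subsetI subset_antisym image_subsetI)
qed

lemma node_ord_succ:
  assumes p: "p \<in> vertices r" and x: "x \<in> extensions (ran p)"
  shows "node_ord T (vert (insert x (ran p))) = ord_succ (node_ord T p)"
proof -
  have "vert (insert x (ran p)) \<in> succs T p" unfolding succs_eq[OF p] using x by blast
  then show ?thesis unfolding succs_def by blast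
qed

lemma sord_subset:
  assumes "(a, b) \<in> sord T p" "p \<in> vertices r"
  obtains x y where "x \<in> extensions (ran p)" "y \<in> extensions (ran p)" "(x, y) \<in> r"
    "a = vert (insert x (ran p))" "b = vert (insert y (ran p))"
  using assms unfolding sord_eq[OF assms(2)] dir_image_def by blast

text \<open>The last common vertex is the common part \<open>A\<close> of the two traces below their
  first difference \<open>u\<close>. The other trace takes next a point \<open>v\<close> with
  \<open>u \<sqsubset> v\<close>, so comparing the traces amounts to comparing two successors of
  \<open>A\<close>.\<close>

lemma branch_less_iff:
  assumes x: "x \<in> branches T" and y: "y \<in> branches T"
  shows "branch_less T x y \<longleftrightarrow> lex (trace x) (trace y)"
proof
  have mem_iseg: "p \<in> vertices r" "iseg (ran p) (trace z)" if "p \<in> z" "z \<in> branches T" for p z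
    using trace_cofinal(2)[OF that(2)] that(1) unfolding branch_def by blast+
  show "lex (trace x) (trace y)" if less: "branch_less T x y"
  proof -
    obtain p a b where p: "p \<in> x" and a: "a \<in> x" and b: "b \<in> y" and ab: "a \<noteq> b" "(a, b) \<in> sord T p"
      using less unfolding branch_less_def branch_at_def by blast
    have pv: "p \<in> vertices r" by (rule mem_iseg(1)[OF p x])
    obtain u v where uv: "u \<in> extensions (ran p)" "v \<in> extensions (ran p)" "(u, v) \<in> r"
      "a = vert (insert u (ran p))" "b = vert (insert v (ran p))"
      by (rule sord_subset[OF ab(2) pv])
    have bd: "insert u (ran p) \<in> bounded_paths" "insert v (ran p) \<in> bounded_paths"
      using bounded_paths_insert[OF ran_bounded_path[OF pv]] uv by auto
    have "u \<sqsubset> v" using uv(3-5) ab(1) unfolding strict_of_def by blast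
    moreover have "trace x \<in> path_cone (insert u (ran p))"
      using trace_cofinal(1)[OF x] mem_iseg(2)[OF a x] unfolding uv(4) ran_vert[OF bd(1)] path_cone_def by blast
    moreover have "trace y \<in> path_cone (insert v (ran p))"
      using trace_cofinal(1)[OF y] mem_iseg(2)[OF b y] unfolding uv(5) ran_vert[OF bd(2)] path_cone_def by blast
    ultimately show ?thesis
      using lex_insert_cones[OF bounded_path_subset[OF ran_bounded_path[OF pv]]] uv(1) by blast
  qed
  show "branch_less T x y" if less: "lex (trace x) (trace y)"
  proof -
    define B where "B = trace x"
    define C where "C = trace y"
    have BC: "B \<in> cofinal_paths" "C \<in> cofinal_paths" "is_path B" "is_path C"
      using trace_cofinal(1)[OF x] trace_cofinal(1)[OF y] unfolding B_def C_def cofinal_paths_def by auto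
    have xB: "x = branch B" and yC: "y = branch C" unfolding B_def C_def using trace_cofinal(2) x y by auto
    obtain u where u: "u \<in> B" "u \<notin> C" "\<And>z. z \<sqsubset> u \<Longrightarrow> z \<in> B \<longleftrightarrow> z \<in> C"
      using less unfolding lex_def B_def C_def by blast
    define A where "A = below lt B u"
    have AC: "A = below lt C u" unfolding A_def below_def using u(3) by blast
    have A: "A \<in> bounded_paths" unfolding A_def by (rule below_bounded[OF BC(3) u(1)])
    have uA: "u \<in> extensions A" unfolding A_def by (rule path_extensions[OF BC(3) u(1)])
    have "A \<noteq> C" using A BC(2) unfolding bounded_paths_def cofinal_paths_def by blast
    moreover have segC: "iseg A C" unfolding AC by (rule initial_seg_below)
    ultimately obtain v where v: "v \<in> C" "v \<in> extensions A" "iseg (insert v A) C"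
      using initial_seg_next[OF BC(4)] by blast
    have segB: "iseg A B" unfolding A_def by (rule initial_seg_below)
    have segB': "iseg (insert u A) B"
      unfolding A_def by (rule initial_seg_insert_below[OF u(1) path_subset[OF BC(3)]])
    have "v \<noteq> u" using v(1) u(2) by blast
    moreover have "\<not> v \<sqsubset> u" using extensions_not_mem[OF v(2)] v(1) unfolding AC below_def by blast
    ultimately have uv: "u \<sqsubset> v" using total uA v(2) extensions_subset by blast
    have bd: "insert u A \<in> bounded_paths" "insert v A \<in> bounded_paths" using bounded_paths_insert[OF A] uA v(2) by auto
    define p where "p = vert A"
    have p: "p \<in> vertices r" "ran p = A" unfolding p_def using vert_mem[OF A] ran_vert[OF A] by auto
    have "p \<in> x" "p \<in> y" unfolding xB yC branch_def using p segB segC by auto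
    moreover have "vert (insert u A) \<in> x" "vert (insert v A) \<in> y"
      unfolding xB yC branch_def using vert_mem bd ran_vert segB' v(3) by auto
    moreover have "node_ord T (vert (insert u A)) = ord_succ (node_ord T p)"
      "node_ord T (vert (insert v A)) = ord_succ (node_ord T p)"
      using node_ord_succ[OF p(1)] uA v(2) unfolding p(2) by auto
    moreover have "vert (insert u A) \<noteq> vert (insert v A)"
    proof
      assume "vert (insert u A) = vert (insert v A)"
      then have "insert u A = insert v A" by (rule vert_inj[OF bd])
      then show False using \<open>v \<noteq> u\<close> extensions_not_mem[OF uA] by auto
    qed
    moreover have "(vert (insert u A), vert (insert v A)) \<in> sord T p"
      using sord_iff[OF p(1), of u v] uA v(2) uv unfolding p(2) strict_of_def by blast
    ultimately show ?thesis unfolding branch_less_def branch_at_def by blast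
  qed
qed

lemma branch_space_iff:
  "(x, y) \<in> branch_space T \<longleftrightarrow> x \<in> branches T \<and> y \<in> branches T \<and> (x = y \<or> lex (trace x) (trace y))"
  unfolding branch_space_def using branch_less_iff by auto

lemma Field_branch_space: "Field (branch_space T) = branches T"
proof
  show "Field (branch_space T) \<subseteq> branches T"
    unfolding Field_def using branch_space_iff by auto
  show "branches T \<subseteq> Field (branch_space T)"
    using FieldI1[of _ _ "branch_space T"] branch_space_iff by blast
qed

lemma trace_eq: "x \<in> branches T \<Longrightarrow> y \<in> branches T \<Longrightarrow> trace x = trace y \<Longrightarrow> x = y"
  using trace_cofinal(2) by metis

lemma strict_branch_space:
  "strict_of (branch_space T) x y \<longleftrightarrow> x \<in> branches T \<and> y \<in> branches T \<and> lex (trace x) (trace y)"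
  unfolding strict_of_def[of "branch_space T"] branch_space_iff using lex_irrefl by auto

lemma Linear_order_branch_space: "Linear_order (branch_space T)"
  unfolding order_on_defs Field_branch_space
proof (intro conjI)
  show "refl_on (branches T) (branch_space T)" using branch_space_iff by (simp add: refl_on_def)
  show "branch_space T \<subseteq> branches T \<times> branches T" using branch_space_iff by auto
  show "trans (branch_space T)"
  proof (rule transI)
    fix x y z assume "(x, y) \<in> branch_space T" "(y, z) \<in> branch_space T"
    then show "(x, z) \<in> branch_space T"
      unfolding branch_space_iff using lex_trans[of "trace x" "trace y" "trace z"] by auto
  qed
  show "antisym (branch_space T)"
  proof (rule antisymI)
    fix x y assume "(x, y) \<in> branch_space T" "(y, x) \<in> branch_space T"
    then show "x = y"
      unfolding branch_space_iff using lex_asym[of "trace x" "trace y"] by auto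
  qed
  show "total_on (branches T) (branch_space T)"
    unfolding total_on_def branch_space_iff
    using lex_total[OF trace_cofinal(1) trace_cofinal(1)] trace_eq by blast
qed

lemma branch_space_iso: "ord_iso (strict_of (branch_space T)) (branches T) lex cofinal_paths"
  unfolding ord_iso_def using bij_trace strict_branch_space by blast

lemma branch_space_hlots: "hlots (branch_space T)"
proof (rule homogeneous_imp_hlots[OF Linear_order_branch_space])
  show "homogeneous_order (Field (branch_space T)) (strict_of (branch_space T))"
    by (rule homogeneous_order_iso[OF cofinal_paths_homogeneous linear_strict_of[OF Linear_order_branch_space]])
      (use branch_space_iso Field_branch_space in simp)
qed

lemma branch_space_incomplete: "\<not> complete_order (branch_space T)"
proof
  assume complete: "complete_order (branch_space T)"
  obtain S u where S: "S \<subseteq> cofinal_paths" "S \<noteq> {}" "\<And>s. s \<in> S \<Longrightarrow> lex s u"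
    and gap: "\<And>s. s \<in> cofinal_paths \<Longrightarrow> (\<And>x. x \<in> S \<Longrightarrow> \<not> lex s x) \<Longrightarrow> \<exists>t. lex t s \<and> (\<forall>x\<in>S. lex x t)"
    by (rule cofinal_paths_gap) blast
  have u: "u \<in> cofinal_paths" using S(2,3) unfolding lex_def by blast
  have br: "strict_of (branch_space T) (branch B) (branch C) \<longleftrightarrow> lex B C"
    if "B \<in> cofinal_paths" "C \<in> cofinal_paths" for B C
    unfolding strict_branch_space using branch_mem trace_branch that by simp
  have F: "branch ` S \<subseteq> Field (branch_space T)" "branch ` S \<noteq> {}" "branch u \<in> Field (branch_space T)"
    using S(1,2) u branch_mem unfolding Field_branch_space by auto
  have "\<forall>t\<in>branch ` S. \<not> strict_of (branch_space T) (branch u) t"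
    using br[OF u] S(1,3) lex_asym by blast
  note complete_sup[OF Linear_order_branch_space complete F this]
  then obtain z where z: "z \<in> Field (branch_space T)" "\<forall>t\<in>branch ` S. \<not> strict_of (branch_space T) z t"
    "\<forall>v\<in>Field (branch_space T). (\<forall>t\<in>branch ` S. \<not> strict_of (branch_space T) v t) \<longrightarrow> \<not> strict_of (branch_space T) v z"
    by (elim bexE conjE)
  have zb: "z \<in> branches T" using z(1) Field_branch_space by blast
  define s where "s = trace z"
  have s: "s \<in> cofinal_paths" "z = branch s" unfolding s_def using trace_cofinal[OF zb] by auto
  have "\<not> lex s x" if "x \<in> S" for x using z(2) br[OF s(1)] that S(1) s(2) by blast
  then obtain t where t: "lex t s" "\<forall>x\<in>S. lex x t" using gap[OF s(1)] by blast
  have tc: "t \<in> cofinal_paths" using t(1) unfolding lex_def by blast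
  have "\<forall>w\<in>branch ` S. \<not> strict_of (branch_space T) (branch t) w"
    using br[OF tc] S(1) t(2) lex_asym by blast
  then have "\<not> strict_of (branch_space T) (branch t) z"
    using z(3) branch_mem[OF tc] unfolding Field_branch_space by blast
  then show False using br[OF tc s(1)] t(1) s(2) by blast
qed

section \<open>Orders of the vertices\<close>

abbreviation rank :: "'a set \<Rightarrow> 'a vertex ordinal" where "rank D \<equiv> node_ord T (vert D)"

lemma lessThan_rank:
  assumes "D \<in> bounded_paths"
  shows "{..<rank D} = (\<lambda>d. rank (below lt D d)) ` D"
  unfolding lessThan_node_ord[OF tree, unfolded nodes_T, OF vert_mem[OF assms]]
    pred_order_eq(2)[OF vert_mem[OF assms]] ran_vert[OF assms] image_image ..

text \<open>An increasing map cannot lower positions. If the segment below \<open>h d\<close> had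
  smaller rank than the one below \<open>d\<close>, its rank would be that of the segment below some
  \<open>e\<close> before \<open>d\<close>; yet \<open>h e\<close> lies before \<open>h d\<close>,
  against the induction hypothesis at \<open>e\<close>.\<close>

lemma rank_mono:
  assumes D: "D \<in> bounded_paths" and E: "E \<in> bounded_paths"
    and h: "\<And>d. d \<in> D \<Longrightarrow> h d \<in> E" "\<And>d e. d \<in> D \<Longrightarrow> e \<in> D \<Longrightarrow> d \<sqsubset> e \<Longrightarrow> h d \<sqsubset> h e"
  shows "rank D \<le> rank E"
proof -
  have wo: "well_ordered D"
    using bounded_is_path[OF D] bounded_path_subset[OF D] unfolding well_ordered_def is_path_def by blast
  have pD: "is_path D" and pE: "is_path E" using D E bounded_is_path by auto
  have claim: "rank (below lt D d) \<le> rank (below lt E (h d))" if "d \<in> D" for d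
    using wo that
  proof (induction d rule: well_ordered_induct)
    case (less d)
    show ?case
    proof (rule ccontr)
      assume "\<not> ?case"
      then have "rank (below lt E (h d)) \<in> {..<rank (below lt D d)}" by simp
      then obtain e where e: "e \<in> below lt D d"
        "rank (below lt E (h d)) = rank (below lt (below lt D d) e)"
        unfolding lessThan_rank[OF below_bounded[OF pD less.hyps]] by blast
      have eD: "e \<in> D" "e \<sqsubset> d" using e(1) unfolding below_def by auto
      have eq: "below lt (below lt D d) e = below lt D e"
        by (rule initial_seg_below_eq[OF initial_seg_below e(1)])
      have he: "h e \<in> below lt E (h d)"
        using h(1)[OF eD(1)] h(2)[OF eD(1) less.hyps eD(2)] unfolding below_def by blast
      have "rank (below lt (below lt E (h d)) (h e)) < rank (below lt E (h d))"
        using lessThan_rank[OF below_bounded[OF pE h(1)[OF less.hyps]]] he by blast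
      then have "rank (below lt E (h e)) < rank (below lt E (h d))"
        unfolding initial_seg_below_eq[OF initial_seg_below he] .
      then show False using less.IH[OF eD] e(2) unfolding eq by simp
    qed
  qed
  show ?thesis
  proof (rule ccontr)
    assume "\<not> ?thesis"
    then have "rank E \<in> {..<rank D}" by simp
    then obtain d where d: "d \<in> D" "rank E = rank (below lt D d)"
      unfolding lessThan_rank[OF D] by blast
    have "rank (below lt E (h d)) < rank E" using lessThan_rank[OF E] h(1)[OF d(1)] by blast
    then show False using claim[OF d(1)] d(2) by simp
  qed
qed

lemma rank_insert:
  assumes "D \<in> bounded_paths" "x \<in> extensions D"
  shows "rank D < rank (insert x D)"
  using node_ord_mono[OF tree prec_insert[OF vert_mem[OF assms(1)]]] assms(2) unfolding ran_vert[OF assms(1)] .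

lemma countable_rank:
  assumes "D \<in> bounded_paths"
  shows "countable {..<rank D}"
proof -
  have "well_ordered D"
    using bounded_is_path[OF assms] bounded_path_subset[OF assms] unfolding well_ordered_def is_path_def by blast
  then have "countable D" by (rule well_ordered_countable)
  then show ?thesis unfolding lessThan_rank[OF assms] by (rule countable_image)
qed

section \<open>The first uncountable ordinal\<close>

lemma bounded_sequence:
  obtains s :: "nat \<Rightarrow> 'a" and b where "\<And>n. s n \<sqsubset> s (Suc n)" "\<And>n. s n \<sqsubset> b"
proof -
  obtain b where b: "b \<in> Field r" using nonempty by blast
  define E where "E = {x. x \<sqsubset> b}"
  have step: "\<exists>e'\<in>E. e \<sqsubset> e'" if "e \<in> E" for e
    using dense[of e b] that unfolding E_def by blast
  obtain y where y: "y \<in> E" using no_min[OF b] unfolding E_def by blast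
  have EX: "E \<subseteq> Field r" unfolding E_def using carrier by blast
  obtain s :: "nat \<Rightarrow> 'a" where "\<And>n. s n \<in> E" "\<And>n. s n \<sqsubset> s (Suc n)" "\<And>n. y \<sqsubset> s (Suc n)"
    using increasing_sequence[of E "\<lambda>_. y"] step y EX by blast
  then show ?thesis using that[of s b] unfolding E_def by blast
qed

text \<open>Makes \<open>Omega\<close> meaningful over the vertex type. Distinct subsets of one
  bounded increasing sequence are distinct bounded paths, so there are at least as many vertices as
  sets of natural numbers.\<close>

lemma uncountable_vertex_type: "uncountable (UNIV :: 'a vertex set)"
proof
  assume "countable (UNIV :: 'a vertex set)"
  obtain s :: "nat \<Rightarrow> 'a" and b where s: "\<And>n. s n \<sqsubset> s (Suc n)" "\<And>n. s n \<sqsubset> b"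
    using bounded_sequence by blast
  have bd: "s ` N \<in> bounded_paths" for N
  proof -
    have "is_path (range s)" by (rule increasing_path) (rule s(1))
    then have "is_path (s ` N)" by (rule path_mono) blast
    moreover have "b \<in> Field r" "\<forall>y\<in>s ` N. \<not> b \<sqsubset> y" using s(2) carrier asym by blast+
    ultimately show ?thesis unfolding bounded_paths_def by blast
  qed
  have "inj s"
    using increasing_mono[where s = s, OF s(1)] irr by (metis injI linorder_neqE_nat)
  have "inj (\<lambda>N. vert (s ` N))"
  proof (rule injI)
    fix M N assume "vert (s ` M) = vert (s ` N)"
    then have "s ` M = s ` N" by (rule vert_inj[OF bd bd])
    then show "M = N" using inj_image_eq_iff[OF \<open>inj s\<close>] by simp
  qed
  moreover have "countable (range (\<lambda>N. vert (s ` N)))"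
    by (rule countable_subset[OF subset_UNIV \<open>countable UNIV\<close>])
  ultimately have "countable (UNIV :: nat set set)" by (rule countable_image_inj_on[rotated])
  then obtain f :: "nat \<Rightarrow> nat set" where "range f = UNIV"
    unfolding uncountable_def[of "UNIV :: nat set set", THEN arg_cong[where f = Not], unfolded not_not] by auto
  then show False using Cantors_theorem[of "UNIV :: nat set"] by (metis Pow_UNIV)
qed

text \<open>The initial segments of a well-order of the whole vertex type have uncountably many
  different order types, so the \<open>LEAST\<close> in the definition of \<open>Omega\<close> is
  attained.\<close>

lemma uncountable_Omega: "uncountable {..<Omega :: 'a vertex ordinal}"
proof -
  obtain w :: "'a vertex rel" where w: "Well_order w" "Field w = UNIV" using well_ordering by metis
  define pos where "pos x = order_type (Restr w (underS w x))" for x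
  have "Linear_order w" using w(1) by (simp add: well_order_on_def)
  then have "x = y \<or> strict_of w x y \<or> strict_of w y x" for x y
    using linear_strict.total[OF linear_strict_of[OF \<open>Linear_order w\<close>], of x y] w(2) by auto
  then have "inj pos"
    using order_type_segment_iff[OF w(1)] w(2) unfolding pos_def inj_on_def by (metis UNIV_I less_irrefl)
  then have "uncountable (pos ` UNIV)"
    using uncountable_vertex_type countable_image_inj_on by blast
  moreover have "{..<order_type w} = pos ` UNIV"
    using lessThan_order_type[OF w(1)] unfolding pos_def w(2) .
  ultimately have "uncountable {..<order_type w}" by simp
  then show ?thesis unfolding Omega_def by (rule LeastI)
qed

lemma less_Omega_iff: "(\<beta> :: 'a vertex ordinal) < Omega \<longleftrightarrow> countable {..<\<beta>}"
proof
  show "countable {..<\<beta>}" if "\<beta> < Omega" using not_less_Least[OF that[unfolded Omega_def]] by blast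
  show "\<beta> < Omega" if "countable {..<\<beta>}"
  proof (rule ccontr)
    assume "\<not> \<beta> < Omega"
    then have "{..<Omega} \<subseteq> {..<\<beta>}" by auto
    then show False using that uncountable_Omega countable_subset by blast
  qed
qed

section \<open>Vertices of arbitrarily large countable order, and the height of branches\<close>

lemma path_image:
  assumes S: "is_path S" and g: "\<And>x y. x \<in> Field r \<Longrightarrow> y \<in> Field r \<Longrightarrow> x \<sqsubset> y \<longleftrightarrow> g x \<sqsubset> g y"
  shows "is_path (g ` S)"
  unfolding is_path_def
proof (intro conjI allI ballI impI)
  have SX: "S \<subseteq> Field r" by (rule path_subset[OF S])
  show "\<exists>m\<in>T. \<forall>y\<in>T. \<not> y \<sqsubset> m" if T: "T \<subseteq> g ` S" "T \<noteq> {}" for T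
  proof -
    obtain U where U: "U \<subseteq> S" "T = g ` U" using T(1) by (meson subset_imageE)
    then obtain m where "m \<in> U" "\<forall>y\<in>U. \<not> y \<sqsubset> m" using path_well_ordered[OF S U(1)] T(2) by blast
    then show ?thesis using U g SX by blast
  qed
  fix d assume "d \<in> g ` S"
  then obtain x where x: "x \<in> S" "d = g x" by blast
  obtain z where z: "z \<sqsubset> x" "\<forall>y\<in>below lt S x. \<not> z \<sqsubset> y"
    using path_extensions[OF S x(1)] unfolding extensions_def by blast
  have X: "z \<in> Field r" "x \<in> Field r" using z(1) carrier by auto
  have "\<not> g z \<sqsubset> y" if y: "y \<in> below lt (g ` S) d" for y
  proof -
    obtain s where s: "s \<in> S" "y = g s" "g s \<sqsubset> g x" using y x(2) unfolding below_def by blast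
    then have "s \<in> below lt S x" using g[of s x] SX X unfolding below_def by blast
    then show ?thesis using z(2) s(1,2) g[of z s] SX X by blast
  qed
  then show "d \<in> extensions (below lt (g ` S) d)"
    unfolding extensions_def using g[OF X] z(1) x(2) by blast
qed

lemma path_blocks:
  fixes s :: "nat \<Rightarrow> 'a"
  assumes s: "\<And>n. s n \<sqsubset> s (Suc n)" and F: "\<And>n. is_path (F n)"
    and block: "\<And>n y. y \<in> F n \<Longrightarrow> s n \<sqsubset> y \<and> y \<sqsubset> s (Suc n)"
  shows "is_path (\<Union>n. F n)"
  unfolding is_path_def
proof (intro conjI allI ballI impI)
  note s_mono = increasing_mono[where s = s, OF s]
  have lt: "x \<sqsubset> s n" if "x \<in> F m" "m < n" for x m n
  proof (cases "Suc m = n")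
    case True
    then show ?thesis using block[OF that(1)] by blast
  next
    case False
    then have "s (Suc m) \<sqsubset> s n" using s_mono that(2) by simp
    then show ?thesis using block[OF that(1)] lt_trans by blast
  qed
  have F_lt: "x \<sqsubset> y" if "x \<in> F m" "y \<in> F n" "m < n" for x y m n
    using lt[OF that(1,3)] block[OF that(2)] lt_trans by blast
  show "\<exists>m\<in>S. \<forall>y\<in>S. \<not> y \<sqsubset> m" if S: "S \<subseteq> (\<Union>n. F n)" "S \<noteq> {}" for S
  proof -
    define n where "n = (LEAST n. S \<inter> F n \<noteq> {})"
    have "\<exists>n. S \<inter> F n \<noteq> {}" using S by blast
    then have ne: "S \<inter> F n \<noteq> {}" unfolding n_def by (rule LeastI_ex)
    obtain m where m: "m \<in> S \<inter> F n" "\<forall>y\<in>S \<inter> F n. \<not> y \<sqsubset> m"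
      using path_well_ordered[OF F, of "S \<inter> F n" n] ne by blast
    have "\<not> y \<sqsubset> m" if y: "y \<in> S" for y
    proof -
      obtain k where k: "y \<in> F k" using y S(1) by blast
      then have "n \<le> k" unfolding n_def using y by (intro Least_le) blast
      then show ?thesis using m y k F_lt[of m n y k] asym by (metis IntD2 IntI le_neq_implies_less)
    qed
    then show ?thesis using m(1) by blast
  qed
  fix d assume "d \<in> (\<Union>n. F n)"
  then obtain n where n: "d \<in> F n" by blast
  obtain z where z: "z \<sqsubset> d" "\<forall>y\<in>below lt (F n) d. \<not> z \<sqsubset> y"
    using path_extensions[OF F n] unfolding extensions_def by blast
  \<comment> \<open>The witness \<open>z\<close> bounds only the earlier points of the same block;
    raised above \<open>s n\<close>, it also bounds all earlier blocks.\<close>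
  obtain w where w: "z \<sqsubset> w" "s n \<sqsubset> w" "w \<sqsubset> d" using between2[OF z(1)] block[OF n] by blast
  have "\<not> w \<sqsubset> y" if y: "y \<in> below lt (\<Union>n. F n) d" for y
  proof -
    obtain k where k: "y \<in> F k" "y \<sqsubset> d" using y unfolding below_def by blast
    have "\<not> n < k" using F_lt[OF n k(1)] k(2) asym by blast
    then consider "k = n" | "k < n" by linarith
    then show ?thesis
    proof cases
      case 1
      then have "\<not> z \<sqsubset> y" using z(2) k unfolding below_def by blast
      then show ?thesis using w(1) lt_trans by blast
    next
      case 2
      then show ?thesis using lt[OF k(1)] w(2) lt_trans asym by blast
    qed
  qed
  then show "d \<in> extensions (below lt (\<Union>n. F n) d)"
    unfolding extensions_def using w(3) by blast
qed

lemma open_convex_between: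
  assumes "a \<sqsubset> b"
  shows "open_convex lt {x. a \<sqsubset> x \<and> x \<sqsubset> b}"
  unfolding open_convex_def
proof (intro conjI ballI allI impI)
  show "{x. a \<sqsubset> x \<and> x \<sqsubset> b} \<noteq> {}" using dense[OF assms] by blast
  show "z \<in> {x. a \<sqsubset> x \<and> x \<sqsubset> b}"
    if "x \<in> {x. a \<sqsubset> x \<and> x \<sqsubset> b}" "y \<in> {x. a \<sqsubset> x \<and> x \<sqsubset> b}" "x \<sqsubset> z \<and> z \<sqsubset> y" for x y z
    using that lt_trans by blast
  fix x assume x: "x \<in> {x. a \<sqsubset> x \<and> x \<sqsubset> b}"
  show "\<exists>y\<in>{x. a \<sqsubset> x \<and> x \<sqsubset> b}. y \<sqsubset> x" using x dense[of a x] lt_trans by blast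
  show "\<exists>y\<in>{x. a \<sqsubset> x \<and> x \<sqsubset> b}. x \<sqsubset> y" using x dense[of x b] lt_trans by blast
qed

lemma between_iso:
  assumes "a \<sqsubset> b"
  obtains g where "\<And>x. x \<in> Field r \<Longrightarrow> a \<sqsubset> g x \<and> g x \<sqsubset> b"
    "\<And>x y. x \<in> Field r \<Longrightarrow> y \<in> Field r \<Longrightarrow> x \<sqsubset> y \<longleftrightarrow> g x \<sqsubset> g y"
proof -
  have "{x. a \<sqsubset> x \<and> x \<sqsubset> b} \<subseteq> Field r" using carrier by blast
  then have "ord_iso (strict_of r) (Field r) (strict_of r) {x. a \<sqsubset> x \<and> x \<sqsubset> b}"
    using homogeneous open_convex_between[OF assms] by blast
  then obtain g where g: "bij_betw g (Field r) {x. a \<sqsubset> x \<and> x \<sqsubset> b}"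
    "\<And>x y. x \<in> Field r \<Longrightarrow> y \<in> Field r \<Longrightarrow> x \<sqsubset> y \<longleftrightarrow> g x \<sqsubset> g y"
    unfolding ord_iso_def by auto
  have "a \<sqsubset> g x \<and> g x \<sqsubset> b" if "x \<in> Field r" for x
    using bij_betw_apply[OF g(1) that] by simp
  then show ?thesis using that g(2) by blast
qed

text \<open>Countably many vertices, moved into successive intervals, are dominated by a single one.\<close>

lemma rank_unbounded:
  "\<beta> < Omega \<Longrightarrow> \<exists>D\<in>bounded_paths. \<beta> \<le> rank D"
proof (induction \<beta> rule: less_induct)
  case (less \<beta>)
  show ?case
  proof (cases "{..<\<beta>} = {}")
    case True
    then have "\<not> rank {} < \<beta>" by blast
    then show ?thesis using empty_path by (meson not_less)
  next
    case False
    have "countable {..<\<beta>}" using less.prems less_Omega_iff by blast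
    then obtain b :: "nat \<Rightarrow> 'a vertex ordinal" where b: "range b = {..<\<beta>}"
      using range_from_nat_into[OF False] by metis
    have "\<exists>D\<in>bounded_paths. b n \<le> rank D" for n
    proof (rule less.IH)
      show "b n < \<beta>" using b by blast
      then show "b n < Omega" using less.prems by (rule less_trans)
    qed
    then obtain D where D: "\<And>n. D n \<in> bounded_paths" "\<And>n. b n \<le> rank (D n)" by metis
    obtain s :: "nat \<Rightarrow> 'a" and c where s: "\<And>n. s n \<sqsubset> s (Suc n)" "\<And>n. s n \<sqsubset> c"
      using bounded_sequence by blast
    have "\<exists>g. (\<forall>x\<in>Field r. s n \<sqsubset> g x \<and> g x \<sqsubset> s (Suc n)) \<and>
      (\<forall>x\<in>Field r. \<forall>y\<in>Field r. x \<sqsubset> y \<longleftrightarrow> g x \<sqsubset> g y)" for n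
      by (rule between_iso[OF s(1)[of n]]) blast
    then obtain g where g: "\<And>n x. x \<in> Field r \<Longrightarrow> s n \<sqsubset> g n x \<and> g n x \<sqsubset> s (Suc n)"
      and g_lt: "\<And>n x y. x \<in> Field r \<Longrightarrow> y \<in> Field r \<Longrightarrow> x \<sqsubset> y \<longleftrightarrow> g n x \<sqsubset> g n y"
      by metis
    have DX: "D n \<subseteq> Field r" for n by (rule bounded_path_subset[OF D(1)])
    define E where "E = (\<Union>n. g n ` D n)"
    have "is_path E"
      unfolding E_def
    proof (rule path_blocks[where s = s])
      show "is_path (g n ` D n)" for n
        by (rule path_image[OF bounded_is_path[OF D(1)]]) (rule g_lt)
      show "s n \<sqsubset> y \<and> y \<sqsubset> s (Suc n)" if "y \<in> g n ` D n" for n y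
        using that g DX by blast
    qed (rule s(1))
    moreover have "c \<in> Field r" "\<forall>y\<in>E. \<not> c \<sqsubset> y"
    proof -
      show "c \<in> Field r" using s(2) carrier by blast
      show "\<forall>y\<in>E. \<not> c \<sqsubset> y"
      proof
        fix y assume "y \<in> E"
        then obtain n x where "x \<in> D n" "y = g n x" unfolding E_def by blast
        then have "y \<sqsubset> s (Suc n)" using g DX by blast
        then show "\<not> c \<sqsubset> y" using s(2) lt_trans asym by blast
      qed
    qed
    ultimately have E: "E \<in> bounded_paths" unfolding bounded_paths_def by blast
    \<comment> \<open>One further point makes the rank exceed every \<open>b n\<close> strictly. As
      the \<open>b n\<close> exhaust the ordinals below \<beta>, the rank is then at least
      \<beta>.\<close>
    obtain x where x: "x \<in> extensions E" using extensions_nonempty[OF E] by blast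
    have "b n < rank (insert x E)" for n
    proof -
      have "rank (D n) \<le> rank E"
      proof (rule rank_mono[OF D(1) E, where h = "g n"])
        show "g n d \<in> E" if "d \<in> D n" for d using that unfolding E_def by blast
        show "g n d \<sqsubset> g n e" if "d \<in> D n" "e \<in> D n" "d \<sqsubset> e" for d e
          using g_lt[of d e n] that DX by blast
      qed
      then show ?thesis using D(2)[of n] rank_insert[OF E x] by (meson le_less_trans)
    qed
    then have "\<not> rank (insert x E) < \<beta>" using b by (metis imageE lessThan_iff less_irrefl)
    then show ?thesis using bounded_paths_insert[OF E x] by (meson not_less)
  qed
qed

lemma rank_less_Omega: "D \<in> bounded_paths \<Longrightarrow> rank D < Omega"
  using countable_rank less_Omega_iff by blast

lemma height_T: "height T (nodes T) = Omega"
  unfolding height_def nodes_T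
proof (rule Least_equality)
  show "\<forall>p\<in>vertices r. node_ord T p < Omega"
    using rank_less_Omega ran_bounded_path vert_ran by metis
  show "Omega \<le> \<alpha>" if \<alpha>: "\<forall>p\<in>vertices r. node_ord T p < \<alpha>" for \<alpha>
  proof (rule ccontr)
    assume "\<not> Omega \<le> \<alpha>"
    then obtain D where "D \<in> bounded_paths" "\<alpha> \<le> rank D" using rank_unbounded by (meson not_le)
    then show False using \<alpha> vert_mem by (meson not_le)
  qed
qed

text \<open>Squeezing \<open>X\<close> into an interval turns the cofinal trace of a branch into a
  bounded path, whose rank is at least the order of every vertex of the branch. One more point makes
  the bound strict, and ranks are below \<open>Omega\<close>.\<close>

lemma Omega_bounded_T: "Omega_bounded T"
  unfolding Omega_bounded_def
proof
  fix x assume x: "x \<in> branches T"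
  define B where "B = trace x"
  have B: "is_path B" "x = branch B" unfolding B_def using trace_cofinal[OF x] unfolding cofinal_paths_def by auto
  have BX: "B \<subseteq> Field r" by (rule path_subset[OF B(1)])
  obtain s :: "nat \<Rightarrow> 'a" where "\<And>n. s n \<sqsubset> s (Suc n)" using bounded_sequence by metis
  then have ab: "s 0 \<sqsubset> s 1" by (metis One_nat_def)
  obtain g where g: "\<And>x. x \<in> Field r \<Longrightarrow> s 0 \<sqsubset> g x \<and> g x \<sqsubset> s 1"
    and g_lt: "\<And>x y. x \<in> Field r \<Longrightarrow> y \<in> Field r \<Longrightarrow> x \<sqsubset> y \<longleftrightarrow> g x \<sqsubset> g y"
    by (rule between_iso[OF ab]) blast
  have "is_path (g ` B)" by (rule path_image[OF B(1)]) (rule g_lt)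
  moreover have "s 1 \<in> Field r" "\<forall>y\<in>g ` B. \<not> s 1 \<sqsubset> y" using ab carrier g BX asym by blast+
  ultimately have gB: "g ` B \<in> bounded_paths" unfolding bounded_paths_def by blast
  obtain y where y: "y \<in> extensions (g ` B)" using extensions_nonempty[OF gB] by blast
  have "node_ord T p < rank (insert y (g ` B))" if p: "p \<in> x" for p
  proof -
    have pv: "p \<in> vertices r" "ran p \<subseteq> B" using p initial_seg_subset unfolding B(2) branch_def by auto
    have "rank (ran p) \<le> rank (g ` B)"
      by (rule rank_mono[OF ran_bounded_path[OF pv(1)] gB, where h = g]) (use pv(2) BX g_lt in blast)+
    then show ?thesis using rank_insert[OF gB y] vert_ran[OF pv(1)] by simp
  qed
  then have "height T x \<le> rank (insert y (g ` B))"
    unfolding height_def by (intro Least_le) blast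
  then show "height T x < Omega"
    using rank_less_Omega[OF bounded_paths_insert[OF gB y]] by (rule le_less_trans)
qed

end

theorem theorem1p3:
  fixes r :: "'a rel"
  assumes "chlots r"
  shows "is_tree (order_tree r) \<and> bi_ordered (order_tree r) \<and>
    Omega_bounded (order_tree r) \<and> reproductive (order_tree r) \<and>
    height (order_tree r) (nodes (order_tree r)) = Omega \<and>
    (\<exists>f. iso (sord (order_tree r) (root_of (order_tree r))) r f) \<and>
    ihlots (branch_space (order_tree r)) \<and>
    (\<exists>s :: 'a vertex set set rel. is_completion (branch_space (order_tree r)) s \<and> chlots s) \<and>
    (\<forall>s :: 'c rel. is_completion (branch_space (order_tree r)) s \<longrightarrow> chlots s)"
proof -
  interpret order_tree_base r by unfold_locales (rule assms)
  have "ihlots (branch_space T)"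
    using branch_space_hlots branch_space_incomplete unfolding ihlots_def by blast
  moreover have "\<exists>s :: 'a vertex set set rel. is_completion (branch_space T) s \<and> chlots s"
    using cut_rel_completion[OF branch_space_hlots] completion_chlots[OF branch_space_hlots] by blast
  moreover have "\<forall>s :: 'c rel. is_completion (branch_space T) s \<longrightarrow> chlots s"
    using completion_chlots[OF branch_space_hlots] by blast
  ultimately show ?thesis
    using tree bi_ordered_T Omega_bounded_T reproductive_T height_T root_succs_iso by blast
qed

end
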